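(* For any non-commutative bipartite graph $K\subseteq\mathcal{L}(A\to B)$, $\overline{C}_{0EF}(K)\le C_{\min E}(K)$.
   Context: A non-commutative bipartite graph is a subspace $K\subseteq\mathcal{L}(A\to B)$ ($A,B$ finite-dimensional) with $\mathbb{1}_A\in\mathrm{span}\{F^\dagger E:E,F\in K\}$; $\mathcal{K}(\mathcal{N})=\mathrm{span}\{E_j\}$ is the Choi–Kraus space of a channel $\mathcal{N}(\rho)=\sum_jE_j\rho E_j^\dagger$. For a state $\rho$ on $A$ with purification $\phi_\rho$ on $A\otimes A'$, $I(\rho;\mathcal{N})=S(\rho)+S(\mathcal{N}(\rho))-S((\mathrm{id}\otimes\mathcal{N})\phi_\rho)$ ($S$ the von Neumann entropy); $C_E(\mathcal{N})=\max_\rho I(\rho;\mathcal{N})$ and $C_{\min E}(K)=\min\{C_E(\mathcal{N}):\mathcal{K}(\mathcal{N})\subseteq K\}$. Activated feedback-assisted zero-error capacity: a feedback-assisted code with $n$ channel uses and $b$ noiseless bits consists of a pure state $|\phi\rangle\in X_0\otimes Y_0$ and $n+b$ rounds; in round $t$ Alice applies an isometry $U^{(m)}_t:X_{t-1}\otimes F_{t-1}\to A_t\otimes X_t$ depending on message $m$, $A_t$ is sent through a channel with Choi–Kraus space $K$ (in $n$ rounds) or the noiseless bit channel $\rho\mapsto\sum_{j=0,1}|j\rangle\langle j|\rho|j\rangle\langle j|$ (in $b$ rounds), and Bob applies an isometry $W_t:Y_{t-1}\otimes B_t\to F_t\otimes Y_t$ returning $F_t$ to Alice; it is zero-error if Bob's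 final states for distinct messages are orthogonally supported (depends only on $K$). $M_f^{+b}(n;K)$ is the maximal number of messages, $\overline{C}_{0EF}(K)=\sup_b\lim_n\frac1n\log M_f^{+b}(n;K)$. *)

theory Defs
  imports "Jordan_Normal_Form.Char_Poly" "HOL-Library.Extended_Real" "HOL-Library.Liminf_Limsup"
begin

text \<open>Operators in L(C^m -> C^n) are complex n x m matrices; vectors are column
  matrices. Tensor products use the standard index order i*d2 + j.\<close>

definition adj :: "complex mat \<Rightarrow> complex mat" where
  "adj M = mat (dim_col M) (dim_row M) (\<lambda>(i,j). cnj (M $$ (j,i)))"

definition kron :: "complex mat \<Rightarrow> complex mat \<Rightarrow> complex mat" where
  "kron A B = mat (dim_row A * dim_row B) (dim_col A * dim_col B)
     (\<lambda>(i,j). A $$ (i div dim_row B, j div dim_col B) * B $$ (i mod dim_row B, j mod dim_col B))"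

text \<open>swap_mat d1 d2 : C^d1 (x) C^d2 -> C^d2 (x) C^d1, |i>|j> |-> |j>|i>.\<close>
definition swap_mat :: "nat \<Rightarrow> nat \<Rightarrow> complex mat" where
  "swap_mat d1 d2 = mat (d1*d2) (d1*d2) (\<lambda>(r,c). if r = (c mod d2) * d1 + c div d2 then 1 else 0)"

definition ptrace2 :: "nat \<Rightarrow> nat \<Rightarrow> complex mat \<Rightarrow> complex mat" where
  "ptrace2 d1 d2 R = mat d1 d1 (\<lambda>(i,j). \<Sum>k<d2. R $$ (i*d2+k, j*d2+k))"

definition ptrace1 :: "nat \<Rightarrow> nat \<Rightarrow> complex mat \<Rightarrow> complex mat" where
  "ptrace1 d1 d2 R = mat d2 d2 (\<lambda>(i,j). \<Sum>k<d1. R $$ (k*d2+i, k*d2+j))"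

definition msum :: "nat \<Rightarrow> nat \<Rightarrow> complex mat list \<Rightarrow> complex mat" where
  "msum nr nc Ms = foldr (+) Ms (0\<^sub>m nr nc)"

definition mspan :: "nat \<Rightarrow> nat \<Rightarrow> complex mat set \<Rightarrow> complex mat set" where
  "mspan nr nc S = {M. \<exists>cs :: (complex \<times> complex mat) list.
      set (map snd cs) \<subseteq> S \<and> M = msum nr nc (map (\<lambda>(c,E). c \<cdot>\<^sub>m E) cs)}"

definition ncbg :: "nat \<Rightarrow> nat \<Rightarrow> complex mat set \<Rightarrow> bool" where
  "ncbg dA dB K \<longleftrightarrow> 0 < dA \<and> K \<subseteq> carrier_mat dB dA \<and> 0\<^sub>m dB dA \<in> K
     \<and> (\<forall>E\<in>K. \<forall>F\<in>K. E + F \<in> K) \<and> (\<forall>c. \<forall>E\<in>K. c \<cdot>\<^sub>m E \<in> K)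
     \<and> 1\<^sub>m dA \<in> mspan dA dA {adj F * E | E F. E \<in> K \<and> F \<in> K}"

definition density :: "nat \<Rightarrow> complex mat \<Rightarrow> bool" where
  "density d \<rho> \<longleftrightarrow> \<rho> \<in> carrier_mat d d \<and> adj \<rho> = \<rho>
     \<and> (\<forall>v \<in> carrier_mat d 1. Im ((adj v * \<rho> * v) $$ (0,0)) = 0 \<and> Re ((adj v * \<rho> * v) $$ (0,0)) \<ge> 0)
     \<and> (\<Sum>i<d. \<rho> $$ (i,i)) = 1"

definition vN_entropy :: "complex mat \<Rightarrow> real" where
  "vN_entropy \<rho> = (\<Sum>z\<in># proots (char_poly \<rho>). - (Re z * log 2 (Re z)))"

definition is_channel :: "nat \<Rightarrow> nat \<Rightarrow> complex mat list \<Rightarrow> bool" where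
  "is_channel dA dB Es \<longleftrightarrow> (\<forall>E\<in>set Es. E \<in> carrier_mat dB dA)
     \<and> msum dA dA (map (\<lambda>E. adj E * E) Es) = 1\<^sub>m dA"

definition kraus_space :: "nat \<Rightarrow> nat \<Rightarrow> complex mat list \<Rightarrow> complex mat set" where
  "kraus_space dA dB Es = mspan dB dA (set Es)"

definition apply_ch :: "nat \<Rightarrow> complex mat list \<Rightarrow> complex mat \<Rightarrow> complex mat" where
  "apply_ch dB Es \<rho> = msum dB dB (map (\<lambda>E. E * \<rho> * adj E) Es)"

definition is_purification :: "nat \<Rightarrow> complex mat \<Rightarrow> complex mat \<Rightarrow> bool" where
  "is_purification dA \<rho> \<phi> \<longleftrightarrow> \<phi> \<in> carrier_mat (dA*dA) 1 \<and> adj \<phi> * \<phi> = 1\<^sub>m 1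
     \<and> ptrace2 dA dA (\<phi> * adj \<phi>) = \<rho>"

definition mutual_info :: "nat \<Rightarrow> nat \<Rightarrow> complex mat \<Rightarrow> complex mat list \<Rightarrow> real" where
  "mutual_info dA dB \<rho> Es = (let \<phi> = (SOME \<phi>. is_purification dA \<rho> \<phi>) in
     vN_entropy \<rho> + vN_entropy (apply_ch dB Es \<rho>)
     - vN_entropy (apply_ch (dB*dA) (map (\<lambda>E. kron E (1\<^sub>m dA)) Es) (\<phi> * adj \<phi>)))"

definition C_E :: "nat \<Rightarrow> nat \<Rightarrow> complex mat list \<Rightarrow> ereal" where
  "C_E dA dB Es = Sup {ereal (mutual_info dA dB \<rho> Es) | \<rho>. density dA \<rho>}"

definition C_minE :: "nat \<Rightarrow> nat \<Rightarrow> complex mat set \<Rightarrow> ereal" where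
  "C_minE dA dB K = Inf {C_E dA dB Es | Es. is_channel dA dB Es \<and> kraus_space dA dB Es \<subseteq> K}"

text \<open>Round t (1 \<le> t \<le> n+b) uses the channel iff sched t, otherwise the noiseless bit channel.
  Registers: X_t (dim xd t), Y_t (dim yd t), F_t (dim fd t), fd 0 = 1.
  Global state at time t lives on X_t (x) F_t (x) Y_t.
  U m t : X_{t-1} (x) F_{t-1} -> A_t (x) X_t ;  W t : Y_{t-1} (x) B_t -> F_t (x) Y_t.\<close>
record fcode =
  sched :: "nat \<Rightarrow> bool"
  xd :: "nat \<Rightarrow> nat"
  yd :: "nat \<Rightarrow> nat"
  fd :: "nat \<Rightarrow> nat"
  phi0 :: "complex mat"
  Uop :: "nat \<Rightarrow> nat \<Rightarrow> complex mat"
  Wop :: "nat \<Rightarrow> complex mat"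

definition bit_kraus :: "complex mat list" where
  "bit_kraus = [mat 2 2 (\<lambda>(i,j). if i = 0 \<and> j = 0 then 1 else 0),
                mat 2 2 (\<lambda>(i,j). if i = 1 \<and> j = 1 then 1 else 0)]"

definition in_dim :: "nat \<Rightarrow> fcode \<Rightarrow> nat \<Rightarrow> nat" where
  "in_dim dA c t = (if sched c t then dA else 2)"

definition out_dim :: "nat \<Rightarrow> fcode \<Rightarrow> nat \<Rightarrow> nat" where
  "out_dim dB c t = (if sched c t then dB else 2)"

definition isometry :: "nat \<Rightarrow> nat \<Rightarrow> complex mat \<Rightarrow> bool" where
  "isometry din dout V \<longleftrightarrow> V \<in> carrier_mat dout din \<and> adj V * V = 1\<^sub>m din"

definition code_ok :: "nat \<Rightarrow> nat \<Rightarrow> nat \<Rightarrow> nat \<Rightarrow> nat \<Rightarrow> fcode \<Rightarrow> bool" where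
  "code_ok dA dB n b M c \<longleftrightarrow>
     card {t \<in> {1..n+b}. sched c t} = n
     \<and> (\<forall>t. 0 < xd c t \<and> 0 < yd c t \<and> 0 < fd c t) \<and> fd c 0 = 1
     \<and> isometry 1 (xd c 0 * yd c 0) (phi0 c)
     \<and> (\<forall>m<M. \<forall>t\<in>{1..n+b}. isometry (xd c (t-1) * fd c (t-1)) (in_dim dA c t * xd c t) (Uop c m t))
     \<and> (\<forall>t\<in>{1..n+b}. isometry (yd c (t-1) * out_dim dB c t) (fd c t * yd c t) (Wop c t))"

definition round_op :: "nat \<Rightarrow> fcode \<Rightarrow> nat \<Rightarrow> nat \<Rightarrow> complex mat \<Rightarrow> complex mat" where
  "round_op dB c m t E =
     kron (1\<^sub>m (xd c t)) (Wop c t)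
     * swap_mat (out_dim dB c t) (xd c t * yd c (t-1))
     * kron E (1\<^sub>m (xd c t * yd c (t-1)))
     * kron (Uop c m t) (1\<^sub>m (yd c (t-1)))"

definition round_kraus :: "complex mat list \<Rightarrow> fcode \<Rightarrow> nat \<Rightarrow> complex mat list" where
  "round_kraus Es c t = (if sched c t then Es else bit_kraus)"

fun glob_state :: "nat \<Rightarrow> complex mat list \<Rightarrow> fcode \<Rightarrow> nat \<Rightarrow> nat \<Rightarrow> complex mat" where
  "glob_state dB Es c m 0 = phi0 c * adj (phi0 c)"
| "glob_state dB Es c m (Suc t) =
     (let D = xd c (Suc t) * fd c (Suc t) * yd c (Suc t) in
      msum D D (map (\<lambda>E. round_op dB c m (Suc t) E * glob_state dB Es c m t
                          * adj (round_op dB c m (Suc t) E)) (round_kraus Es c (Suc t))))"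

definition bob_state :: "nat \<Rightarrow> complex mat list \<Rightarrow> fcode \<Rightarrow> nat \<Rightarrow> nat \<Rightarrow> complex mat" where
  "bob_state dB Es c m T = ptrace1 (xd c T * fd c T) (yd c T) (glob_state dB Es c m T)"

definition orth_supp :: "nat \<Rightarrow> complex mat \<Rightarrow> complex mat \<Rightarrow> bool" where
  "orth_supp d \<rho> \<sigma> \<longleftrightarrow> (\<forall>u \<in> carrier_mat d 1. \<forall>v \<in> carrier_mat d 1. adj (\<rho> * u) * (\<sigma> * v) = 0\<^sub>m 1 1)"

definition zero_error :: "nat \<Rightarrow> nat \<Rightarrow> complex mat set \<Rightarrow> nat \<Rightarrow> nat \<Rightarrow> nat \<Rightarrow> fcode \<Rightarrow> bool" where
  "zero_error dA dB K n b M c \<longleftrightarrow>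
     (\<forall>Es. is_channel dA dB Es \<and> kraus_space dA dB Es = K \<longrightarrow>
        (\<forall>m<M. \<forall>m'<M. m \<noteq> m' \<longrightarrow>
           orth_supp (yd c (n+b)) (bob_state dB Es c m (n+b)) (bob_state dB Es c m' (n+b))))"

definition M_f :: "nat \<Rightarrow> nat \<Rightarrow> complex mat set \<Rightarrow> nat \<Rightarrow> nat \<Rightarrow> nat" where
  "M_f dA dB K b n = (GREATEST M. \<exists>c. code_ok dA dB n b M c \<and> zero_error dA dB K n b M c)"

definition C0EF_act :: "nat \<Rightarrow> nat \<Rightarrow> complex mat set \<Rightarrow> ereal" where
  "C0EF_act dA dB K = (SUP b. limsup (\<lambda>n. ereal (log 2 (real (M_f dA dB K b n)) / real n)))"

end

theory Submission
  imports Defs "Jordan_Normal_Form.Schur_Decomposition"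
begin

text \<open>
  Fix a channel \<open>N\<close> whose Choi-Kraus space lies in \<open>K\<close>; a zero-error code for \<open>K\<close> is one for \<open>N\<close>, since
  every amplitude under \<open>N\<close> is a linear combination of amplitudes under a channel spanning \<open>K\<close>. For a
  uniformly random message, follow the Holevo quantity of the receiver's register. It starts at 0 and ends
  at \<open>log M\<close>, because the final states are orthogonal. Handing the feedback register over cannot increase
  it. One use of \<open>N\<close> increases it by at most \<open>S(\<rho>) + S(N(\<rho>)) - S(N\<^sup>c(\<rho>))\<close>, where \<open>\<rho>\<close> is the average input and
  \<open>N\<^sup>c\<close> the complementary channel, and this is the mutual information \<open>I(\<rho>; N)\<close>; a noiseless bit contributes
  a bounded amount, which disappears in the limit. Both estimates are instances of strong subadditivity,
  applied to vectors in which the message label is copied into the environment.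

  Strong subadditivity is obtained from a variational formula for the derivative of the relative entropy
  along a resolvent parameter, for which monotonicity under partial traces is evident.
\<close>

section \<open>Spectral decompositions and entropy\<close>

text \<open>In the entropy estimates states never appear as matrices. Every reduced state is a
  \<open>gram\<close> kernel of an amplitude family: one index runs over the system, the other over
  everything traced out. A partial trace moves a component from the first index to the second, a
  purification is always at hand, and complementary systems have equal entropy by the Schmidt
  decomposition. Matrices return only where the round operators are unfolded and where
  \<open>mutual_info\<close> is evaluated. A copied label makes a kernel block diagonal, so its
  entropy is exactly the sum over messages that a Holevo quantity subtracts. Quadratic functionals
  are used because they avoid logarithms of operators: only scalar logarithms of eigenvalues are
  ever differentiated. Two difficulties come from the definitions: zero error is demanded only of
  channels spanning exactly \<open>K\<close>, which need not exist, and a largest number of messages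
  need not exist either. The bound on \<open>M_f\<close> therefore carries a constant independent of
  the block length.\<close>

definition ip :: "'i set \<Rightarrow> ('i \<Rightarrow> complex) \<Rightarrow> ('i \<Rightarrow> complex) \<Rightarrow> complex" where
  "ip I u v = (\<Sum>i\<in>I. cnj (u i) * v i)"

definition orthon :: "'i set \<Rightarrow> 'k set \<Rightarrow> ('k \<Rightarrow> 'i \<Rightarrow> complex) \<Rightarrow> bool" where
  "orthon I N v \<longleftrightarrow> (\<forall>k\<in>N. \<forall>l\<in>N. ip I (v k) (v l) = (if k = l then 1 else 0))"

text \<open>Only the non-zero eigenvalues are listed, so \<open>N\<close> indexes the range of \<open>R\<close>.\<close>
definition spec :: "'i set \<Rightarrow> ('i \<Rightarrow> 'i \<Rightarrow> complex) \<Rightarrow> 'k set \<Rightarrow> ('k \<Rightarrow> real) \<Rightarrow> ('k \<Rightarrow> 'i \<Rightarrow> complex) \<Rightarrow> bool" where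
  "spec I R N p v \<longleftrightarrow> finite N \<and> (\<forall>k\<in>N. p k > 0) \<and> orthon I N v \<and>
     (\<forall>i\<in>I. \<forall>j\<in>I. R i j = (\<Sum>k\<in>N. of_real (p k) * v k i * cnj (v k j)))"

text \<open>The reduced state on \<open>I\<close> of the possibly unnormalised vector
  \<open>\<Psi>\<close> on \<open>I\<close> times \<open>E\<close>. Positivity is built in, and a
  purification is part of the data.\<close>

definition gram :: "'e set \<Rightarrow> ('i \<Rightarrow> 'e \<Rightarrow> complex) \<Rightarrow> 'i \<Rightarrow> 'i \<Rightarrow> complex" where
  "gram E \<Psi> i j = (\<Sum>e\<in>E. \<Psi> i e * cnj (\<Psi> j e))"

lemma sum_swap3: "(\<Sum>a\<in>A. \<Sum>b\<in>B. \<Sum>c\<in>C. f a b c) = (\<Sum>c\<in>C. \<Sum>a\<in>A. \<Sum>b\<in>B. f a b c)"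
  by (rule trans[OF sum.cong[OF refl sum.swap] sum.swap])

section \<open>Inner products, orthonormal families and Bessel's inequality\<close>

lemma ip_self: "ip I u u = of_real (\<Sum>i\<in>I. (cmod (u i))\<^sup>2)"
  unfolding ip_def of_real_sum
  by (intro sum.cong refl) (simp add: complex_norm_square[symmetric] mult.commute)

lemma cnj_ip: "cnj (ip I u v) = ip I v u"
  unfolding ip_def cnj_sum by (intro sum.cong refl) (simp add: mult.commute)

lemma ip_cong: "(\<And>i. i \<in> I \<Longrightarrow> u i = u' i) \<Longrightarrow> (\<And>i. i \<in> I \<Longrightarrow> v i = v' i) \<Longrightarrow> ip I u v = ip I u' v'"
  unfolding ip_def by (intro sum.cong) auto

lemma ip_sum_right: "ip I u (\<lambda>i. \<Sum>k\<in>N. c k * v k i) = (\<Sum>k\<in>N. c k * ip I u (v k))"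
  unfolding ip_def sum_distrib_left by (subst sum.swap) (simp add: mult_ac)

lemma ip_sum_left: "ip I (\<lambda>i. \<Sum>k\<in>N. c k * v k i) u = (\<Sum>k\<in>N. cnj (c k) * ip I (v k) u)"
  unfolding ip_def sum_distrib_left cnj_sum sum_distrib_right by (subst sum.swap) (simp add: mult_ac)

lemma ip_scale_right: "ip I u (\<lambda>i. c * v i) = c * ip I u v"
  unfolding ip_def sum_distrib_left by (simp add: mult_ac)

lemma ip_diff_right: "ip I u (\<lambda>i. v i - w i) = ip I u v - ip I u w"
  unfolding ip_def by (simp add: algebra_simps sum_subtractf)

lemma ip_diff_left: "ip I (\<lambda>i. v i - w i) u = ip I v u - ip I w u"
  unfolding ip_def by (simp add: algebra_simps sum_subtractf)

lemma complex_mult_cnj_cmod2: "z * cnj z = of_real ((cmod z)\<^sup>2)"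
  by (rule complex_norm_square[symmetric])

lemma orthonD: "orthon I N v \<Longrightarrow> k \<in> N \<Longrightarrow> l \<in> N \<Longrightarrow> ip I (v k) (v l) = (if k = l then 1 else 0)"
  unfolding orthon_def by blast

text \<open>Both cross terms and the double sum of the expanded square reduce to the sum of squared
  coefficients. The exact residual is recorded because the equality case matters too: a vector equal
  to its projection keeps its norm.\<close>

lemma bessel_residual:
  assumes "orthon I N v" "finite N"
  shows "ip I (\<lambda>i. x i - (\<Sum>k\<in>N. ip I (v k) x * v k i)) (\<lambda>i. x i - (\<Sum>k\<in>N. ip I (v k) x * v k i))
    = ip I x x - (\<Sum>k\<in>N. of_real ((cmod (ip I (v k) x))\<^sup>2))"
proof -
  have 1: "(\<Sum>k\<in>N. cnj (ip I (v k) x) * (\<Sum>l\<in>N. ip I (v l) x * ip I (v k) (v l))) 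
     = (\<Sum>k\<in>N. of_real ((cmod (ip I (v k) x))\<^sup>2))"
  proof (rule sum.cong[OF refl])
    fix k assume k: "k \<in> N"
    have "(\<Sum>l\<in>N. ip I (v l) x * ip I (v k) (v l)) = (\<Sum>l\<in>N. if l = k then ip I (v k) x else 0)"
      using orthonD[OF assms(1) k] by (intro sum.cong refl) auto
    also have "\<dots> = ip I (v k) x" using k assms(2) by simp
    finally show "cnj (ip I (v k) x) * (\<Sum>l\<in>N. ip I (v l) x * ip I (v k) (v l)) = of_real ((cmod (ip I (v k) x))\<^sup>2)"
      by (simp add: complex_mult_cnj_cmod2[symmetric] mult.commute del: of_real_power)
  qed
  have 2: "(\<Sum>k\<in>N. cnj (ip I (v k) x) * ip I (v k) x) = (\<Sum>k\<in>N. of_real ((cmod (ip I (v k) x))\<^sup>2))"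
    by (intro sum.cong refl) (simp add: complex_mult_cnj_cmod2[symmetric] mult.commute del: of_real_power)
  have 3: "(\<Sum>k\<in>N. ip I (v k) x * ip I x (v k)) = (\<Sum>k\<in>N. of_real ((cmod (ip I (v k) x))\<^sup>2))"
    by (intro sum.cong refl) (simp add: complex_mult_cnj_cmod2[symmetric] cnj_ip del: of_real_power)
  show ?thesis
    unfolding ip_diff_left ip_diff_right ip_sum_left ip_sum_right 1 2 3 by simp
qed

lemma bessel:
  assumes "orthon I N v" "finite N"
  shows "(\<Sum>k\<in>N. (cmod (ip I (v k) x))\<^sup>2) \<le> (\<Sum>i\<in>I. (cmod (x i))\<^sup>2)"
proof -
  let ?r = "\<lambda>i. x i - (\<Sum>k\<in>N. ip I (v k) x * v k i)"
  have "complex_of_real (\<Sum>i\<in>I. (cmod (?r i))\<^sup>2) = of_real ((\<Sum>i\<in>I. (cmod (x i))\<^sup>2) - (\<Sum>k\<in>N. (cmod (ip I (v k) x))\<^sup>2))"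
    using bessel_residual[OF assms, of x] unfolding ip_self by simp
  then have "(\<Sum>i\<in>I. (cmod (?r i))\<^sup>2) = (\<Sum>i\<in>I. (cmod (x i))\<^sup>2) - (\<Sum>k\<in>N. (cmod (ip I (v k) x))\<^sup>2)"
    using of_real_eq_iff by blast
  then show ?thesis using sum_nonneg[of I "\<lambda>i. (cmod (?r i))\<^sup>2"] by simp
qed

section \<open>Eigenvectors and uniqueness of the spectrum\<close>

lemma spec_apply:
  assumes "spec I R N p v" "i \<in> I"
  shows "(\<Sum>j\<in>I. R i j * x j) = (\<Sum>k\<in>N. of_real (p k) * ip I (v k) x * v k i)"
proof -
  have "(\<Sum>j\<in>I. R i j * x j) = (\<Sum>j\<in>I. \<Sum>k\<in>N. of_real (p k) * v k i * cnj (v k j) * x j)"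
    using assms unfolding spec_def by (intro sum.cong refl) (simp add: sum_distrib_right)
  also have "\<dots> = (\<Sum>k\<in>N. of_real (p k) * ip I (v k) x * v k i)"
    unfolding ip_def sum_distrib_left sum_distrib_right by (subst sum.swap) (simp add: mult_ac)
  finally show ?thesis .
qed

lemma spec_eigen:
  assumes "spec I R N p v" "i \<in> I" "k \<in> N"
  shows "(\<Sum>j\<in>I. R i j * v k j) = of_real (p k) * v k i"
proof -
  have o: "orthon I N v" and f: "finite N" using assms(1) unfolding spec_def by auto
  have "(\<Sum>j\<in>I. R i j * v k j) = (\<Sum>l\<in>N. if l = k then of_real (p k) * v k i else 0)"
    unfolding spec_apply[OF assms(1,2)] using orthonD[OF o _ assms(3)] by (intro sum.cong refl) auto
  then show ?thesis using assms(3) f by simp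
qed

text \<open>Evaluating the form of \<open>R\<close> between \<open>w l\<close> and
  \<open>v k\<close> through either eigenvalue multiplies the same overlap by \<open>q l\<close> and
  by \<open>p k\<close>.\<close>

lemma spec_overlap:
  assumes s: "spec I R N p v" and t: "spec I R L q w" and k: "k \<in> N" and l: "l \<in> L"
  shows "ip I (w l) (v k) = 0 \<or> q l = p k"
proof -
  have fL: "finite L" and oL: "orthon I L w" using t unfolding spec_def by auto
  have "of_real (p k) * ip I (w l) (v k) = ip I (w l) (\<lambda>i. \<Sum>l\<in>L. of_real (q l) * ip I (w l) (v k) * w l i)"
    using spec_eigen[OF s _ k] spec_apply[OF t, of _ "v k"]
    by (subst ip_scale_right[symmetric], intro ip_cong) auto
  also have "\<dots> = (\<Sum>l'\<in>L. if l' = l then of_real (q l) * ip I (w l) (v k) else 0)"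
    unfolding ip_sum_right using orthonD[OF oL l] by (intro sum.cong refl) auto
  also have "\<dots> = of_real (q l) * ip I (w l) (v k)" using l fL by simp
  finally show ?thesis by auto
qed

text \<open>Since \<open>p k\<close> is positive, \<open>v k\<close> lies in the range of
  \<open>R\<close>, which the \<open>w l\<close> span, so this is Parseval's identity. Expanding
  \<open>R\<close> produces the weight \<open>q l\<close>, which equals \<open>p k\<close> wherever
  the overlap is non-zero.\<close>

lemma spec_overlap_sum:
  assumes s: "spec I R N p v" and t: "spec I R L q w" and k: "k \<in> N"
  shows "(\<Sum>l\<in>L. (cmod (ip I (w l) (v k)))\<^sup>2) = 1"
proof -
  have pk: "p k > 0" and o: "orthon I N v" using s k unfolding spec_def by auto
  have "of_real (p k) * ip I (v k) (v k) = ip I (v k) (\<lambda>i. \<Sum>l\<in>L. of_real (q l) * ip I (w l) (v k) * w l i)"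
    using spec_eigen[OF s _ k] spec_apply[OF t, of _ "v k"]
    by (subst ip_scale_right[symmetric], intro ip_cong) auto
  also have "\<dots> = (\<Sum>l\<in>L. of_real (p k) * (ip I (w l) (v k) * cnj (ip I (w l) (v k))))"
    unfolding ip_sum_right cnj_ip using spec_overlap[OF s t k] by (intro sum.cong refl) fastforce
  also have "\<dots> = of_real (p k * (\<Sum>l\<in>L. (cmod (ip I (w l) (v k)))\<^sup>2))"
    unfolding complex_mult_cnj_cmod2 by (simp add: sum_distrib_left)
  finally have "complex_of_real (p k) = of_real (p k * (\<Sum>l\<in>L. (cmod (ip I (w l) (v k)))\<^sup>2))"
    using orthonD[OF o k k] by simp
  then have "p k = p k * (\<Sum>l\<in>L. (cmod (ip I (w l) (v k)))\<^sup>2)" using of_real_eq_iff by blast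
  then show ?thesis using pk by simp
qed

lemma cmod_ip_commute: "cmod (ip I u v) = cmod (ip I v u)"
  using complex_mod_cnj[of "ip I u v"] unfolding cnj_ip by simp

text \<open>The overlaps \<open>|\<langle>w\<^sub>l, v\<^sub>k\<rangle>|\<^sup>2\<close> of two eigenbases couple only equal eigenvalues and are doubly stochastic.\<close>
lemma spec_unique:
  fixes f :: "real \<Rightarrow> real"
  assumes s: "spec I R N p v" and t: "spec I R L q w"
  shows "(\<Sum>k\<in>N. f (p k)) = (\<Sum>l\<in>L. f (q l))"
proof -
  have "(\<Sum>k\<in>N. f (p k)) = (\<Sum>k\<in>N. \<Sum>l\<in>L. (cmod (ip I (w l) (v k)))\<^sup>2 * f (p k))"
    by (simp add: sum_distrib_right[symmetric] spec_overlap_sum[OF s t])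
  also have "\<dots> = (\<Sum>k\<in>N. \<Sum>l\<in>L. (cmod (ip I (v k) (w l)))\<^sup>2 * f (q l))"
  proof (intro sum.cong refl)
    fix k l assume "k \<in> N" "l \<in> L"
    from spec_overlap[OF s t this] show "(cmod (ip I (w l) (v k)))\<^sup>2 * f (p k) = (cmod (ip I (v k) (w l)))\<^sup>2 * f (q l)"
      by (auto simp: cmod_ip_commute[of I "v k" "w l"])
  qed
  also have "\<dots> = (\<Sum>l\<in>L. \<Sum>k\<in>N. (cmod (ip I (v k) (w l)))\<^sup>2 * f (q l))" by (rule sum.swap)
  also have "\<dots> = (\<Sum>l\<in>L. f (q l))"
    by (simp add: sum_distrib_right[symmetric] spec_overlap_sum[OF t s])
  finally show ?thesis .
qed

text \<open>With the natural logarithm; well-defined by \<open>spec_unique\<close>.\<close>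
definition ent :: "'i set \<Rightarrow> ('i \<Rightarrow> 'i \<Rightarrow> complex) \<Rightarrow> real" where
  "ent I R = (THE s. \<exists>(N :: nat set) p v. spec I R N p v \<and> s = (\<Sum>k\<in>N. - (p k * ln (p k))))"

text \<open>\<open>ent\<close> quantifies over eigendata indexed by natural numbers; this
  relabelling lets eigendata with any index type, such as pairs, be used to compute it.\<close>

lemma spec_reindex_index:
  assumes s: "spec I R N p v" and f: "inj_on f N"
  shows "spec I R (f ` N) (p \<circ> inv_into N f) (v \<circ> inv_into N f)"
proof -
  have i: "inv_into N f (f k) = k" if "k \<in> N" for k using f that by simp
  show ?thesis using s f unfolding spec_def orthon_def
    by (auto simp: i sum.reindex inj_on_eq_iff intro!: sum.cong)
qed

lemma ent_eq:
  assumes s: "spec I R N p v"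
  shows "ent I R = (\<Sum>k\<in>N. - (p k * ln (p k)))"
proof -
  have fN: "finite N" using s unfolding spec_def by simp
  obtain f :: "'b \<Rightarrow> nat" where f: "inj_on f N" using finite_imp_inj_to_nat_seg[OF fN] by blast
  note s' = spec_reindex_index[OF s f]
  show ?thesis unfolding ent_def
  proof (rule the_equality)
    show "\<exists>(N' :: nat set) p' v. spec I R N' p' v \<and> (\<Sum>k\<in>N. - (p k * ln (p k))) = (\<Sum>k\<in>N'. - (p' k * ln (p' k)))"
      using s' spec_unique[OF s s', of "\<lambda>x. - (x * ln x)"] by blast
  next
    fix r assume "\<exists>(N' :: nat set) p' v. spec I R N' p' v \<and> r = (\<Sum>k\<in>N'. - (p' k * ln (p' k)))"
    then show "r = (\<Sum>k\<in>N. - (p k * ln (p k)))"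
      using spec_unique[OF _ s, of _ _ _ "\<lambda>x. - (x * ln x)"] by blast
  qed
qed

lemma ent_cong:
  assumes "\<And>i j. i \<in> I \<Longrightarrow> j \<in> I \<Longrightarrow> R i j = R' i j"
  shows "ent I R = ent I R'"
proof -
  have "spec I R (N :: nat set) p v = spec I R' N p v" for N p v
    using assms unfolding spec_def by auto
  then show ?thesis unfolding ent_def by simp
qed

section \<open>The spectral theorem for Hermitian kernels\<close>

lemma herm_ip:
  assumes "\<And>i j. i \<in> I \<Longrightarrow> j \<in> I \<Longrightarrow> R j i = cnj (R i j)"
  shows "ip I x (\<lambda>i. \<Sum>j\<in>I. R i j * y j) = ip I (\<lambda>i. \<Sum>j\<in>I. R i j * x j) y"
proof -
  have "ip I x (\<lambda>i. \<Sum>j\<in>I. R i j * y j) = (\<Sum>i\<in>I. \<Sum>j\<in>I. cnj (x i) * R i j * y j)"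
    unfolding ip_def sum_distrib_left by (simp add: mult_ac)
  also have "\<dots> = (\<Sum>j\<in>I. \<Sum>i\<in>I. cnj (x i) * cnj (R j i) * y j)"
    using assms by (subst sum.swap) (intro sum.cong refl, metis)
  also have "\<dots> = ip I (\<lambda>i. \<Sum>j\<in>I. R i j * x j) y"
    unfolding ip_def cnj_sum sum_distrib_right by (simp add: mult_ac)
  finally show ?thesis .
qed

lemma mult_mat_entry:
  assumes "A \<in> carrier_mat n k" "B \<in> carrier_mat k m" "i < n" "j < m"
  shows "(A * B) $$ (i, j) = (\<Sum>l<k. A $$ (i, l) * B $$ (l, j))"
  using assms by (auto simp: scalar_prod_def atLeast0LessThan)

lemma trace_mult_comm:
  assumes "A \<in> carrier_mat n n" "B \<in> carrier_mat n n"
  shows "(\<Sum>i<n. (A * B) $$ (i, i)) = (\<Sum>i<n. (B * A) $$ (i, i) :: complex)"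
proof -
  have "(\<Sum>i<n. (A * B) $$ (i, i)) = (\<Sum>i<n. \<Sum>l<n. A $$ (i, l) * B $$ (l, i))"
    using mult_mat_entry[OF assms] by simp
  also have "\<dots> = (\<Sum>l<n. \<Sum>i<n. B $$ (l, i) * A $$ (i, l))"
    by (subst sum.swap) (simp add: mult.commute)
  also have "\<dots> = (\<Sum>i<n. (B * A) $$ (i, i))"
    using mult_mat_entry[OF assms(2,1)] by simp
  finally show ?thesis .
qed

text \<open>If all eigenvalues vanish, a Schur form is strictly upper triangular, so the trace of the square,
  which is the sum of all \<open>|R\<^sub>i\<^sub>j|\<^sup>2\<close>, vanishes.\<close>
lemma hermitian_nonzero_eigenvalue:
  fixes R :: "nat \<Rightarrow> nat \<Rightarrow> complex"
  assumes herm: "\<And>i j. i < n \<Longrightarrow> j < n \<Longrightarrow> R j i = cnj (R i j)"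
    and nz: "a < n" "b < n" "R a b \<noteq> 0"
  shows "\<exists>\<mu> u. \<mu> \<noteq> 0 \<and> (\<exists>i<n. u i \<noteq> 0) \<and> (\<forall>i<n. (\<Sum>j<n. R i j * u j) = \<mu> * u i)"
proof -
  define A where "A = mat n n (\<lambda>(i, j). R i j)"
  have A: "A \<in> carrier_mat n n" unfolding A_def by simp
  obtain es where cp: "char_poly A = (\<Prod>a\<leftarrow>es. [:- a, 1:])"
    using char_poly_factorized[OF A] by blast
  obtain B P Q where BPQ: "schur_decomposition A es = (B, P, Q)" by (cases "schur_decomposition A es") auto
  from schur_decomposition[OF A cp BPQ]
  have sim: "similar_mat_wit A B P Q" and ut: "upper_triangular B" and diag: "diag_mat B = es" by auto
  from similar_mat_witD2[OF A sim] have PQ: "P * Q = 1\<^sub>m n" "Q * P = 1\<^sub>m n" "A = P * B * Q"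
    and B: "B \<in> carrier_mat n n" and P: "P \<in> carrier_mat n n" and Q: "Q \<in> carrier_mat n n" by auto
  have "\<exists>e\<in>set es. e \<noteq> 0"
  proof (rule ccontr)
    assume "\<not> ?thesis"
    then have "B $$ (i, i) = 0" if "i < n" for i
      using that B unfolding diag[symmetric] diag_mat_def by auto
    then have B0: "B $$ (i, j) = 0" if "j \<le> i" "i < n" for i j
      using that ut B unfolding upper_triangular_def by (cases "i = j") auto
    have "A * A = P * B * Q * (P * B * Q)" using PQ by simp
    also have "\<dots> = P * B * (Q * P) * B * Q"
      using P B Q by (simp add: assoc_mult_mat[of _ n n _ n _ n])
    also have "\<dots> = P * (B * B * Q)" unfolding PQ using P B Q
      by (simp add: assoc_mult_mat[of _ n n _ n _ n])
    finally have AA: "A * A = P * (B * B * Q)" .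
    have "(\<Sum>i<n. (A * A) $$ (i, i)) = (\<Sum>i<n. (B * B * Q * P) $$ (i, i))"
      unfolding AA using P B Q by (intro trace_mult_comm) auto
    also have "B * B * Q * P = B * B" using P B Q PQ by (simp add: assoc_mult_mat[of _ n n _ n _ n])
    also have "(\<Sum>i<n. (B * B) $$ (i, i)) = 0"
    proof (intro sum.neutral ballI)
      fix i assume "i \<in> {..<n}"
      then have i: "i < n" by simp
      show "(B * B) $$ (i, i) = 0"
        unfolding mult_mat_entry[OF B B i i]
      proof (intro sum.neutral ballI)
        fix l assume "l \<in> {..<n}"
        then show "B $$ (i, l) * B $$ (l, i) = 0"
          using B0[of l i] B0[of i l] i by (cases "l \<le> i") auto
      qed
    qed
    finally have "(\<Sum>i<n. \<Sum>l<n. A $$ (i, l) * A $$ (l, i)) = 0"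
      using mult_mat_entry[OF A A] by simp
    also have "(\<Sum>i<n. \<Sum>l<n. A $$ (i, l) * A $$ (l, i)) = (\<Sum>i<n. \<Sum>l<n. of_real ((cmod (R i l))\<^sup>2))"
    proof (intro sum.cong refl)
      fix i l assume "i \<in> {..<n}" "l \<in> {..<n}"
      then show "A $$ (i, l) * A $$ (l, i) = of_real ((cmod (R i l))\<^sup>2)"
        unfolding complex_mult_cnj_cmod2[symmetric] using herm[of i l] unfolding A_def by simp
    qed
    finally have "complex_of_real (\<Sum>i<n. \<Sum>l<n. (cmod (R i l))\<^sup>2) = 0" by simp
    then have "(\<Sum>i<n. \<Sum>l<n. (cmod (R i l))\<^sup>2) = 0" using of_real_eq_0_iff by blast
    then have "(\<Sum>l<n. (cmod (R a l))\<^sup>2) = 0" using nz(1) by (subst (asm) sum_nonneg_eq_0_iff) (auto intro: sum_nonneg)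
    then have "(cmod (R a b))\<^sup>2 = 0" using nz(2) by (subst (asm) sum_nonneg_eq_0_iff) auto
    then show False using nz(3) by simp
  qed
  then obtain e where e: "e \<in> set es" "e \<noteq> 0" by blast
  have "poly (char_poly A) e = 0" unfolding cp using e(1) by (induction es) auto
  then have "eigenvalue A e" using eigenvalue_root_char_poly[OF A] by simp
  then obtain v where v: "v \<in> carrier_vec n" "v \<noteq> 0\<^sub>v n" "A *\<^sub>v v = e \<cdot>\<^sub>v v"
    unfolding eigenvalue_def eigenvector_def using A by auto
  have 1: "\<exists>i<n. v $ i \<noteq> 0" using v(1,2) by (metis eq_vecI carrier_vecD index_zero_vec(1,2))
  have 2: "(\<Sum>j<n. R i j * v $ j) = e * v $ i" if "i < n" for i
  proof -
    have "(A *\<^sub>v v) $ i = (\<Sum>j<n. R i j * v $ j)"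
      using that v(1) unfolding A_def by (simp add: scalar_prod_def atLeast0LessThan)
    then show ?thesis using v that by simp
  qed
  show ?thesis using e(2) 1 2 by (intro exI[of _ e] exI[of _ "\<lambda>i. v $ i"]) auto
qed

text \<open>Deflation: the eigenvectors already found are moved into the kernel of a shifted copy
  \<open>A\<close> of \<open>R\<close>, and any eigenvector of \<open>A\<close> with non-zero
  eigenvalue is then orthogonal to them and is again an eigenvector of \<open>R\<close>.\<close>

lemma spectral_theorem_partial:
  fixes R :: "nat \<Rightarrow> nat \<Rightarrow> complex"
  assumes herm: "\<And>i j. i < n \<Longrightarrow> j < n \<Longrightarrow> R j i = cnj (R i j)" and "m \<le> n"
  shows "\<exists>(l :: nat \<Rightarrow> real) v. orthon {..<n} {..<m} v \<and>
    (\<forall>k<m. \<forall>i<n. (\<Sum>j<n. R i j * v k j) = of_real (l k) * v k i)"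
  using assms(2)
proof (induction m)
  case 0
  then show ?case by (simp add: orthon_def)
next
  case (Suc m)
  then obtain l :: "nat \<Rightarrow> real" and v where o: "orthon {..<n} {..<m} v"
    and ev: "\<And>k i. k < m \<Longrightarrow> i < n \<Longrightarrow> (\<Sum>j<n. R i j * v k j) = of_real (l k) * v k i" by auto
  define tr where "tr = (\<Sum>i<n. Re (R i i))"
  \<comment> \<open>The shift is solved from the requirement that the deflated \<open>A\<close> has
    trace 1. Hence \<open>A\<close> is not zero and has a non-zero eigenvalue. The division is
    legitimate because \<open>m < n\<close>.\<close>
  define c where "c = (1 - tr + (\<Sum>k<m. l k)) / real (n - m)"
  define A where "A = (\<lambda>i j. R i j + (if i = j then of_real c else 0) - (\<Sum>k<m. of_real (l k + c) * v k i * cnj (v k j)))"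
  have hermA: "A j i = cnj (A i j)" if "i < n" "j < n" for i j
    unfolding A_def using herm[OF that] by (auto simp: mult_ac)
  have R: "R i i = of_real (Re (R i i))" if "i < n" for i
    using herm[OF that that] by (simp add: complex_eq_iff)
  have nrm: "(\<Sum>i<n. v k i * cnj (v k i)) = 1" if "k < m" for k
    using orthonD[OF o, of k k] that unfolding ip_def by (simp add: mult.commute)
  have "(\<Sum>i<n. A i i) = (\<Sum>i<n. R i i) + of_nat n * of_real c - (\<Sum>i<n. \<Sum>k<m. of_real (l k + c) * (v k i * cnj (v k i)))"
    unfolding A_def by (simp add: sum.distrib sum_subtractf mult.assoc)
  also have "(\<Sum>i<n. \<Sum>k<m. of_real (l k + c) * (v k i * cnj (v k i))) = (\<Sum>k<m. of_real (l k + c))"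
    by (subst sum.swap) (simp add: sum_distrib_left[symmetric] nrm)
  also have "(\<Sum>i<n. R i i) = of_real tr" unfolding tr_def of_real_sum using R by (intro sum.cong) auto
  also have "of_real tr + of_nat n * of_real c - (\<Sum>k<m. of_real (l k + c)) 
      = complex_of_real (tr + real n * c - (\<Sum>k<m. l k) - real m * c)"
    by (simp add: sum.distrib)
  also have "tr + real n * c - (\<Sum>k<m. l k) - real m * c = 1"
  proof -
    have "c * (real n - real m) = 1 - tr + (\<Sum>k<m. l k)"
      using Suc.prems unfolding c_def by (simp add: of_nat_diff)
    then show ?thesis by (simp add: algebra_simps)
  qed
  finally have "(\<Sum>i<n. A i i) \<noteq> 0" by simp
  then obtain a where a: "a < n" "A a a \<noteq> 0" by (meson lessThan_iff sum.neutral)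
  obtain \<mu> u where mu: "\<mu> \<noteq> 0" "\<exists>i<n. u i \<noteq> 0" and Au: "\<And>i. i < n \<Longrightarrow> (\<Sum>j<n. A i j * u j) = \<mu> * u i"
    using hermitian_nonzero_eigenvalue[of n A a a] hermA a by blast
  have Aapp: "(\<Sum>j<n. A i j * x j) = (\<Sum>j<n. R i j * x j) + of_real c * x i
      - (\<Sum>k<m. of_real (l k + c) * v k i * ip {..<n} (v k) x)" if "i < n" for i x
  proof -
    have "(\<Sum>j<n. A i j * x j) = (\<Sum>j<n. R i j * x j) + (\<Sum>j<n. (if i = j then of_real c else 0) * x j)
      - (\<Sum>j<n. \<Sum>k<m. of_real (l k + c) * v k i * (cnj (v k j) * x j))"
      unfolding A_def by (simp add: algebra_simps sum.distrib sum_subtractf sum_distrib_left)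
    also have "(\<Sum>j<n. (if i = j then of_real c else 0) * x j) = of_real c * x i"
      using that by (simp add: if_distrib[of "\<lambda>y. y * _"] cong: if_cong)
    also have "(\<Sum>j<n. \<Sum>k<m. of_real (l k + c) * v k i * (cnj (v k j) * x j))
        = (\<Sum>k<m. of_real (l k + c) * v k i * ip {..<n} (v k) x)"
      unfolding ip_def by (subst sum.swap) (simp add: sum_distrib_left)
    finally show ?thesis .
  qed
  have Av: "(\<Sum>j<n. A i j * v k j) = 0" if "i < n" "k < m" for i k
  proof -
    have "(\<Sum>q<m. of_real (l q + c) * v q i * ip {..<n} (v q) (v k)) = (\<Sum>q<m. if q = k then of_real (l k + c) * v k i else 0)"
      using orthonD[OF o] that by (intro sum.cong refl) auto
    also have "\<dots> = of_real (l k + c) * v k i" using that by simp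
    finally show ?thesis unfolding Aapp[OF that(1)] using ev[OF that(2,1)] by (simp add: algebra_simps)
  qed
  \<comment> \<open>\<open>v k\<close> and \<open>u\<close> are eigenvectors of the Hermitian
    \<open>A\<close> for the distinct eigenvalues 0 and \<open>\<mu>\<close>.\<close>
  have orth: "ip {..<n} (v k) u = 0" if "k < m" for k
  proof -
    have "\<mu> * ip {..<n} (v k) u = ip {..<n} (v k) (\<lambda>i. \<Sum>j<n. A i j * u j)"
      unfolding ip_scale_right[symmetric] using Au by (intro ip_cong) auto
    also have "\<dots> = ip {..<n} (\<lambda>i. \<Sum>j<n. A i j * v k j) u" by (rule herm_ip) (rule hermA, simp_all)
    also have "\<dots> = 0" using Av[OF _ that] unfolding ip_def by simp
    finally show ?thesis using mu by simp
  qed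
  define s where "s = (\<Sum>i<n. (cmod (u i))\<^sup>2)"
  have s: "s > 0"
  proof -
    obtain i where "i < n" "u i \<noteq> 0" using mu by blast
    then show ?thesis unfolding s_def by (intro sum_pos2[of _ i]) auto
  qed
  have uu: "ip {..<n} u u = of_real s" unfolding ip_self s_def ..
  have "\<mu> * ip {..<n} u u = ip {..<n} u (\<lambda>i. \<Sum>j<n. A i j * u j)"
    unfolding ip_scale_right[symmetric] using Au by (intro ip_cong) auto
  also have "\<dots> = ip {..<n} (\<lambda>i. \<Sum>j<n. A i j * u j) u" by (rule herm_ip) (rule hermA, simp_all)
  also have "\<dots> = cnj (ip {..<n} u (\<lambda>i. \<Sum>j<n. A i j * u j))" by (simp add: cnj_ip)
  also have "ip {..<n} u (\<lambda>i. \<Sum>j<n. A i j * u j) = \<mu> * ip {..<n} u u"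
    unfolding ip_scale_right[symmetric] using Au by (intro ip_cong) auto
  finally have "\<mu> = cnj \<mu>" using uu s by simp
  then have mur: "\<mu> = of_real (Re \<mu>)" by (simp add: complex_eq_iff)
  have Ru: "(\<Sum>j<n. R i j * u j) = of_real (Re \<mu> - c) * u i" if "i < n" for i
    using Au[OF that] mur unfolding Aapp[OF that] by (simp add: orth algebra_simps)
  define v' where "v' = (\<lambda>k i. if k = m then u i / of_real (sqrt s) else v k i)"
  define l' where "l' = (\<lambda>k. if k = m then Re \<mu> - c else l k)"
  have v'm: "ip {..<n} x (v' m) = ip {..<n} x u / of_real (sqrt s)" for x
    unfolding v'_def ip_def by (simp add: sum_divide_distrib)
  have v'k: "v' k = v k" if "k < m" for k using that unfolding v'_def by auto
  have v'mm: "ip {..<n} (v' m) (v' m) = 1"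
  proof -
    have "ip {..<n} (v' m) (v' m) = cnj (ip {..<n} u (v' m)) / of_real (sqrt s)"
      unfolding v'm[of "v' m"] by (simp add: cnj_ip)
    also have "\<dots> = of_real (s / (sqrt s * sqrt s))" unfolding v'm uu
      by (simp only: complex_cnj_divide complex_cnj_complex_of_real of_real_divide of_real_mult divide_divide_eq_left)
    finally show ?thesis using s by simp
  qed
  have 1: "orthon {..<n} {..<Suc m} v'"
    unfolding orthon_def
  proof (intro ballI)
    fix k q assume "k \<in> {..<Suc m}" "q \<in> {..<Suc m}"
    then consider "k = m" "q = m" | "k = m" "q < m" | "k < m" "q = m" | "k < m" "q < m" by fastforce
    then show "ip {..<n} (v' k) (v' q) = (if k = q then 1 else 0)"
    proof cases
      case 1 then show ?thesis using v'mm by simp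
    next
      case 2
      then have "ip {..<n} (v' k) (v' q) = cnj (ip {..<n} (v q) (v' m))" by (simp add: cnj_ip v'k)
      then show ?thesis using 2 unfolding v'm by (simp add: orth)
    next
      case 3 then show ?thesis by (simp add: v'm v'k orth)
    next
      case 4 then show ?thesis using orthonD[OF o] by (simp add: v'k)
    qed
  qed
  have 2: "(\<Sum>j<n. R i j * v' k j) = of_real (l' k) * v' k i" if "k < Suc m" "i < n" for i k
  proof (cases "k = m")
    case True
    then have "(\<Sum>j<n. R i j * v' k j) = (\<Sum>j<n. R i j * u j) / of_real (sqrt s)"
      unfolding v'_def by (simp add: sum_divide_distrib)
    then show ?thesis unfolding Ru[OF that(2)] using True unfolding v'_def l'_def by simp
  next
    case False
    then show ?thesis using that ev unfolding v'_def l'_def by simp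
  qed
  show ?case using 1 2 by blast
qed

text \<open>A left inverse of a square matrix is a right inverse; this is how orthonormality of
  \<open>n\<close> vectors becomes completeness.\<close>

lemma orthon_unitary:
  fixes v :: "nat \<Rightarrow> nat \<Rightarrow> complex"
  assumes "orthon {..<n} {..<n} v"
  defines "V \<equiv> mat n n (\<lambda>(i, k). v k i)" and "W \<equiv> mat n n (\<lambda>(k, i). cnj (v k i))"
  shows "W * V = 1\<^sub>m n" "V * W = 1\<^sub>m n"
proof -
  have V: "V \<in> carrier_mat n n" and W: "W \<in> carrier_mat n n" unfolding V_def W_def by auto
  show "W * V = 1\<^sub>m n"
  proof (rule eq_matI)
    fix k q assume kq: "k < dim_row (1\<^sub>m n :: complex mat)" "q < dim_col (1\<^sub>m n :: complex mat)"
    then have "(W * V) $$ (k, q) = ip {..<n} (v k) (v q)"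
      using mult_mat_entry[OF W V] unfolding ip_def V_def W_def by simp
    then show "(W * V) $$ (k, q) = 1\<^sub>m n $$ (k, q)" using kq orthonD[OF assms(1), of k q] by simp
  qed (use V W in auto)
  then show "V * W = 1\<^sub>m n" using mat_mult_left_right_inverse[OF W V] by simp
qed

lemma orthon_complete:
  fixes v :: "nat \<Rightarrow> nat \<Rightarrow> complex"
  assumes o: "orthon {..<n} {..<n} v" and ij: "i < n" "j < n"
  shows "(\<Sum>k<n. v k i * cnj (v k j)) = (if i = j then 1 else 0)"
proof -
  have "(mat n n (\<lambda>(i, k). v k i) * mat n n (\<lambda>(k, i). cnj (v k i))) $$ (i, j) = (if i = j then 1 else 0)"
    using orthon_unitary(2)[OF o] ij by simp
  then show ?thesis using ij by (subst (asm) mult_mat_entry[of _ n n _ n]) auto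
qed

lemma spectral_theorem:
  fixes R :: "nat \<Rightarrow> nat \<Rightarrow> complex"
  assumes herm: "\<And>i j. i < n \<Longrightarrow> j < n \<Longrightarrow> R j i = cnj (R i j)"
  obtains l :: "nat \<Rightarrow> real" and v where "orthon {..<n} {..<n} v"
    "\<And>i j. i < n \<Longrightarrow> j < n \<Longrightarrow> R i j = (\<Sum>k<n. of_real (l k) * v k i * cnj (v k j))"
proof -
  obtain l :: "nat \<Rightarrow> real" and v where lv: "orthon {..<n} {..<n} v \<and>
      (\<forall>k<n. \<forall>i<n. (\<Sum>j<n. R i j * v k j) = of_real (l k) * v k i)"
    using spectral_theorem_partial[of n R n, OF herm order.refl] by auto
  then have o: "orthon {..<n} {..<n} v"
    and ev: "\<And>k i. k < n \<Longrightarrow> i < n \<Longrightarrow> (\<Sum>j<n. R i j * v k j) = of_real (l k) * v k i"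
    by auto
  have "R i j = (\<Sum>k<n. of_real (l k) * v k i * cnj (v k j))" if "i < n" "j < n" for i j
  proof -
    have "(\<Sum>k<n. of_real (l k) * v k i * cnj (v k j)) = (\<Sum>k<n. (\<Sum>q<n. R i q * v k q) * cnj (v k j))"
      using ev that by simp
    also have "\<dots> = (\<Sum>q<n. R i q * (\<Sum>k<n. v k q * cnj (v k j)))"
      unfolding sum_distrib_left sum_distrib_right by (subst sum.swap) (simp add: mult_ac)
    also have "\<dots> = (\<Sum>q<n. if q = j then R i j else 0)"
      using orthon_complete[OF o _ that(2)] by (intro sum.cong refl) auto
    also have "\<dots> = R i j" using that by simp
    finally show ?thesis ..
  qed
  then show ?thesis using that o by blast
qed

section \<open>Gram kernels: eigendata and Schmidt duality\<close>

lemma gram_herm: "gram E \<Psi> j i = cnj (gram E \<Psi> i j)"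
  unfolding gram_def by (simp add: mult.commute)

lemma gram_form:
  "(\<Sum>i\<in>I. \<Sum>j\<in>I. cnj (x i) * gram E \<Psi> i j * y j)
    = (\<Sum>e\<in>E. ip I x (\<lambda>i. \<Psi> i e) * cnj (ip I y (\<lambda>i. \<Psi> i e)))"
proof -
  have "(\<Sum>i\<in>I. \<Sum>j\<in>I. cnj (x i) * gram E \<Psi> i j * y j)
      = (\<Sum>i\<in>I. \<Sum>j\<in>I. \<Sum>e\<in>E. cnj (x i) * \<Psi> i e * (cnj (\<Psi> j e) * y j))"
    unfolding gram_def sum_distrib_left sum_distrib_right by (simp add: mult_ac)
  also have "\<dots> = (\<Sum>e\<in>E. \<Sum>i\<in>I. \<Sum>j\<in>I. cnj (x i) * \<Psi> i e * (cnj (\<Psi> j e) * y j))"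
      by (rule sum_swap3)
  also have "\<dots> = (\<Sum>e\<in>E. ip I x (\<lambda>i. \<Psi> i e) * cnj (ip I y (\<lambda>i. \<Psi> i e)))"
    unfolding ip_def cnj_sum sum_product by (simp add: mult_ac)
  finally show ?thesis .
qed

text \<open>Two forms of the same eigendata: the full basis, zero eigenvalues included, serves to
  diagonalise matrices and read off characteristic polynomials; the positive part is what
  \<open>spec\<close> asks for.\<close>

lemma spectral_gram_nat:
  fixes \<Psi> :: "nat \<Rightarrow> 'e \<Rightarrow> complex"
  obtains l :: "nat \<Rightarrow> real" and v where "orthon {..<n} {..<n} v"
    "\<And>i j. i < n \<Longrightarrow> j < n \<Longrightarrow> gram E \<Psi> i j = (\<Sum>k<n. of_real (l k) * v k i * cnj (v k j))"
    "\<And>k. k < n \<Longrightarrow> l k \<ge> 0"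
    "spec {..<n} (gram E \<Psi>) {k. k < n \<and> l k > 0} l v"
proof -
  obtain l :: "nat \<Rightarrow> real" and v where o: "orthon {..<n} {..<n} v" and
    eq: "\<And>i j. i < n \<Longrightarrow> j < n \<Longrightarrow> gram E \<Psi> i j = (\<Sum>k<n. of_real (l k) * v k i * cnj (v k j))"
    by (rule spectral_theorem[of n "gram E \<Psi>"]) (rule gram_herm, blast)
  \<comment> \<open>\<open>l k\<close> is the quadratic form of the kernel at \<open>v k\<close>,
    and \<open>gram_form\<close> turns it into a sum of squares.\<close>
  have nn: "l k \<ge> 0" if k: "k < n" for k
  proof -
    have "(\<Sum>i<n. \<Sum>j<n. cnj (v k i) * gram E \<Psi> i j * v k j)
        = (\<Sum>i<n. \<Sum>j<n. \<Sum>q<n. of_real (l q) * (cnj (v k i) * v q i) * (cnj (v q j) * v k j))"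
      by (intro sum.cong refl) (simp add: eq sum_distrib_left sum_distrib_right mult_ac)
    also have "\<dots> = (\<Sum>q<n. \<Sum>i<n. \<Sum>j<n. of_real (l q) * (cnj (v k i) * v q i) * (cnj (v q j) * v k j))"
      by (rule sum_swap3)
    also have "\<dots> = (\<Sum>q<n. of_real (l q) * (ip {..<n} (v k) (v q) * ip {..<n} (v q) (v k)))"
      unfolding ip_def sum_product unfolding sum_distrib_left by (simp add: mult_ac)
    also have "\<dots> = (\<Sum>q<n. if q = k then of_real (l k) else 0)"
      using orthonD[OF o] k by (intro sum.cong refl) auto
    also have "\<dots> = of_real (l k)" using k by simp
    finally have "complex_of_real (l k) = (\<Sum>e\<in>E. of_real ((cmod (ip {..<n} (v k) (\<lambda>i. \<Psi> i e)))\<^sup>2))"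
      unfolding gram_form complex_mult_cnj_cmod2 by simp
    then have "l k = (\<Sum>e\<in>E. (cmod (ip {..<n} (v k) (\<lambda>i. \<Psi> i e)))\<^sup>2)"
      using of_real_eq_iff[where 'a = complex] unfolding of_real_sum[symmetric] by blast
    then show ?thesis by (simp add: sum_nonneg)
  qed
  have "(\<Sum>k<n. of_real (l k) * v k i * cnj (v k j)) = (\<Sum>k | k < n \<and> l k > 0. of_real (l k) * v k i * cnj (v k j))" for i j
    using nn by (intro sum.mono_neutral_right) (auto simp: not_less intro: order.antisym)
  then have "spec {..<n} (gram E \<Psi>) {k. k < n \<and> l k > 0} l v"
    using o eq unfolding spec_def orthon_def by auto
  then show ?thesis using that o eq nn by blast
qed

lemma spec_reindex:
  assumes f: "bij_betw f J I" and s: "spec J (\<lambda>a b. R (f a) (f b)) N p v"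
  shows "spec I R N p (\<lambda>k i. v k (inv_into J f i))"
proof -
  have fi: "inj_on f J" and im: "f ` J = I" using f by (auto simp: bij_betw_def)
  have i: "inv_into J f (f a) = a" if "a \<in> J" for a using fi that by simp
  have "ip I (\<lambda>i. v k (inv_into J f i)) (\<lambda>i. v l (inv_into J f i)) = ip J (v k) (v l)" for k l
    unfolding ip_def im[symmetric] sum.reindex[OF fi] by (intro sum.cong) (auto simp: i)
  then show ?thesis using s unfolding spec_def orthon_def im[symmetric] by (auto simp: i)
qed

lemma spec_gram_exists:
  assumes "finite I"
  obtains N :: "nat set" and p v where "N \<subseteq> {..<card I}" "spec I (gram E \<Psi>) N p v"
proof -
  obtain f where f: "bij_betw f {..<card I} I"
    using ex_bij_betw_nat_finite[OF assms] by (auto simp: atLeast0LessThan)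
  obtain l :: "nat \<Rightarrow> real" and v where
    s: "spec {..<card I} (gram E (\<lambda>a. \<Psi> (f a))) {k. k < card I \<and> l k > 0} l v"
    by (rule spectral_gram_nat[of "card I" E "\<lambda>a. \<Psi> (f a)"]) blast
  have "gram E (\<lambda>a. \<Psi> (f a)) = (\<lambda>a b. gram E \<Psi> (f a) (f b))" by (intro ext) (simp add: gram_def)
  from spec_reindex[OF f, of "gram E \<Psi>", OF s[unfolded this]] show ?thesis
    by (intro that) auto
qed

lemma ent_reindex:
  assumes f: "bij_betw f J I" and J: "finite J"
  shows "ent J (\<lambda>a b. gram E \<Psi> (f a) (f b)) = ent I (gram E \<Psi>)"
proof -
  have I: "finite I" using bij_betw_finite[OF f] J by simp
  have g: "gram E (\<lambda>a. \<Psi> (f a)) = (\<lambda>a b. gram E \<Psi> (f a) (f b))" by (intro ext) (simp add: gram_def)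
  obtain N :: "nat set" and p v where s: "spec J (gram E (\<lambda>a. \<Psi> (f a))) N p v"
    by (rule spec_gram_exists[OF J])
  show ?thesis using ent_eq[OF spec_reindex[OF f s[unfolded g]]] ent_eq[OF s[unfolded g]] by simp
qed

lemma spec_trace:
  assumes s: "spec I R N p v"
  shows "(\<Sum>i\<in>I. R i i) = of_real (\<Sum>k\<in>N. p k)"
proof -
  have o: "orthon I N v" and eq: "\<And>i j. i \<in> I \<Longrightarrow> j \<in> I \<Longrightarrow> R i j = (\<Sum>k\<in>N. of_real (p k) * v k i * cnj (v k j))"
    using s unfolding spec_def by auto
  have "(\<Sum>i\<in>I. R i i) = (\<Sum>i\<in>I. \<Sum>k\<in>N. of_real (p k) * (cnj (v k i) * v k i))"
    using eq by (intro sum.cong refl) (simp add: mult_ac)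
  also have "\<dots> = (\<Sum>k\<in>N. of_real (p k) * ip I (v k) (v k))"
    unfolding ip_def sum_distrib_left by (rule sum.swap)
  also have "\<dots> = (\<Sum>k\<in>N. of_real (p k))" using orthonD[OF o] by simp
  finally show ?thesis by simp
qed

text \<open>The coefficient functions of \<open>\<Psi>\<close> along the eigenvectors are the
  unnormalised partners in the Schmidt decomposition: orthogonal on \<open>E\<close>, with squared
  norm \<open>p k\<close>.\<close>

lemma spec_gram_coeffs:
  assumes s: "spec I (gram E \<Psi>) N p v" and k: "k \<in> N" and l: "l \<in> N"
  shows "(\<Sum>e\<in>E. ip I (v k) (\<lambda>i. \<Psi> i e) * cnj (ip I (v l) (\<lambda>i. \<Psi> i e))) = (if k = l then of_real (p k) else 0)"
proof -
  have o: "orthon I N v" using s unfolding spec_def by auto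
  have "(\<Sum>e\<in>E. ip I (v k) (\<lambda>i. \<Psi> i e) * cnj (ip I (v l) (\<lambda>i. \<Psi> i e))) = (\<Sum>i\<in>I. cnj (v k i) * (\<Sum>j\<in>I. gram E \<Psi> i j * v l j))"
    unfolding gram_form[symmetric] by (simp add: sum_distrib_left mult_ac)
  also have "\<dots> = (\<Sum>i\<in>I. of_real (p l) * (cnj (v k i) * v l i))"
    by (intro sum.cong refl, subst spec_eigen[OF s _ l]) (simp_all add: mult_ac)
  also have "\<dots> = of_real (p l) * ip I (v k) (v l)"
    unfolding ip_def sum_distrib_left ..
  also have "\<dots> = (if k = l then of_real (p k) else 0)" using orthonD[OF o k l] by simp
  finally show ?thesis .
qed

text \<open>Every \<open>\<Psi>\<close> column lies in the range of the kernel. For fixed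
  \<open>i\<close>, the squared difference of the two sides summed over \<open>E\<close> expands
  into four terms, all equal to the diagonal entry \<open>S\<close>, and so vanishes.\<close>

lemma spec_gram_expand:
  assumes E: "finite E" and s: "spec I (gram E \<Psi>) N p v" and i: "i \<in> I" and e: "e \<in> E"
  shows "\<Psi> i e = (\<Sum>k\<in>N. ip I (v k) (\<lambda>i. \<Psi> i e) * v k i)"
proof -
  have fN: "finite N" using s unfolding spec_def by auto
  define g where "g = (\<lambda>k e. ip I (v k) (\<lambda>i. \<Psi> i e))"
  have gg: "(\<Sum>e\<in>E. g k e * cnj (g l e)) = (if k = l then of_real (p k) else 0)" if "k \<in> N" "l \<in> N" for k l
    unfolding g_def by (rule spec_gram_coeffs[OF s that])
  have pg: "(\<Sum>e\<in>E. \<Psi> i e * cnj (g k e)) = of_real (p k) * v k i" if k: "k \<in> N" for k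
  proof -
    have "(\<Sum>e\<in>E. \<Psi> i e * cnj (g k e)) = (\<Sum>e\<in>E. \<Sum>j\<in>I. \<Psi> i e * cnj (\<Psi> j e) * v k j)"
      unfolding g_def ip_def cnj_sum sum_distrib_left by (simp add: mult_ac)
    also have "\<dots> = (\<Sum>j\<in>I. gram E \<Psi> i j * v k j)"
      unfolding gram_def sum_distrib_right by (rule sum.swap)
    finally show ?thesis using spec_eigen[OF s i k] by simp
  qed
  define S where "S = (\<Sum>k\<in>N. of_real (p k) * v k i * cnj (v k i))"
  have Scnj: "cnj S = S" unfolding S_def cnj_sum by (simp add: mult_ac)
  have 1: "(\<Sum>e\<in>E. \<Psi> i e * cnj (\<Psi> i e)) = S"
    using s i unfolding spec_def S_def gram_def by auto
  have "(\<Sum>e\<in>E. \<Psi> i e * cnj (\<Sum>k\<in>N. g k e * v k i)) = (\<Sum>k\<in>N. (\<Sum>e\<in>E. \<Psi> i e * cnj (g k e)) * cnj (v k i))"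
    unfolding cnj_sum sum_distrib_left sum_distrib_right by (subst sum.swap) (simp add: mult_ac)
  then have 2: "(\<Sum>e\<in>E. \<Psi> i e * cnj (\<Sum>k\<in>N. g k e * v k i)) = S"
    unfolding S_def by (simp add: pg)
  have "(\<Sum>e\<in>E. (\<Sum>k\<in>N. g k e * v k i) * cnj (\<Psi> i e)) = cnj (\<Sum>e\<in>E. \<Psi> i e * cnj (\<Sum>k\<in>N. g k e * v k i))"
    unfolding cnj_sum by (simp add: mult.commute)
  then have 3: "(\<Sum>e\<in>E. (\<Sum>k\<in>N. g k e * v k i) * cnj (\<Psi> i e)) = S" unfolding 2 Scnj .
  have "(\<Sum>e\<in>E. (\<Sum>k\<in>N. g k e * v k i) * cnj (\<Sum>l\<in>N. g l e * v l i))
    = (\<Sum>e\<in>E. \<Sum>k\<in>N. \<Sum>l\<in>N. (g k e * cnj (g l e)) * (v k i * cnj (v l i)))"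
    unfolding cnj_sum sum_product by (simp add: mult_ac)
  also have "\<dots> = (\<Sum>k\<in>N. \<Sum>l\<in>N. (\<Sum>e\<in>E. g k e * cnj (g l e)) * (v k i * cnj (v l i)))"
      unfolding sum_distrib_right by (rule sum_swap3[symmetric])
  also have "\<dots> = (\<Sum>k\<in>N. \<Sum>l\<in>N. if k = l then of_real (p k) * v k i * cnj (v k i) else 0)"
    by (intro sum.cong refl) (auto simp: gg)
  also have "\<dots> = S" unfolding S_def using fN by simp
  finally have 4: "(\<Sum>e\<in>E. (\<Sum>k\<in>N. g k e * v k i) * cnj (\<Sum>l\<in>N. g l e * v l i)) = S" .
  define d where "d = (\<lambda>e. \<Psi> i e - (\<Sum>k\<in>N. g k e * v k i))"
  have "(\<Sum>e\<in>E. d e * cnj (d e)) = S - S - S + S"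
    unfolding d_def complex_cnj_diff left_diff_distrib right_diff_distrib sum_subtractf 1 2 3 4 by simp
  then have "complex_of_real (\<Sum>e\<in>E. (cmod (d e))\<^sup>2) = 0"
    unfolding complex_mult_cnj_cmod2 of_real_sum by simp
  then have "(\<Sum>e\<in>E. (cmod (d e))\<^sup>2) = 0" using of_real_eq_0_iff by blast
  then have "(cmod (d e))\<^sup>2 = 0" using e E by (subst (asm) sum_nonneg_eq_0_iff) auto
  then show ?thesis unfolding d_def g_def by simp
qed

text \<open>The Schmidt decomposition \<open>\<Psi> i e = \<Sum>\<^sub>k \<surd>p\<^sub>k v\<^sub>k(i) w\<^sub>k(e)\<close>.\<close>
lemma spec_dual:
  assumes I: "finite I" and E: "finite E" and s: "spec I (gram E \<Psi>) N p v"
  shows "spec E (gram I (\<lambda>e i. \<Psi> i e)) N p (\<lambda>k e. ip I (v k) (\<lambda>i. \<Psi> i e) / of_real (sqrt (p k)))"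
proof -
  have fN: "finite N" and pos: "\<And>k. k \<in> N \<Longrightarrow> p k > 0" and o: "orthon I N v"
    using s unfolding spec_def by auto
  define g where "g = (\<lambda>k e. ip I (v k) (\<lambda>i. \<Psi> i e))"
  have gg: "(\<Sum>e\<in>E. g k e * cnj (g l e)) = (if k = l then of_real (p k) else 0)" if "k \<in> N" "l \<in> N" for k l
    unfolding g_def by (rule spec_gram_coeffs[OF s that])
  have rec: "\<Psi> i e = (\<Sum>k\<in>N. g k e * v k i)" if "i \<in> I" "e \<in> E" for i e
    unfolding g_def by (rule spec_gram_expand[OF E s that])
  have orth: "orthon E N (\<lambda>k e. g k e / of_real (sqrt (p k)))"
    unfolding orthon_def
  proof (intro ballI)
    fix k l assume kl: "k \<in> N" "l \<in> N"
    have "ip E (\<lambda>e. g k e / of_real (sqrt (p k))) (\<lambda>e. g l e / of_real (sqrt (p l)))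
       = (\<Sum>e\<in>E. g l e * cnj (g k e)) / of_real (sqrt (p k) * sqrt (p l))"
      unfolding ip_def sum_divide_distrib by (simp add: mult_ac)
    also have "\<dots> = (if k = l then 1 else 0)"
      unfolding gg[OF kl(2,1)] using pos[OF kl(1)] by (auto simp: of_real_mult[symmetric] simp del: of_real_mult)
    finally show "ip E (\<lambda>e. g k e / of_real (sqrt (p k))) (\<lambda>e. g l e / of_real (sqrt (p l))) = (if k = l then 1 else 0)" .
  qed
  have "gram I (\<lambda>e i. \<Psi> i e) e e' = (\<Sum>k\<in>N. of_real (p k) * (g k e / of_real (sqrt (p k))) * cnj (g k e' / of_real (sqrt (p k))))"
    if e: "e \<in> E" "e' \<in> E" for e e'
  proof -
    have "gram I (\<lambda>e i. \<Psi> i e) e e' = (\<Sum>i\<in>I. (\<Sum>k\<in>N. g k e * v k i) * cnj (\<Sum>k\<in>N. g k e' * v k i))"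
      unfolding gram_def using rec e by (intro sum.cong refl) metis
    also have "\<dots> = (\<Sum>i\<in>I. \<Sum>k\<in>N. \<Sum>l\<in>N. g k e * cnj (g l e') * (cnj (v l i) * v k i))"
      unfolding cnj_sum sum_product by (simp add: mult_ac)
    also have "\<dots> = (\<Sum>k\<in>N. \<Sum>l\<in>N. g k e * cnj (g l e') * ip I (v l) (v k))"
      unfolding ip_def sum_distrib_left by (rule sum_swap3[symmetric])
    also have "\<dots> = (\<Sum>k\<in>N. \<Sum>l\<in>N. if k = l then g k e * cnj (g k e') else 0)"
      using orthonD[OF o] by (intro sum.cong refl) auto
    also have "\<dots> = (\<Sum>k\<in>N. g k e * cnj (g k e'))" using fN by simp
    also have "\<dots> = (\<Sum>k\<in>N. of_real (p k) * (g k e / of_real (sqrt (p k))) * cnj (g k e' / of_real (sqrt (p k))))"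
    proof (intro sum.cong refl)
      fix k assume k: "k \<in> N"
      have "of_real (p k) = complex_of_real (sqrt (p k)) * of_real (sqrt (p k))"
        using pos[OF k] by (simp add: of_real_mult[symmetric] del: of_real_mult)
      then show "g k e * cnj (g k e') = of_real (p k) * (g k e / of_real (sqrt (p k))) * cnj (g k e' / of_real (sqrt (p k)))"
        using pos[OF k] by (simp add: field_simps)
    qed
    finally show ?thesis .
  qed
  then show ?thesis using fN pos orth unfolding spec_def g_def by auto
qed

text \<open>The two marginals of a pure vector have the same non-zero eigenvalues. This replaces an
  entropy by that of the complementary system throughout.\<close>

lemma ent_dual:
  assumes "finite I" "finite E"
  shows "ent I (gram E \<Psi>) = ent E (gram I (\<lambda>e i. \<Psi> i e))"
proof -
  obtain N :: "nat set" and p v where s: "spec I (gram E \<Psi>) N p v"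
    by (rule spec_gram_exists[OF assms(1)])
  show ?thesis using ent_eq[OF s] ent_eq[OF spec_dual[OF assms s]] by simp
qed

section \<open>Comparison with the entropy of matrices\<close>

lemma proots_linear_factors: "proots (\<Prod>a\<leftarrow>as. [:- a, 1:]) = mset (as :: complex list)"
proof (induction as)
  case (Cons a as)
  have "(\<Prod>a\<leftarrow>as. [:- a, 1:]) \<noteq> 0" by (auto simp: prod_list_zero_iff)
  then show ?case using Cons by (simp add: proots_mult del: mult_pCons_left)
qed simp

text \<open>Diagonalisation turns the roots of the characteristic polynomial into the list of all
  eigenvalues. Zero eigenvalues contribute nothing, and \<open>ln 2\<close> converts natural units
  to bits.\<close>

lemma vN_entropy_gram:
  assumes A: "A \<in> carrier_mat n n" and eq: "\<And>i j. i < n \<Longrightarrow> j < n \<Longrightarrow> A $$ (i, j) = gram E \<Psi> i j"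
  shows "vN_entropy A = ent {..<n} (gram E \<Psi>) / ln 2"
proof -
  obtain l :: "nat \<Rightarrow> real" and v where o: "orthon {..<n} {..<n} v" and
    sp: "\<And>i j. i < n \<Longrightarrow> j < n \<Longrightarrow> gram E \<Psi> i j = (\<Sum>k<n. of_real (l k) * v k i * cnj (v k j))" and
    nn: "\<And>k. k < n \<Longrightarrow> l k \<ge> 0" and
    s: "spec {..<n} (gram E \<Psi>) {k. k < n \<and> l k > 0} l v"
    by (rule spectral_gram_nat[of n E \<Psi>]) blast
  define V where "V = mat n n (\<lambda>(i, k). v k i)"
  define W where "W = mat n n (\<lambda>(k, i). cnj (v k i))"
  define D where "D = mat n n (\<lambda>(i, j). if i = j then complex_of_real (l i) else 0)"
  have V: "V \<in> carrier_mat n n" and W: "W \<in> carrier_mat n n" and D: "D \<in> carrier_mat n n"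
    unfolding V_def W_def D_def by auto
  have "A = V * D * W"
  proof (rule eq_matI)
    fix i j assume "i < dim_row (V * D * W)" "j < dim_col (V * D * W)"
    then have ij: "i < n" "j < n" using V W by auto
    have VD: "(V * D) $$ (i, k) = of_real (l k) * v k i" if "k < n" for k
    proof -
      have "(V * D) $$ (i, k) = (\<Sum>q<n. if q = k then of_real (l k) * v k i else 0)"
        unfolding mult_mat_entry[OF V D ij(1) that] using that ij
        by (intro sum.cong refl) (auto simp: V_def D_def)
      then show ?thesis using that by simp
    qed
    have "(V * D * W) $$ (i, j) = (\<Sum>k<n. of_real (l k) * v k i * cnj (v k j))"
      unfolding mult_mat_entry[OF mult_carrier_mat[OF V D] W ij] using ij
      by (intro sum.cong refl) (simp add: VD W_def)
    then show "A $$ (i, j) = (V * D * W) $$ (i, j)" using eq sp ij by simp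
  qed (use A V W in auto)
  then have "similar_mat A D"
    using A V W D orthon_unitary[OF o, folded V_def W_def] by (intro similar_matI[of _ _ V W n]) auto
  then have "char_poly A = char_poly D" by (rule char_poly_similar)
  also have "\<dots> = (\<Prod>a\<leftarrow>diag_mat D. [:- a, 1:])"
    by (rule char_poly_upper_triangular[OF D]) (auto simp: D_def upper_triangular_def)
  finally have "proots (char_poly A) = mset (diag_mat D)"
    by (simp add: proots_linear_factors)
  then have "vN_entropy A = (\<Sum>z\<leftarrow>diag_mat D. - (Re z * log 2 (Re z)))"
    unfolding vN_entropy_def by (simp add: sum_mset_sum_list[symmetric])
  also have "\<dots> = (\<Sum>k<n. - (l k * log 2 (l k)))"
    unfolding diag_mat_def by (simp add: D_def comp_def interv_sum_list_conv_sum_set_nat atLeast0LessThan)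
  also have "\<dots> = (\<Sum>k<n. - (l k * ln (l k))) / ln 2"
    by (simp add: log_def sum_divide_distrib)
  also have "(\<Sum>k<n. - (l k * ln (l k))) = (\<Sum>k | k < n \<and> l k > 0. - (l k * ln (l k)))"
    using nn by (intro sum.mono_neutral_right) (auto simp: not_less intro: order.antisym)
  also have "\<dots> = ent {..<n} (gram E \<Psi>)" using ent_eq[OF s] by simp
  finally show ?thesis .
qed

section \<open>Strong subadditivity\<close>

lemma form_spec:
  assumes s: "spec I R N p u"
  shows "(\<Sum>i\<in>I. \<Sum>j\<in>I. cnj (x i) * R i j * x j) = of_real (\<Sum>k\<in>N. p k * (cmod (ip I (u k) x))\<^sup>2)"
proof -
  have "(\<Sum>i\<in>I. \<Sum>j\<in>I. cnj (x i) * R i j * x j) = (\<Sum>i\<in>I. cnj (x i) * (\<Sum>j\<in>I. R i j * x j))"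
    by (simp add: sum_distrib_left mult_ac)
  also have "\<dots> = ip I x (\<lambda>i. \<Sum>k\<in>N. of_real (p k) * ip I (u k) x * u k i)"
    unfolding ip_def[of I x] using spec_apply[OF s] by (intro sum.cong refl) simp
  also have "\<dots> = (\<Sum>k\<in>N. of_real (p k) * (ip I (u k) x * cnj (ip I (u k) x)))"
    unfolding ip_sum_right by (simp add: cnj_ip mult_ac)
  finally show ?thesis unfolding complex_mult_cnj_cmod2 by simp
qed

text \<open>The trace of \<open>\<sigma>\<close> conjugated by \<open>Y\<close>, with the adjoint of
  \<open>Y\<close> on the left. Inserting the adjoint of \<open>Y\<close> for \<open>Y\<close> gives
  the conjugation in the other order.\<close>

definition conj_trace :: "'i set \<Rightarrow> ('i \<Rightarrow> 'i \<Rightarrow> complex) \<Rightarrow> ('i \<Rightarrow> 'i \<Rightarrow> complex) \<Rightarrow> complex" where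
  "conj_trace I \<sigma> Y = (\<Sum>j\<in>I. \<Sum>a\<in>I. \<Sum>b\<in>I. cnj (Y a j) * \<sigma> a b * Y b j)"

lemma conj_trace_spec:
  assumes s: "spec I \<sigma> L q v"
  shows "Re (conj_trace I \<sigma> Y) = (\<Sum>l\<in>L. q l * (\<Sum>j\<in>I. (cmod (ip I (v l) (\<lambda>a. Y a j)))\<^sup>2))"
proof -
  have "conj_trace I \<sigma> Y = of_real (\<Sum>j\<in>I. \<Sum>l\<in>L. q l * (cmod (ip I (v l) (\<lambda>a. Y a j)))\<^sup>2)"
    unfolding conj_trace_def form_spec[OF s] by simp
  also have "(\<Sum>j\<in>I. \<Sum>l\<in>L. q l * (cmod (ip I (v l) (\<lambda>a. Y a j)))\<^sup>2)
     = (\<Sum>l\<in>L. q l * (\<Sum>j\<in>I. (cmod (ip I (v l) (\<lambda>a. Y a j)))\<^sup>2))"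
    unfolding sum_distrib_left by (rule sum.swap)
  finally show ?thesis by simp
qed

text \<open>For positive kernels \<open>\<rho>, \<sigma>\<close> and \<open>t > 0\<close> the functional
  \<open>2 Re tr(\<rho> Y\<^sup>*) - tr(Y\<^sup>* \<sigma> Y) - t tr(Y \<rho> Y\<^sup>*)\<close> has maximum
  \<open>\<Sum>\<^sub>k\<^sub>l |\<langle>v\<^sub>l,u\<^sub>k\<rangle>|\<^sup>2 p\<^sub>k\<^sup>2 / (q\<^sub>l + t p\<^sub>k)\<close>, whose integral over \<open>t\<close> is, up to a term depending
  only on the trace, the relative entropy of \<open>\<rho>\<close> and \<open>\<sigma>\<close>. Since the functional for \<open>Y \<otimes> 1\<close> only sees the
  partial traces, the maximum can only decrease under partial trace.\<close>
definition qform :: "'i set \<Rightarrow> ('i \<Rightarrow> 'i \<Rightarrow> complex) \<Rightarrow> ('i \<Rightarrow> 'i \<Rightarrow> complex) \<Rightarrow> real \<Rightarrow> ('i \<Rightarrow> 'i \<Rightarrow> complex) \<Rightarrow> real" where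
  "qform I \<rho> \<sigma> t Y = 2 * Re (\<Sum>i\<in>I. \<Sum>j\<in>I. \<rho> i j * cnj (Y i j))
     - Re (conj_trace I \<sigma> Y) - t * Re (conj_trace I \<rho> (\<lambda>i a. cnj (Y a i)))"

lemma qform_spec:
  assumes s: "spec I \<rho> N p u" and s': "spec I \<sigma> L q v"
  shows "qform I \<rho> \<sigma> t Y = 2 * (\<Sum>k\<in>N. p k * Re (ip I (\<lambda>i. \<Sum>j\<in>I. Y i j * u k j) (u k)))
     - (\<Sum>l\<in>L. q l * (\<Sum>j\<in>I. (cmod (ip I (v l) (\<lambda>a. Y a j)))\<^sup>2))
     - t * (\<Sum>k\<in>N. p k * (\<Sum>a\<in>I. (cmod (\<Sum>j\<in>I. Y a j * u k j))\<^sup>2))"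
proof -
  have eq: "\<And>i j. i \<in> I \<Longrightarrow> j \<in> I \<Longrightarrow> \<rho> i j = (\<Sum>k\<in>N. of_real (p k) * u k i * cnj (u k j))"
    using s unfolding spec_def by auto
  have "(\<Sum>i\<in>I. \<Sum>j\<in>I. \<rho> i j * cnj (Y i j)) 
      = (\<Sum>i\<in>I. \<Sum>j\<in>I. \<Sum>k\<in>N. of_real (p k) * (u k i * cnj (Y i j * u k j)))"
    by (intro sum.cong refl) (simp add: eq sum_distrib_right sum_distrib_left mult_ac)
  also have "\<dots> = (\<Sum>k\<in>N. \<Sum>i\<in>I. \<Sum>j\<in>I. of_real (p k) * (u k i * cnj (Y i j * u k j)))"
      by (rule sum_swap3)
  also have "\<dots> = (\<Sum>k\<in>N. of_real (p k) * ip I (\<lambda>i. \<Sum>j\<in>I. Y i j * u k j) (u k))"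
    unfolding ip_def cnj_sum sum_distrib_left sum_distrib_right by (simp add: mult_ac)
  finally have 1: "Re (\<Sum>i\<in>I. \<Sum>j\<in>I. \<rho> i j * cnj (Y i j)) 
      = (\<Sum>k\<in>N. p k * Re (ip I (\<lambda>i. \<Sum>j\<in>I. Y i j * u k j) (u k)))" by simp
  have cm: "cmod (ip I (u k) (\<lambda>i. cnj (Y a i))) = cmod (\<Sum>j\<in>I. Y a j * u k j)" for k a
  proof -
    have "ip I (u k) (\<lambda>i. cnj (Y a i)) = cnj (\<Sum>j\<in>I. Y a j * u k j)"
      unfolding ip_def cnj_sum by (simp add: mult.commute)
    then show ?thesis by (simp only: complex_mod_cnj)
  qed
  show ?thesis unfolding qform_def 1 conj_trace_spec[OF s] conj_trace_spec[OF s'] cm ..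
qed

text \<open>Completing the square in \<open>cmod z\<close>. Equality holds at
  \<open>z = (p / d) c\<close>, which dictates the optimal operator in
  \<open>qform_attained\<close>.\<close>

lemma complete_square_bound:
  fixes z c :: complex and p d :: real
  assumes "d > 0"
  shows "2 * (p * Re (cnj z * c)) - d * (cmod z)\<^sup>2 \<le> p\<^sup>2 * (cmod c)\<^sup>2 / d"
proof -
  have "Re (cnj z * c) \<le> cmod z * cmod c"
    using complex_Re_le_cmod[of "cnj z * c"] by (simp add: norm_mult)
  moreover have "- Re (cnj z * c) \<le> cmod z * cmod c"
    using complex_Re_le_cmod[of "- (cnj z * c)"] by (simp add: norm_mult)
  ultimately have "\<bar>Re (cnj z * c)\<bar> \<le> cmod z * cmod c" by linarith
  then have "\<bar>p\<bar> * \<bar>Re (cnj z * c)\<bar> \<le> \<bar>p\<bar> * (cmod z * cmod c)" by (intro mult_left_mono) auto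
  moreover have "p * Re (cnj z * c) \<le> \<bar>p\<bar> * \<bar>Re (cnj z * c)\<bar>"
    unfolding abs_mult[symmetric] by (rule abs_ge_self)
  ultimately have 1: "p * Re (cnj z * c) \<le> \<bar>p\<bar> * cmod c * cmod z"
    by (simp only: mult_ac)
  have "0 \<le> (\<bar>p\<bar> * cmod c - d * cmod z)\<^sup>2" by simp
  then have "2 * (\<bar>p\<bar> * cmod c * cmod z) * d - d * (cmod z)\<^sup>2 * d \<le> p\<^sup>2 * (cmod c)\<^sup>2"
    by (simp add: power2_diff power_mult_distrib power2_eq_square algebra_simps)
  then have "2 * (\<bar>p\<bar> * cmod c * cmod z) - d * (cmod z)\<^sup>2 \<le> p\<^sup>2 * (cmod c)\<^sup>2 / d"
    using assms by (simp add: field_simps)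
  then show ?thesis using 1 by linarith
qed

lemma sum_combine:
  fixes p :: "'k \<Rightarrow> real" and q :: "'l \<Rightarrow> real"
  shows "2 * (\<Sum>k\<in>N. p k * (\<Sum>l\<in>L. f k l)) - (\<Sum>l\<in>L. q l * (\<Sum>k\<in>N. g k l)) - t * (\<Sum>k\<in>N. p k * (\<Sum>l\<in>L. g k l))
    = (\<Sum>k\<in>N. \<Sum>l\<in>L. 2 * (p k * f k l) - (q l + t * p k) * g k l)"
proof -
  have "(\<Sum>l\<in>L. q l * (\<Sum>k\<in>N. g k l)) = (\<Sum>k\<in>N. \<Sum>l\<in>L. q l * g k l)"
    unfolding sum_distrib_left by (rule sum.swap)
  then show ?thesis
    unfolding distrib_right sum_subtractf sum.distrib sum_distrib_left by (simp add: mult_ac)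
qed

text \<open>The matrix elements \<open>y k l\<close> of \<open>Y\<close> between the two eigenbases
  decouple the functional into scalar problems. In the two subtracted terms Bessel's inequality
  drops the part of \<open>Y\<close> outside the eigenvectors; the linear term must be captured
  exactly, and this is where \<open>supp\<close> enters: it puts the range of \<open>\<rho>\<close>
  inside that of \<open>\<sigma>\<close>.\<close>

lemma qform_upper:
  assumes s: "spec I \<rho> N p u" and s': "spec I \<sigma> L q v" and t: "t > 0"
    and supp: "\<And>k i. k \<in> N \<Longrightarrow> i \<in> I \<Longrightarrow> u k i = (\<Sum>l\<in>L. ip I (v l) (u k) * v l i)"
  shows "qform I \<rho> \<sigma> t Y \<le> (\<Sum>k\<in>N. \<Sum>l\<in>L. (p k)\<^sup>2 * (cmod (ip I (v l) (u k)))\<^sup>2 / (q l + t * p k))"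
proof -
  have fN: "finite N" and o: "orthon I N u" and fL: "finite L" and oL: "orthon I L v"
    and p: "\<And>k. k \<in> N \<Longrightarrow> p k > 0" and q: "\<And>l. l \<in> L \<Longrightarrow> q l > 0"
    using s s' unfolding spec_def by auto
  define Yu where "Yu = (\<lambda>k i. \<Sum>j\<in>I. Y i j * u k j)"
  define y where "y = (\<lambda>k l. ip I (v l) (Yu k))"
  have 1: "Re (ip I (Yu k) (u k)) = (\<Sum>l\<in>L. Re (cnj (y k l) * ip I (v l) (u k)))" if "k \<in> N" for k
  proof -
    have "ip I (Yu k) (u k) = ip I (Yu k) (\<lambda>i. \<Sum>l\<in>L. ip I (v l) (u k) * v l i)"
      using supp[OF that] by (intro ip_cong) auto
    also have "\<dots> = (\<Sum>l\<in>L. cnj (y k l) * ip I (v l) (u k))"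
      unfolding ip_sum_right y_def by (simp add: cnj_ip mult.commute)
    finally show ?thesis by simp
  qed
  have 3: "(\<Sum>l\<in>L. (cmod (y k l))\<^sup>2) \<le> (\<Sum>a\<in>I. (cmod (Yu k a))\<^sup>2)" for k
    unfolding y_def by (rule bessel[OF oL fL])
  have yy: "cmod (ip I (u k) (\<lambda>j. cnj (ip I (v l) (\<lambda>a. Y a j)))) = cmod (y k l)" for k l
  proof -
    have "ip I (u k) (\<lambda>j. cnj (ip I (v l) (\<lambda>a. Y a j))) = cnj (\<Sum>j\<in>I. \<Sum>a\<in>I. cnj (v l a) * (Y a j * u k j))"
      unfolding ip_def cnj_sum sum_distrib_left by (simp add: mult_ac)
    also have "(\<Sum>j\<in>I. \<Sum>a\<in>I. cnj (v l a) * (Y a j * u k j)) = y k l"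
      unfolding y_def Yu_def ip_def sum_distrib_left by (rule sum.swap)
    finally show ?thesis by simp
  qed
  have 2: "(\<Sum>k\<in>N. (cmod (y k l))\<^sup>2) \<le> (\<Sum>j\<in>I. (cmod (ip I (v l) (\<lambda>a. Y a j)))\<^sup>2)" for l
    using bessel[OF o fN, of "\<lambda>j. cnj (ip I (v l) (\<lambda>a. Y a j))"] unfolding yy by simp
  have "qform I \<rho> \<sigma> t Y \<le> 2 * (\<Sum>k\<in>N. p k * (\<Sum>l\<in>L. Re (cnj (y k l) * ip I (v l) (u k))))
     - (\<Sum>l\<in>L. q l * (\<Sum>k\<in>N. (cmod (y k l))\<^sup>2)) - t * (\<Sum>k\<in>N. p k * (\<Sum>l\<in>L. (cmod (y k l))\<^sup>2))"
  proof -
    have a: "(\<Sum>k\<in>N. p k * Re (ip I (Yu k) (u k))) = (\<Sum>k\<in>N. p k * (\<Sum>l\<in>L. Re (cnj (y k l) * ip I (v l) (u k))))"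
      using 1 by (intro sum.cong refl) simp
    have b: "(\<Sum>l\<in>L. q l * (\<Sum>k\<in>N. (cmod (y k l))\<^sup>2)) \<le> (\<Sum>l\<in>L. q l * (\<Sum>j\<in>I. (cmod (ip I (v l) (\<lambda>a. Y a j)))\<^sup>2))"
      using q by (intro sum_mono mult_left_mono 2) (auto simp: less_imp_le)
    have c: "(\<Sum>k\<in>N. p k * (\<Sum>l\<in>L. (cmod (y k l))\<^sup>2)) \<le> (\<Sum>k\<in>N. p k * (\<Sum>a\<in>I. (cmod (Yu k a))\<^sup>2))"
      using p by (intro sum_mono mult_left_mono 3) (auto simp: less_imp_le)
    have c': "t * (\<Sum>k\<in>N. p k * (\<Sum>l\<in>L. (cmod (y k l))\<^sup>2)) \<le> t * (\<Sum>k\<in>N. p k * (\<Sum>a\<in>I. (cmod (Yu k a))\<^sup>2))"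
      using c t by (intro mult_left_mono) auto
    show ?thesis using a b c' unfolding qform_spec[OF s s'] Yu_def by linarith
  qed
  also have "\<dots> = (\<Sum>k\<in>N. \<Sum>l\<in>L. 2 * (p k * Re (cnj (y k l) * ip I (v l) (u k))) - (q l + t * p k) * (cmod (y k l))\<^sup>2)"
    by (rule sum_combine)
  also have "\<dots> \<le> (\<Sum>k\<in>N. \<Sum>l\<in>L. (p k)\<^sup>2 * (cmod (ip I (v l) (u k)))\<^sup>2 / (q l + t * p k))"
    using p q t by (intro sum_mono complete_square_bound) (simp add: add_pos_pos)
  finally show ?thesis .
qed

lemma qform_attained:
  assumes s: "spec I \<rho> N p u" and s': "spec I \<sigma> L q v" and t: "t > 0"
  shows "\<exists>Y. qform I \<rho> \<sigma> t Y = (\<Sum>k\<in>N. \<Sum>l\<in>L. (p k)\<^sup>2 * (cmod (ip I (v l) (u k)))\<^sup>2 / (q l + t * p k))"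
proof -
  have fN: "finite N" and o: "orthon I N u" and fL: "finite L" and oL: "orthon I L v"
    and p: "\<And>k. k \<in> N \<Longrightarrow> p k > 0" and q: "\<And>l. l \<in> L \<Longrightarrow> q l > 0"
    using s s' unfolding spec_def by auto
  \<comment> \<open>These are the equality values in \<open>complete_square_bound\<close>, with
    \<open>d = q l + t * p k\<close>; \<open>Y\<close> is assembled from them as its matrix
    elements.\<close>
  define y where "y = (\<lambda>k l. of_real (p k / (q l + t * p k)) * ip I (v l) (u k))"
  define Y where "Y = (\<lambda>i j. \<Sum>k\<in>N. \<Sum>l\<in>L. y k l * v l i * cnj (u k j))"
  have ipsq: "(\<Sum>i\<in>I. (cmod (\<Sum>m\<in>M. c m * w m i))\<^sup>2) = (\<Sum>m\<in>M. (cmod (c m))\<^sup>2)"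
    if "orthon I M w" "finite M" for M :: "'x set" and c w
  proof -
    have "complex_of_real (\<Sum>i\<in>I. (cmod (\<Sum>m\<in>M. c m * w m i))\<^sup>2) = ip I (\<lambda>i. \<Sum>m\<in>M. c m * w m i) (\<lambda>i. \<Sum>m\<in>M. c m * w m i)"
      unfolding ip_self ..
    also have "\<dots> = (\<Sum>m\<in>M. cnj (c m) * (\<Sum>n\<in>M. c n * ip I (w m) (w n)))"
      unfolding ip_sum_left ip_sum_right ..
    also have "\<dots> = (\<Sum>m\<in>M. cnj (c m) * (\<Sum>n\<in>M. if n = m then c m else 0))"
      using orthonD[OF that(1)] by (intro sum.cong refl arg_cong2[where f = "(*)"]) auto
    also have "\<dots> = (\<Sum>m\<in>M. c m * cnj (c m))" using that(2) by (simp add: mult.commute)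
    also have "\<dots> = of_real (\<Sum>m\<in>M. (cmod (c m))\<^sup>2)"
      unfolding complex_mult_cnj_cmod2 by simp
    finally show ?thesis using of_real_eq_iff by blast
  qed
  have Yu: "(\<Sum>j\<in>I. Y i j * u k j) = (\<Sum>l\<in>L. y k l * v l i)" if k: "k \<in> N" for i k
  proof -
    have "(\<Sum>j\<in>I. Y i j * u k j) = (\<Sum>j\<in>I. \<Sum>m\<in>N. (\<Sum>l\<in>L. y m l * v l i) * (cnj (u m j) * u k j))"
      unfolding Y_def sum_distrib_right by (simp add: mult_ac)
    also have "\<dots> = (\<Sum>m\<in>N. (\<Sum>l\<in>L. y m l * v l i) * ip I (u m) (u k))"
      unfolding ip_def by (subst sum.swap) (simp add: sum_distrib_left)
    also have "\<dots> = (\<Sum>m\<in>N. if m = k then (\<Sum>l\<in>L. y k l * v l i) else 0)"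
      using orthonD[OF o] k by (intro sum.cong refl) auto
    finally show ?thesis using k fN by simp
  qed
  have vY: "ip I (v l) (\<lambda>a. Y a j) = cnj (\<Sum>k\<in>N. cnj (y k l) * u k j)" if l: "l \<in> L" for l j
  proof -
    have "ip I (v l) (\<lambda>a. Y a j) = ip I (v l) (\<lambda>a. \<Sum>m\<in>L. (\<Sum>k\<in>N. y k m * cnj (u k j)) * v m a)"
      unfolding Y_def sum_distrib_right by (subst sum.swap) (simp add: mult_ac)
    also have "\<dots> = (\<Sum>m\<in>L. if m = l then (\<Sum>k\<in>N. y k l * cnj (u k j)) else 0)"
      unfolding ip_sum_right using orthonD[OF oL] l by (intro sum.cong refl) auto
    finally show ?thesis using l fL by simp
  qed
  have "qform I \<rho> \<sigma> t Y = 2 * (\<Sum>k\<in>N. p k * (\<Sum>l\<in>L. Re (cnj (y k l) * ip I (v l) (u k))))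
     - (\<Sum>l\<in>L. q l * (\<Sum>k\<in>N. (cmod (y k l))\<^sup>2)) - t * (\<Sum>k\<in>N. p k * (\<Sum>l\<in>L. (cmod (y k l))\<^sup>2))"
  proof -
    have a: "(\<Sum>k\<in>N. p k * Re (ip I (\<lambda>i. \<Sum>j\<in>I. Y i j * u k j) (u k))) = (\<Sum>k\<in>N. p k * (\<Sum>l\<in>L. Re (cnj (y k l) * ip I (v l) (u k))))"
      by (intro sum.cong refl) (simp add: Yu ip_sum_left)
    have b: "(\<Sum>l\<in>L. q l * (\<Sum>j\<in>I. (cmod (ip I (v l) (\<lambda>a. Y a j)))\<^sup>2)) = (\<Sum>l\<in>L. q l * (\<Sum>k\<in>N. (cmod (y k l))\<^sup>2))"
      using ipsq[OF o fN] by (intro sum.cong refl) (simp only: vY complex_mod_cnj)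
    have c: "(\<Sum>k\<in>N. p k * (\<Sum>a\<in>I. (cmod (\<Sum>j\<in>I. Y a j * u k j))\<^sup>2)) = (\<Sum>k\<in>N. p k * (\<Sum>l\<in>L. (cmod (y k l))\<^sup>2))"
      using ipsq[OF oL fL] by (intro sum.cong refl) (simp add: Yu)
    show ?thesis unfolding qform_spec[OF s s'] a b c ..
  qed
  also have "\<dots> = (\<Sum>k\<in>N. \<Sum>l\<in>L. 2 * (p k * Re (cnj (y k l) * ip I (v l) (u k))) - (q l + t * p k) * (cmod (y k l))\<^sup>2)"
    by (rule sum_combine)
  also have "\<dots> = (\<Sum>k\<in>N. \<Sum>l\<in>L. (p k)\<^sup>2 * (cmod (ip I (v l) (u k)))\<^sup>2 / (q l + t * p k))"
  proof (intro sum.cong refl)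
    fix k l assume kl: "k \<in> N" "l \<in> L"
    define d where "d = q l + t * p k"
    have d: "d > 0" unfolding d_def using p q t kl by (simp add: add_pos_pos)
    define c where "c = ip I (v l) (u k)"
    have y: "y k l = of_real (p k / d) * c" unfolding y_def d_def c_def ..
    have "cnj (y k l) * c = of_real (p k / d) * (c * cnj c)" unfolding y by (simp add: mult_ac)
    then have 1: "Re (cnj (y k l) * c) = p k / d * (cmod c)\<^sup>2"
      unfolding complex_mult_cnj_cmod2 of_real_mult[symmetric] Re_complex_of_real by simp
    have 2: "(cmod (y k l))\<^sup>2 = (p k / d)\<^sup>2 * (cmod c)\<^sup>2"
      by (simp only: y norm_mult power_mult_distrib norm_of_real power2_abs)
    show "2 * (p k * Re (cnj (y k l) * ip I (v l) (u k))) - (q l + t * p k) * (cmod (y k l))\<^sup>2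
       = (p k)\<^sup>2 * (cmod (ip I (v l) (u k)))\<^sup>2 / (q l + t * p k)"
      unfolding c_def[symmetric] d_def[symmetric] 1 2 using d by (simp add: field_simps power2_eq_square)
  qed
  finally show ?thesis by blast
qed

lemma sum_Times3: "(\<Sum>i\<in>B \<times> R \<times> S. f i) = (\<Sum>x\<in>B \<times> R. \<Sum>s\<in>S. f (fst x, snd x, s))"
  by (simp add: sum.cartesian_product' case_prod_unfold)

text \<open>Each term of the functional is linear in \<open>\<rho>\<close> or in
  \<open>\<sigma>\<close>, and the identity on \<open>S\<close> forces equal \<open>S\<close>
  indices on both sides, so that only the sum over the \<open>S\<close> diagonal survives.\<close>

lemma qform_tensor_one:
  fixes B :: "'a set" and R :: "'b set" and S :: "'c set"
  assumes S: "finite S"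
  shows "qform (B \<times> R \<times> S) \<rho> \<sigma> t (\<lambda>(b, r, s) (b', r', s'). if s = s' then Y (b, r) (b', r') else 0)
    = qform (B \<times> R) (\<lambda>x y. \<Sum>s\<in>S. \<rho> (fst x, snd x, s) (fst y, snd y, s)) (\<lambda>x y. \<Sum>s\<in>S. \<sigma> (fst x, snd x, s) (fst y, snd y, s)) t Y"
proof -
  define e where "e = (\<lambda>(x :: 'a \<times> 'b) (s :: 'c). (fst x, snd x, s))"
  define Z where "Z = (\<lambda>(b, r, s :: 'c) (b', r', s'). if s = s' then Y (b, r) (b', r') else 0 :: complex)"
  have Z: "Z (e x s) (e y s') = (if s = s' then Y x y else 0)" for x y s s'
    unfolding Z_def e_def by simp
  have sm: "(\<Sum>i\<in>B \<times> R \<times> S. f i) = (\<Sum>x\<in>B \<times> R. \<Sum>s\<in>S. f (e x s))" for f :: "_ \<Rightarrow> complex"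
    unfolding e_def by (rule sum_Times3)
  have d: "(\<Sum>s\<in>S. g s * (if s = s' then c else 0)) = g s' * c" "(\<Sum>s\<in>S. (if s = s' then c else 0) * g s) = c * g s'"
    "(\<Sum>s\<in>S. g s * (if s' = s then c else 0)) = g s' * c" "(\<Sum>s\<in>S. (if s' = s then c else 0) * g s) = c * g s'"
    if "s' \<in> S" for g :: "'c \<Rightarrow> complex" and s' c
    using that S by (simp_all add: if_distrib[of "\<lambda>y. _ * y"] if_distrib[of "\<lambda>y. y * _"] cong: if_cong)
  have dc: "cnj (if s = s' then a else 0) = (if s = s' then cnj a else 0)" for s s' :: 'c and a by simp
  have 1: "(\<Sum>i\<in>B \<times> R \<times> S. \<Sum>j\<in>B \<times> R \<times> S. \<rho> i j * cnj (Z i j))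
    = (\<Sum>x\<in>B \<times> R. \<Sum>y\<in>B \<times> R. (\<Sum>s\<in>S. \<rho> (e x s) (e y s)) * cnj (Y x y))"
  proof -
    have "(\<Sum>i\<in>B \<times> R \<times> S. \<Sum>j\<in>B \<times> R \<times> S. \<rho> i j * cnj (Z i j))
      = (\<Sum>x\<in>B \<times> R. \<Sum>s\<in>S. \<Sum>y\<in>B \<times> R. \<rho> (e x s) (e y s) * cnj (Y x y))"
      unfolding sm Z dc by (simp add: d)
    also have "\<dots> = (\<Sum>x\<in>B \<times> R. \<Sum>y\<in>B \<times> R. \<Sum>s\<in>S. \<rho> (e x s) (e y s) * cnj (Y x y))"
      by (intro sum.cong refl sum.swap)
    finally show ?thesis by (simp add: sum_distrib_right)
  qed
  \<comment> \<open>Stated for arbitrary \<open>Z\<close> and \<open>Y\<close>, because the term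
    with \<open>\<rho>\<close> needs it for their adjoints.\<close>
  have 2: "conj_trace (B \<times> R \<times> S) \<sigma> Z = conj_trace (B \<times> R) (\<lambda>x y. \<Sum>s\<in>S. \<sigma> (e x s) (e y s)) Y"
    if Z: "\<And>x y s s'. Z (e x s) (e y s') = (if s = s' then Y x y else 0)" for \<sigma> Z and Y :: "'a \<times> 'b \<Rightarrow> 'a \<times> 'b \<Rightarrow> complex"
  proof -
    have "(\<Sum>j\<in>B \<times> R \<times> S. \<Sum>a\<in>B \<times> R \<times> S. \<Sum>b\<in>B \<times> R \<times> S. cnj (Z a j) * \<sigma> a b * Z b j)
      = (\<Sum>z\<in>B \<times> R. \<Sum>w\<in>S. \<Sum>x\<in>B \<times> R. \<Sum>y\<in>B \<times> R. cnj (Y x z) * \<sigma> (e x w) (e y w) * Y y z)"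
    proof -
      have "(\<Sum>s\<in>S. \<Sum>y\<in>B \<times> R. \<Sum>s'\<in>S. cnj (Z (e x s) (e z w)) * \<sigma> (e x s) (e y s') * Z (e y s') (e z w))
        = (\<Sum>y\<in>B \<times> R. cnj (Y x z) * \<sigma> (e x w) (e y w) * Y y z)" if w: "w \<in> S" for x z w
      proof -
        have "(\<Sum>s\<in>S. \<Sum>y\<in>B \<times> R. \<Sum>s'\<in>S. cnj (Z (e x s) (e z w)) * \<sigma> (e x s) (e y s') * Z (e y s') (e z w))
          = (\<Sum>s\<in>S. \<Sum>y\<in>B \<times> R. (if s = w then cnj (Y x z) else 0) * (\<sigma> (e x s) (e y w) * Y y z))"
          unfolding Z dc d(1)[OF w] by (simp add: mult.assoc)
        also have "\<dots> = (\<Sum>y\<in>B \<times> R. \<Sum>s\<in>S. (if s = w then cnj (Y x z) else 0) * (\<sigma> (e x s) (e y w) * Y y z))"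
          by (rule sum.swap)
        finally show ?thesis unfolding d(2)[OF w] by (simp add: mult.assoc)
      qed
      then show ?thesis unfolding sm by (intro sum.cong refl)
    qed
    also have "\<dots> = (\<Sum>z\<in>B \<times> R. \<Sum>x\<in>B \<times> R. \<Sum>w\<in>S. \<Sum>y\<in>B \<times> R. cnj (Y x z) * \<sigma> (e x w) (e y w) * Y y z)"
      by (intro sum.cong refl sum.swap)
    also have "\<dots> = (\<Sum>z\<in>B \<times> R. \<Sum>x\<in>B \<times> R. \<Sum>y\<in>B \<times> R. \<Sum>w\<in>S. cnj (Y x z) * \<sigma> (e x w) (e y w) * Y y z)"
      by (intro sum.cong refl sum.swap)
    finally show ?thesis unfolding conj_trace_def by (simp add: sum_distrib_right sum_distrib_left)
  qed
  have Z': "cnj (Z (e y s') (e x s)) = (if s = s' then cnj (Y y x) else 0)" for x y s s' unfolding Z by auto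
  show ?thesis unfolding qform_def Z_def[symmetric] 1 2[OF Z] 2[of "\<lambda>i a. cnj (Z a i)", OF Z'] unfolding e_def ..
qed

text \<open>The function \<open>\<Sum> c p ln(q + t p) - \<Sum> c' p' ln(q' + t p')\<close> of \<open>t\<close> increases, and its limit at
  infinity exists because the terms \<open>ln t\<close> cancel.\<close>
lemma sum_ln_ratio_mono:
  fixes c p q :: "'k \<Rightarrow> real" and c' p' q' :: "'l \<Rightarrow> real"
  assumes fin: "finite K" "finite K'"
    and pos: "\<And>k. k \<in> K \<Longrightarrow> p k > 0 \<and> q k > 0" "\<And>k. k \<in> K' \<Longrightarrow> p' k > 0 \<and> q' k > 0"
    and tot: "(\<Sum>k\<in>K. c k * p k) = (\<Sum>k\<in>K'. c' k * p' k)"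
    and le: "\<And>t. t > 0 \<Longrightarrow> (\<Sum>k\<in>K'. (p' k)\<^sup>2 * c' k / (q' k + t * p' k)) \<le> (\<Sum>k\<in>K. (p k)\<^sup>2 * c k / (q k + t * p k))"
  shows "(\<Sum>k\<in>K'. c' k * p' k * (ln (p' k) - ln (q' k))) \<le> (\<Sum>k\<in>K. c k * p k * (ln (p k) - ln (q k)))"
proof -
  \<comment> \<open>At 0 the logarithms are those of \<open>q\<close> and \<open>q'\<close>; at
    infinity, after cancellation, those of \<open>p\<close> and \<open>p'\<close>. Comparing the two
    ends is the claim, and \<open>le\<close> says that the derivative is non-negative in
    between.\<close>
  define G where "G = (\<lambda>t. (\<Sum>k\<in>K. c k * p k * ln (q k + t * p k)) - (\<Sum>k\<in>K'. c' k * p' k * ln (q' k + t * p' k)))"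
  have der: "(G has_real_derivative ((\<Sum>k\<in>K. (p k)\<^sup>2 * c k / (q k + t * p k)) - (\<Sum>k\<in>K'. (p' k)\<^sup>2 * c' k / (q' k + t * p' k)))) (at t)"
    if t: "t \<ge> 0" for t
  proof -
    have 1: "((\<lambda>t. a * p * ln (q + t * p)) has_real_derivative (p\<^sup>2 * a / (q + t * p))) (at t)"
      if "p > 0" "q > 0" for a p q :: real
    proof -
      have "q + t * p > 0" using that t by (simp add: add_pos_nonneg)
      then show ?thesis by (auto intro!: derivative_eq_intros simp: power2_eq_square field_simps)
    qed
    show ?thesis unfolding G_def by (intro DERIV_diff DERIV_sum 1) (use pos in auto)
  qed
  have mono: "G 0 \<le> G t" if t: "t > 0" for t
  proof (rule DERIV_nonneg_imp_increasing_open[of 0 t G])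
    show "0 \<le> t" using t by simp
    show "\<exists>y. (G has_real_derivative y) (at x) \<and> 0 \<le> y" if "0 < x" "x < t" for x
      using der[of x] le[of x] that by (intro exI conjI) auto
    show "continuous_on {0..t} G"
      using der by (intro continuous_at_imp_continuous_on ballI DERIV_isCont) auto
  qed
  \<comment> \<open>The factor \<open>t\<close> is pulled out of each logarithm; equality of the
    totals in \<open>tot\<close> cancels the \<open>ln t\<close> contributions.\<close>
  have alt: "G t = (\<Sum>k\<in>K. c k * p k * ln (p k + q k / t)) - (\<Sum>k\<in>K'. c' k * p' k * ln (p' k + q' k / t))" if t: "t > 0" for t
  proof -
    have 1: "ln (b + t * a) = ln t + ln (a + b / t)" if "a > 0" "b > 0" for a b :: real
    proof -
      have "b + t * a = t * (a + b / t)" using t by (simp add: field_simps)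
      moreover have "a + b / t > 0" using that t by (simp add: add_pos_pos)
      ultimately show ?thesis using t by (simp add: ln_mult)
    qed
    have "(\<Sum>k\<in>K. c k * p k * ln (q k + t * p k)) = (\<Sum>k\<in>K. c k * p k) * ln t + (\<Sum>k\<in>K. c k * p k * ln (p k + q k / t))"
      unfolding sum_distrib_right sum.distrib[symmetric] using pos(1) by (intro sum.cong refl) (simp add: 1 distrib_left)
    moreover have "(\<Sum>k\<in>K'. c' k * p' k * ln (q' k + t * p' k)) = (\<Sum>k\<in>K'. c' k * p' k) * ln t + (\<Sum>k\<in>K'. c' k * p' k * ln (p' k + q' k / t))"
      unfolding sum_distrib_right sum.distrib[symmetric] using pos(2) by (intro sum.cong refl) (simp add: 1 distrib_left)
    ultimately show ?thesis unfolding G_def tot by simp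
  qed
  have lim1: "((\<lambda>t. ln (a + b / t)) \<longlongrightarrow> ln a) at_top" if "a > 0" for a b :: real
  proof -
    have "((\<lambda>t. a + b / t) \<longlongrightarrow> a + 0) at_top"
      by (intro tendsto_add tendsto_const real_tendsto_divide_at_top[where c = b] filterlim_ident)
    then show ?thesis using that by (intro tendsto_ln) auto
  qed
  have lim: "((\<lambda>t. (\<Sum>k\<in>K. c k * p k * ln (p k + q k / t)) - (\<Sum>k\<in>K'. c' k * p' k * ln (p' k + q' k / t)))
     \<longlongrightarrow> (\<Sum>k\<in>K. c k * p k * ln (p k)) - (\<Sum>k\<in>K'. c' k * p' k * ln (p' k))) at_top"
    using pos by (intro tendsto_diff tendsto_sum tendsto_mult tendsto_const lim1) auto
  have "G 0 \<le> (\<Sum>k\<in>K. c k * p k * ln (p k)) - (\<Sum>k\<in>K'. c' k * p' k * ln (p' k))"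
  proof (rule tendsto_lowerbound[OF lim])
    show "\<forall>\<^sub>F t in at_top. G 0 \<le> (\<Sum>k\<in>K. c k * p k * ln (p k + q k / t)) - (\<Sum>k\<in>K'. c' k * p' k * ln (p' k + q' k / t))"
      using eventually_gt_at_top[of "0 :: real"] by eventually_elim (simp add: alt[symmetric] mono)
  qed simp
  then show ?thesis unfolding G_def by (simp add: right_diff_distrib sum_subtractf)
qed

section \<open>Conditional entropy as a relative entropy\<close>

lemma projection_fixed_norm:
  assumes o: "orthon I L v" and L: "finite L" and x: "\<And>i. i \<in> I \<Longrightarrow> x i = (\<Sum>l\<in>L. ip I (v l) x * v l i)"
    and n: "ip I x x = 1"
  shows "(\<Sum>l\<in>L. (cmod (ip I (v l) x))\<^sup>2) = 1"
proof -
  have "ip I (\<lambda>i. x i - (\<Sum>l\<in>L. ip I (v l) x * v l i)) (\<lambda>i. x i - (\<Sum>l\<in>L. ip I (v l) x * v l i)) = 0"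
    unfolding ip_def[of I "\<lambda>i. x i - _ i"] using x by (intro sum.neutral) auto
  then have "complex_of_real (\<Sum>l\<in>L. (cmod (ip I (v l) x))\<^sup>2) = of_real 1"
    unfolding bessel_residual[OF o L] n by simp
  then show ?thesis using of_real_eq_iff by blast
qed

text \<open>The first factor carries the identity: these are the eigendata of \<open>1 \<otimes> \<tau>\<close>.\<close>
lemma spec_one_tensor:
  assumes B: "finite B" and s: "spec J \<tau> L q v"
  shows "spec (B \<times> J) (\<lambda>x y. if fst x = fst y then \<tau> (snd x) (snd y) else 0) (B \<times> L) (q \<circ> snd)
     (\<lambda>z x. if fst x = fst z then v (snd z) (snd x) else 0)"
proof -
  have fL: "finite L" and oL: "orthon J L v" and q: "\<And>l. l \<in> L \<Longrightarrow> q l > 0"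
    and eq: "\<And>i j. i \<in> J \<Longrightarrow> j \<in> J \<Longrightarrow> \<tau> i j = (\<Sum>l\<in>L. of_real (q l) * v l i * cnj (v l j))"
    using s unfolding spec_def by auto
  have "ip (B \<times> J) (\<lambda>x. if fst x = b then v l (snd x) else 0) (\<lambda>x. if fst x = b' then v l' (snd x) else 0)
     = (if b = b' then ip J (v l) (v l') else 0)" if "b \<in> B" "b' \<in> B" for b b' l l'
  proof -
    have "ip (B \<times> J) (\<lambda>x. if fst x = b then v l (snd x) else 0) (\<lambda>x. if fst x = b' then v l' (snd x) else 0)
      = (\<Sum>a\<in>B. if a = b then if b = b' then ip J (v l) (v l') else 0 else 0)"
      unfolding ip_def sum.cartesian_product' by (intro sum.cong refl) (auto simp: ip_def)
    then show ?thesis using B that by simp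
  qed
  then have o: "orthon (B \<times> J) (B \<times> L) (\<lambda>z x. if fst x = fst z then v (snd z) (snd x) else 0)"
    unfolding orthon_def using orthonD[OF oL] by auto
  have "(if fst x = fst y then \<tau> (snd x) (snd y) else 0) = (\<Sum>z\<in>B \<times> L. of_real ((q \<circ> snd) z) *
      (if fst x = fst z then v (snd z) (snd x) else 0) * cnj (if fst y = fst z then v (snd z) (snd y) else 0))"
    if "x \<in> B \<times> J" "y \<in> B \<times> J" for x y
  proof -
    have "(\<Sum>z\<in>B \<times> L. of_real ((q \<circ> snd) z) *
      (if fst x = fst z then v (snd z) (snd x) else 0) * cnj (if fst y = fst z then v (snd z) (snd y) else 0))
      = (\<Sum>b\<in>B. if b = fst x then if fst x = fst y then \<tau> (snd x) (snd y) else 0 else 0)"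
      unfolding sum.cartesian_product' using that by (intro sum.cong refl) (auto simp: eq)
    then show ?thesis using B that by auto
  qed
  then show ?thesis using o q fL B unfolding spec_def by auto
qed

text \<open>\<open>D(\<rho> \<parallel> 1 \<otimes> \<rho>\<^sub>J) = S(\<rho>\<^sub>J) - S(\<rho>)\<close>, together with the support condition.\<close>
lemma conditional_entropy_spec:
  fixes \<Psi> :: "'b \<times> 'j \<Rightarrow> 'e \<Rightarrow> complex"
  assumes fin: "finite B" "finite J" "finite E"
    and s: "spec (B \<times> J) (gram E \<Psi>) N p u"
    and s': "spec J (gram (B \<times> E) (\<lambda>j (b, e). \<Psi> (b, j) e)) L q v"
    and w_def: "w = (\<lambda>z x. if fst x = fst z then v (snd z) (snd x) else 0)"
  shows "\<And>k i. k \<in> N \<Longrightarrow> i \<in> B \<times> J \<Longrightarrow> u k i = (\<Sum>z\<in>B \<times> L. ip (B \<times> J) (w z) (u k) * w z i)"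
    and "(\<Sum>k\<in>N. \<Sum>z\<in>B \<times> L. (cmod (ip (B \<times> J) (w z) (u k)))\<^sup>2 * p k) = (\<Sum>k\<in>N. p k)"
    and "(\<Sum>k\<in>N. \<Sum>z\<in>B \<times> L. (cmod (ip (B \<times> J) (w z) (u k)))\<^sup>2 * p k * (ln (p k) - ln (q (snd z))))
      = ent J (gram (B \<times> E) (\<lambda>j (b, e). \<Psi> (b, j) e)) - ent (B \<times> J) (gram E \<Psi>)"
proof -
  have fL: "finite L" and oL: "orthon J L v" and q: "\<And>l. l \<in> L \<Longrightarrow> q l > 0"
    and fN: "finite N" and o: "orthon (B \<times> J) N u" and p: "\<And>k. k \<in> N \<Longrightarrow> p k > 0"
    using s s' unfolding spec_def by auto
  have ow: "orthon (B \<times> J) (B \<times> L) w" and fw: "finite (B \<times> L)"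
    using spec_one_tensor[OF fin(1) s'] fL fin unfolding spec_def w_def by auto
  have ipw: "ip (B \<times> J) (w (b, l)) x = ip J (v l) (\<lambda>j. x (b, j))" if "b \<in> B" for b l x
  proof -
    have "ip (B \<times> J) (w (b, l)) x = (\<Sum>a\<in>B. if a = b then ip J (v l) (\<lambda>j. x (b, j)) else 0)"
      unfolding ip_def sum.cartesian_product' w_def by (intro sum.cong refl) auto
    then show ?thesis using that fin by simp
  qed
  \<comment> \<open>For fixed \<open>b\<close> and \<open>e\<close>, the vector with entries
    \<open>\<Psi> (b, j) e\<close> is one of the columns generating the marginal on
    \<open>J\<close>, so it lies in the range of that marginal.\<close>
  have \<Psi>: "\<Psi> i e = (\<Sum>z\<in>B \<times> L. ip (B \<times> J) (w z) (\<lambda>i. \<Psi> i e) * w z i)" if i: "i \<in> B \<times> J" and e: "e \<in> E" for i e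
  proof -
    obtain b j where bj: "i = (b, j)" "b \<in> B" "j \<in> J" using i by auto
    have "\<Psi> (b, j) e = (\<Sum>l\<in>L. ip J (v l) (\<lambda>j. \<Psi> (b, j) e) * v l j)"
      using spec_gram_expand[OF _ s' bj(3), of "(b, e)"] fin bj e by simp
    also have "\<dots> = (\<Sum>a\<in>B. if a = b then (\<Sum>l\<in>L. ip (B \<times> J) (w (b, l)) (\<lambda>i. \<Psi> i e) * w (b, l) i) else 0)"
      using fin bj by (simp add: ipw) (simp add: w_def)
    also have "\<dots> = (\<Sum>z\<in>B \<times> L. ip (B \<times> J) (w z) (\<lambda>i. \<Psi> i e) * w z i)"
      unfolding sum.cartesian_product' using bj by (intro sum.cong refl) (auto simp: w_def)
    finally show ?thesis unfolding bj .
  qed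
  show supp: "u k i = (\<Sum>z\<in>B \<times> L. ip (B \<times> J) (w z) (u k) * w z i)" if k: "k \<in> N" and i: "i \<in> B \<times> J" for k i
  proof -
    \<comment> \<open>The eigenvalue equation for \<open>u k\<close>, with the kernel written as a
      product of amplitudes and divided by \<open>p k > 0\<close>, expresses \<open>u k\<close>
      through the columns of \<open>\<Psi>\<close>.\<close>
    define a where "a = (\<lambda>e. (\<Sum>j\<in>B \<times> J. cnj (\<Psi> j e) * u k j) / of_real (p k))"
    have u: "u k i = (\<Sum>e\<in>E. a e * \<Psi> i e)" if "i \<in> B \<times> J" for i
    proof -
      have "of_real (p k) * u k i = (\<Sum>j\<in>B \<times> J. \<Sum>e\<in>E. \<Psi> i e * cnj (\<Psi> j e) * u k j)"
        unfolding spec_eigen[OF s that k, symmetric] gram_def sum_distrib_right ..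
      also have "\<dots> = (\<Sum>e\<in>E. \<Psi> i e * (\<Sum>j\<in>B \<times> J. cnj (\<Psi> j e) * u k j))"
        unfolding sum_distrib_left by (subst sum.swap) (simp add: mult_ac)
      also have "\<dots> = of_real (p k) * (\<Sum>e\<in>E. a e * \<Psi> i e)"
        unfolding sum_distrib_left[of "of_real (p k)"] using p[OF k] by (intro sum.cong refl) (simp add: a_def)
      finally show ?thesis using p[OF k] by simp
    qed
    have ipu: "ip (B \<times> J) (w z) (u k) = (\<Sum>e\<in>E. a e * ip (B \<times> J) (w z) (\<lambda>i. \<Psi> i e))" for z
      unfolding ip_sum_right[symmetric] using u by (intro ip_cong) auto
    have "u k i = (\<Sum>e\<in>E. a e * (\<Sum>z\<in>B \<times> L. ip (B \<times> J) (w z) (\<lambda>i. \<Psi> i e) * w z i))"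
      unfolding u[OF i] using \<Psi>[OF i] by (intro sum.cong refl) simp
    also have "\<dots> = (\<Sum>z\<in>B \<times> L. ip (B \<times> J) (w z) (u k) * w z i)"
      unfolding ipu sum_distrib_left sum_distrib_right by (subst sum.swap) (simp add: mult_ac)
    finally show ?thesis .
  qed
  \<comment> \<open>The equality case of Bessel: the support property makes \<open>u k\<close> its
    own projection.\<close>
  have one: "(\<Sum>z\<in>B \<times> L. (cmod (ip (B \<times> J) (w z) (u k)))\<^sup>2) = 1" if k: "k \<in> N" for k
    using projection_fixed_norm[OF ow fw supp[OF k]] orthonD[OF o k k] by simp
  show "(\<Sum>k\<in>N. \<Sum>z\<in>B \<times> L. (cmod (ip (B \<times> J) (w z) (u k)))\<^sup>2 * p k) = (\<Sum>k\<in>N. p k)"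
    by (simp add: sum_distrib_right[symmetric] one)
  have A: "(\<Sum>k\<in>N. \<Sum>z\<in>B \<times> L. (cmod (ip (B \<times> J) (w z) (u k)))\<^sup>2 * p k * ln (p k)) = - ent (B \<times> J) (gram E \<Psi>)"
    unfolding ent_eq[OF s] sum_negf minus_minus
    by (intro sum.cong refl) (simp add: sum_distrib_right[symmetric] one)
  \<comment> \<open>The left side is the expectation of the projection onto \<open>v l\<close>, with
    the identity on \<open>B\<close>, in the joint state; it depends only on the marginal on
    \<open>J\<close> and equals its eigenvalue.\<close>
  have ql: "(\<Sum>k\<in>N. \<Sum>b\<in>B. p k * (cmod (ip (B \<times> J) (w (b, l)) (u k)))\<^sup>2) = q l" if l: "l \<in> L" for l
  proof -
    have "complex_of_real (q l) = (\<Sum>i\<in>J. \<Sum>j\<in>J. cnj (v l i) * gram (B \<times> E) (\<lambda>j (b, e). \<Psi> (b, j) e) i j * v l j)"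
    proof -
      have "(\<Sum>i\<in>J. \<Sum>j\<in>J. cnj (v l i) * gram (B \<times> E) (\<lambda>j (b, e). \<Psi> (b, j) e) i j * v l j)
        = (\<Sum>i\<in>J. cnj (v l i) * (\<Sum>j\<in>J. gram (B \<times> E) (\<lambda>j (b, e). \<Psi> (b, j) e) i j * v l j))"
        by (simp add: sum_distrib_left mult_ac)
      also have "\<dots> = (\<Sum>i\<in>J. of_real (q l) * (cnj (v l i) * v l i))"
        by (intro sum.cong refl, subst spec_eigen[OF s' _ l]) (simp_all add: mult_ac)
      also have "\<dots> = of_real (q l) * ip J (v l) (v l)" unfolding ip_def sum_distrib_left ..
      finally show ?thesis using orthonD[OF oL l l] by simp
    qed
    also have "\<dots> = (\<Sum>b\<in>B. \<Sum>e\<in>E. of_real ((cmod (ip J (v l) (\<lambda>j. \<Psi> (b, j) e)))\<^sup>2))"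
      unfolding gram_form complex_mult_cnj_cmod2 sum.cartesian_product' by simp
    also have "\<dots> = (\<Sum>b\<in>B. \<Sum>e\<in>E. ip (B \<times> J) (w (b, l)) (\<lambda>i. \<Psi> i e) * cnj (ip (B \<times> J) (w (b, l)) (\<lambda>i. \<Psi> i e)))"
      unfolding complex_mult_cnj_cmod2 by (intro sum.cong refl) (simp add: ipw)
    also have "\<dots> = (\<Sum>b\<in>B. of_real (\<Sum>k\<in>N. p k * (cmod (ip (B \<times> J) (u k) (w (b, l))))\<^sup>2))"
      unfolding gram_form[symmetric] form_spec[OF s] ..
    also have "\<dots> = of_real (\<Sum>b\<in>B. \<Sum>k\<in>N. p k * (cmod (ip (B \<times> J) (w (b, l)) (u k)))\<^sup>2)"
      unfolding of_real_sum by (subst cmod_ip_commute) (rule refl)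
    finally have "q l = (\<Sum>b\<in>B. \<Sum>k\<in>N. p k * (cmod (ip (B \<times> J) (w (b, l)) (u k)))\<^sup>2)"
      using of_real_eq_iff by blast
    then show ?thesis by (subst sum.swap) simp
  qed
  have "(\<Sum>k\<in>N. \<Sum>z\<in>B \<times> L. (cmod (ip (B \<times> J) (w z) (u k)))\<^sup>2 * p k * ln (q (snd z)))
    = (\<Sum>k\<in>N. \<Sum>b\<in>B. \<Sum>l\<in>L. p k * (cmod (ip (B \<times> J) (w (b, l)) (u k)))\<^sup>2 * ln (q l))"
    unfolding sum.cartesian_product' by (simp add: mult_ac)
  also have "\<dots> = (\<Sum>l\<in>L. \<Sum>k\<in>N. \<Sum>b\<in>B. p k * (cmod (ip (B \<times> J) (w (b, l)) (u k)))\<^sup>2 * ln (q l))"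
      by (rule sum_swap3)
  also have "\<dots> = (\<Sum>l\<in>L. q l * ln (q l))"
    by (intro sum.cong refl) (simp add: sum_distrib_right[symmetric] ql)
  also have "\<dots> = - ent J (gram (B \<times> E) (\<lambda>j (b, e). \<Psi> (b, j) e))"
    unfolding ent_eq[OF s'] by (simp add: sum_negf)
  finally have C: "(\<Sum>k\<in>N. \<Sum>z\<in>B \<times> L. (cmod (ip (B \<times> J) (w z) (u k)))\<^sup>2 * p k * ln (q (snd z)))
     = - ent J (gram (B \<times> E) (\<lambda>j (b, e). \<Psi> (b, j) e))" .
  show "(\<Sum>k\<in>N. \<Sum>z\<in>B \<times> L. (cmod (ip (B \<times> J) (w z) (u k)))\<^sup>2 * p k * (ln (p k) - ln (q (snd z))))
      = ent J (gram (B \<times> E) (\<lambda>j (b, e). \<Psi> (b, j) e)) - ent (B \<times> J) (gram E \<Psi>)"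
    unfolding right_diff_distrib sum_subtractf A C by simp
qed

text \<open>Read as S(B|RS) \<le> S(B|R) for the vector \<open>\<Psi>\<close> on \<open>B\<close>,
  \<open>R\<close>, \<open>S\<close>, \<open>E\<close>. A negative conditional entropy is the
  relative entropy of the joint state to identity times marginal, and tracing out \<open>S\<close>
  can only decrease the latter.\<close>

theorem strong_subadditivity:
  fixes \<Psi> :: "'b \<Rightarrow> 'r \<Rightarrow> 's \<Rightarrow> 'e \<Rightarrow> complex"
  assumes fin: "finite B" "finite R" "finite S" "finite E"
  shows "ent (B \<times> R \<times> S) (gram E (\<lambda>(b, r, s) e. \<Psi> b r s e)) - ent (R \<times> S) (gram (B \<times> E) (\<lambda>(r, s) (b, e). \<Psi> b r s e))
    \<le> ent (B \<times> R) (gram (S \<times> E) (\<lambda>(b, r) (s, e). \<Psi> b r s e)) - ent R (gram (B \<times> S \<times> E) (\<lambda>r (b, s, e). \<Psi> b r s e))"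
proof -
  define \<Psi>1 where "\<Psi>1 = (\<lambda>(b, r, s) e. \<Psi> b r s e)"
  define \<Psi>2 where "\<Psi>2 = (\<lambda>(b, r) (s, e). \<Psi> b r s e)"
  have m1: "(\<lambda>(r, s) (b, e). \<Psi> b r s e) = (\<lambda>j (b, e). \<Psi>1 (b, j) e)"
    unfolding \<Psi>1_def by (auto simp: fun_eq_iff)
  have m2: "(\<lambda>r (b, s, e). \<Psi> b r s e) = (\<lambda>j (b, e). \<Psi>2 (b, j) e)"
    unfolding \<Psi>2_def by (auto simp: fun_eq_iff)
  have fin1: "finite (R \<times> S)" "finite (B \<times> R \<times> S)" "finite (B \<times> R)" "finite (S \<times> E)" using fin by auto
  obtain N1 :: "nat set" and p1 u1 where s1: "spec (B \<times> R \<times> S) (gram E \<Psi>1) N1 p1 u1"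
    by (rule spec_gram_exists[OF fin1(2)])
  obtain L1 :: "nat set" and q1 v1 where t1: "spec (R \<times> S) (gram (B \<times> E) (\<lambda>j (b, e). \<Psi>1 (b, j) e)) L1 q1 v1"
    by (rule spec_gram_exists[OF fin1(1)])
  obtain N2 :: "nat set" and p2 u2 where s2: "spec (B \<times> R) (gram (S \<times> E) \<Psi>2) N2 p2 u2"
    by (rule spec_gram_exists[OF fin1(3)])
  obtain L2 :: "nat set" and q2 v2 where t2: "spec R (gram (B \<times> S \<times> E) (\<lambda>j (b, e). \<Psi>2 (b, j) e)) L2 q2 v2"
    by (rule spec_gram_exists[OF fin(2)])
  note o1 = spec_one_tensor[OF fin(1) t1] and o2 = spec_one_tensor[OF fin(1) t2]
  define w1 where "w1 = (\<lambda>(z :: 'b \<times> nat) x. if fst x = fst z then v1 (snd z) (snd x) else (0 :: complex))"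
  define w2 where "w2 = (\<lambda>(z :: 'b \<times> nat) x. if fst x = fst z then v2 (snd z) (snd x) else (0 :: complex))"
  note ce1 = conditional_entropy_spec[OF fin(1) fin1(1) fin(4) s1 t1 w1_def]
  note ce2 = conditional_entropy_spec[OF fin(1) fin(2) fin1(4) s2 t2 w2_def]
  note o1 = o1[folded w1_def] and o2 = o2[folded w2_def]
  define c1 where "c1 = (\<lambda>(k, z). (cmod (ip (B \<times> R \<times> S) (w1 z) (u1 k)))\<^sup>2)"
  define c2 where "c2 = (\<lambda>(k, z). (cmod (ip (B \<times> R) (w2 z) (u2 k)))\<^sup>2)"
  define P1 where "P1 = (\<lambda>(k, z :: 'b \<times> nat). p1 k)"
  define P2 where "P2 = (\<lambda>(k, z :: 'b \<times> nat). p2 k)"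
  define Q1 where "Q1 = (\<lambda>(k :: nat, z :: 'b \<times> nat). q1 (snd z))"
  define Q2 where "Q2 = (\<lambda>(k :: nat, z :: 'b \<times> nat). q2 (snd z))"
  define \<sigma>1 where "\<sigma>1 = (\<lambda>(x :: 'b \<times> 'r \<times> 's) y. if fst x = fst y then gram (B \<times> E) (\<lambda>j (b, e). \<Psi>1 (b, j) e) (snd x) (snd y) else 0)"
  define \<sigma>2 where "\<sigma>2 = (\<lambda>(x :: 'b \<times> 'r) y. if fst x = fst y then gram (B \<times> S \<times> E) (\<lambda>j (b, e). \<Psi>2 (b, j) e) (snd x) (snd y) else 0)"
  \<comment> \<open>The identity factor sits on \<open>B\<close>, so tracing out \<open>S\<close>
    leaves the second operator of the same shape: identity on \<open>B\<close> times the marginal on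
    \<open>R\<close>.\<close>
  have marg\<rho>: "(\<lambda>x y. \<Sum>s\<in>S. gram E \<Psi>1 (fst x, snd x, s) (fst y, snd y, s)) = gram (S \<times> E) \<Psi>2"
    unfolding gram_def \<Psi>1_def \<Psi>2_def by (simp add: sum.cartesian_product' fun_eq_iff)
  have marg\<sigma>: "(\<lambda>x y. \<Sum>s\<in>S. \<sigma>1 (fst x, snd x, s) (fst y, snd y, s)) = \<sigma>2"
  proof (intro ext)
    fix x y :: "'b \<times> 'r"
    have "(\<Sum>s\<in>S. \<Sum>b\<in>B. \<Sum>e\<in>E. \<Psi> b (snd x) s e * cnj (\<Psi> b (snd y) s e)) = (\<Sum>b\<in>B. \<Sum>s\<in>S. \<Sum>e\<in>E. \<Psi> b (snd x) s e * cnj (\<Psi> b (snd y) s e))"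
      by (rule sum.swap)
    then show "(\<Sum>s\<in>S. \<sigma>1 (fst x, snd x, s) (fst y, snd y, s)) = \<sigma>2 x y"
      unfolding \<sigma>1_def \<sigma>2_def gram_def \<Psi>1_def \<Psi>2_def by (simp add: sum.cartesian_product')
  qed
  have "(\<Sum>k\<in>N2 \<times> (B \<times> L2). c2 k * P2 k * (ln (P2 k) - ln (Q2 k))) \<le> (\<Sum>k\<in>N1 \<times> (B \<times> L1). c1 k * P1 k * (ln (P1 k) - ln (Q1 k)))"
  proof (rule sum_ln_ratio_mono)
    show "finite (N1 \<times> B \<times> L1)" "finite (N2 \<times> B \<times> L2)" using s1 s2 t1 t2 fin unfolding spec_def by auto
    show "P1 k > 0 \<and> Q1 k > 0" if "k \<in> N1 \<times> B \<times> L1" for k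
      using that s1 t1 unfolding spec_def P1_def Q1_def by auto
    show "P2 k > 0 \<and> Q2 k > 0" if "k \<in> N2 \<times> B \<times> L2" for k
      using that s2 t2 unfolding spec_def P2_def Q2_def by auto
    have "complex_of_real (\<Sum>k\<in>N1. p1 k) = (\<Sum>i\<in>B \<times> R \<times> S. gram E \<Psi>1 i i)" using spec_trace[OF s1] by simp
    also have "\<dots> = (\<Sum>x\<in>B \<times> R. gram (S \<times> E) \<Psi>2 x x)" unfolding sum_Times3 marg\<rho>[symmetric] ..
    also have "\<dots> = of_real (\<Sum>k\<in>N2. p2 k)" using spec_trace[OF s2] by simp
    finally have "(\<Sum>k\<in>N1. p1 k) = (\<Sum>k\<in>N2. p2 k)" using of_real_eq_iff by blast
    then show "(\<Sum>k\<in>N1 \<times> B \<times> L1. c1 k * P1 k) = (\<Sum>k\<in>N2 \<times> B \<times> L2. c2 k * P2 k)"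
      using ce1(2) ce2(2) unfolding sum.cartesian_product'[of _ N1] sum.cartesian_product'[of _ N2] c1_def c2_def P1_def P2_def
      by simp
  next
    \<comment> \<open>The optimal \<open>Y\<close> for the small systems, extended by the identity
      on \<open>S\<close>, is a competitor for the large ones with the same value of the
      functional.\<close>
    fix t :: real assume t: "t > 0"
    obtain Y where Y: "qform (B \<times> R) (gram (S \<times> E) \<Psi>2) \<sigma>2 t Y
       = (\<Sum>k\<in>N2. \<Sum>l\<in>B \<times> L2. (p2 k)\<^sup>2 * (cmod (ip (B \<times> R) (w2 l) (u2 k)))\<^sup>2 / ((q2 \<circ> snd) l + t * p2 k))"
      using qform_attained[OF s2 o2[folded \<sigma>2_def] t] by blast
    have "\<dots> = qform (B \<times> R \<times> S) (gram E \<Psi>1) \<sigma>1 t (\<lambda>(b, r, s) (b', r', s'). if s = s' then Y (b, r) (b', r') else 0)"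
      unfolding qform_tensor_one[OF fin(3)] marg\<rho> marg\<sigma> Y ..
    also have "\<dots> \<le> (\<Sum>k\<in>N1. \<Sum>l\<in>B \<times> L1. (p1 k)\<^sup>2 * (cmod (ip (B \<times> R \<times> S) (w1 l) (u1 k)))\<^sup>2 / ((q1 \<circ> snd) l + t * p1 k))"
      by (rule qform_upper[OF s1 o1[folded \<sigma>1_def] t ce1(1)])
    finally show "(\<Sum>k\<in>N2 \<times> B \<times> L2. (P2 k)\<^sup>2 * c2 k / (Q2 k + t * P2 k)) \<le> (\<Sum>k\<in>N1 \<times> B \<times> L1. (P1 k)\<^sup>2 * c1 k / (Q1 k + t * P1 k))"
      unfolding sum.cartesian_product'[of _ N1] sum.cartesian_product'[of _ N2] c1_def c2_def P1_def P2_def Q1_def Q2_def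
      by simp
  qed
  then have "ent R (gram (B \<times> S \<times> E) (\<lambda>j (b, e). \<Psi>2 (b, j) e)) - ent (B \<times> R) (gram (S \<times> E) \<Psi>2)
     \<le> ent (R \<times> S) (gram (B \<times> E) (\<lambda>j (b, e). \<Psi>1 (b, j) e)) - ent (B \<times> R \<times> S) (gram E \<Psi>1)"
    using ce1(3) ce2(3) unfolding sum.cartesian_product'[of _ N1] sum.cartesian_product'[of _ N2] c1_def c2_def P1_def P2_def Q1_def Q2_def
    by simp
  then show ?thesis unfolding m1 m2 \<Psi>1_def[symmetric] \<Psi>2_def[symmetric] by linarith
qed

section \<open>Holevo quantities\<close>

lemma isometry_inner:
  assumes fin: "finite A"
    and V: "\<And>a a'. a \<in> A \<Longrightarrow> a' \<in> A \<Longrightarrow> (\<Sum>x\<in>O'. cnj (V x a) * V x a') = (if a = a' then 1 else 0)"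
  shows "(\<Sum>x\<in>O'. (\<Sum>a\<in>A. V x a * f a) * cnj (\<Sum>a\<in>A. V x a * g a)) = (\<Sum>a\<in>A. f a * cnj (g a))"
proof -
  have "(\<Sum>x\<in>O'. (\<Sum>a\<in>A. V x a * f a) * cnj (\<Sum>a\<in>A. V x a * g a))
     = (\<Sum>x\<in>O'. \<Sum>a\<in>A. \<Sum>a'\<in>A. f a * cnj (g a') * (cnj (V x a') * V x a))"
    unfolding cnj_sum sum_product by (simp add: mult_ac)
  also have "\<dots> = (\<Sum>a\<in>A. \<Sum>a'\<in>A. f a * cnj (g a') * (\<Sum>x\<in>O'. cnj (V x a') * V x a))"
      unfolding sum_distrib_left by (rule sum_swap3[symmetric])
  also have "\<dots> = (\<Sum>a\<in>A. \<Sum>a'\<in>A. if a' = a then f a * cnj (g a) else 0)"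
    by (intro sum.cong refl) (auto simp: V)
  also have "\<dots> = (\<Sum>a\<in>A. f a * cnj (g a))" using fin by simp
  finally show ?thesis .
qed

text \<open>Seen from the environment \<open>D\<close> the isometry is invisible: the dual kernels
  agree entry by entry.\<close>

lemma ent_isometry:
  assumes fin: "finite O'" "finite A" "finite D"
    and V: "\<And>a a'. a \<in> A \<Longrightarrow> a' \<in> A \<Longrightarrow> (\<Sum>x\<in>O'. cnj (V x a) * V x a') = (if a = a' then 1 else 0)"
  shows "ent O' (gram D (\<lambda>x d. \<Sum>a\<in>A. V x a * \<chi> a d)) = ent A (gram D \<chi>)"
proof -
  have "gram O' (\<lambda>d x. \<Sum>a\<in>A. V x a * \<chi> a d) d d' = gram A (\<lambda>d a. \<chi> a d) d d'" for d d'
    unfolding gram_def by (rule isometry_inner[OF fin(2) V])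
  then show ?thesis unfolding ent_dual[OF fin(1,3)] ent_dual[OF fin(2,3)] by (intro ent_cong) simp
qed

text \<open>When the kernels annihilate each other, their eigenvectors for positive eigenvalues are
  mutually orthogonal, and the disjoint union of the eigenbases diagonalises the sum.\<close>

lemma ent_orthogonal_sum:
  assumes I: "finite I" and L: "finite L"
    and orth: "\<And>m m' i j. m \<in> L \<Longrightarrow> m' \<in> L \<Longrightarrow> m \<noteq> m' \<Longrightarrow> i \<in> I \<Longrightarrow> j \<in> I \<Longrightarrow>
       (\<Sum>l\<in>I. gram (E m) (\<psi> m) i l * gram (E m') (\<psi> m') l j) = 0"
  shows "ent I (\<lambda>i j. \<Sum>m\<in>L. gram (E m) (\<psi> m) i j) = (\<Sum>m\<in>L. ent I (gram (E m) (\<psi> m)))"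
proof -
  have "\<exists>(N :: nat set) p v. spec I (gram (E m) (\<psi> m)) N p v" for m
    by (rule spec_gram_exists[OF I, of "E m" "\<psi> m"]) blast
  then obtain N :: "_ \<Rightarrow> nat set" and p v where s: "\<And>m. spec I (gram (E m) (\<psi> m)) (N m) (p m) (v m)" by metis
  have fN: "finite (N m)" and o: "orthon I (N m) (v m)" and pos: "\<And>k. k \<in> N m \<Longrightarrow> p m k > 0"
    and eq: "\<And>i j. i \<in> I \<Longrightarrow> j \<in> I \<Longrightarrow> gram (E m) (\<psi> m) i j = (\<Sum>k\<in>N m. of_real (p m k) * v m k i * cnj (v m k j))" for m
    using s unfolding spec_def by auto
  let ?N = "SIGMA m:L. N m"
  have vv: "ip I (v m k) (v m' k') = 0" if m: "m \<in> L" "m' \<in> L" "m \<noteq> m'" and k: "k \<in> N m" "k' \<in> N m'" for m m' k k'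
  proof -
    let ?K = "gram (E m) (\<psi> m)" and ?K' = "gram (E m') (\<psi> m')"
    have "of_real (p m k) * (of_real (p m' k') * ip I (v m k) (v m' k'))
       = ip I (\<lambda>i. of_real (p m k) * v m k i) (\<lambda>i. of_real (p m' k') * v m' k' i)"
      unfolding ip_def sum_distrib_left by (simp add: mult_ac)
    also have "\<dots> = ip I (\<lambda>i. \<Sum>j\<in>I. ?K i j * v m k j) (\<lambda>i. of_real (p m' k') * v m' k' i)"
      using spec_eigen[OF s _ k(1)] by (intro ip_cong) auto
    also have "\<dots> = ip I (v m k) (\<lambda>i. \<Sum>l\<in>I. ?K i l * (of_real (p m' k') * v m' k' l))"
      by (rule herm_ip[symmetric]) (rule gram_herm)
    also have "\<dots> = ip I (v m k) (\<lambda>i. \<Sum>l\<in>I. ?K i l * (\<Sum>j\<in>I. ?K' l j * v m' k' j))"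
      using spec_eigen[OF s _ k(2)] by (intro ip_cong refl sum.cong) auto
    also have "\<dots> = 0"
    proof -
      have "(\<Sum>l\<in>I. ?K i l * (\<Sum>j\<in>I. ?K' l j * v m' k' j)) = 0" if i: "i \<in> I" for i
      proof -
        have "(\<Sum>l\<in>I. ?K i l * (\<Sum>j\<in>I. ?K' l j * v m' k' j)) = (\<Sum>j\<in>I. (\<Sum>l\<in>I. ?K i l * ?K' l j) * v m' k' j)"
          unfolding sum_distrib_left sum_distrib_right by (subst sum.swap) (simp add: mult_ac)
        then show ?thesis using orth[OF m i] by simp
      qed
      then show ?thesis unfolding ip_def by simp
    qed
    finally show ?thesis using pos[OF k(1)] pos[OF k(2)] by simp
  qed
  have "spec I (\<lambda>i j. \<Sum>m\<in>L. gram (E m) (\<psi> m) i j) ?N (\<lambda>(m, k). p m k) (\<lambda>(m, k). v m k)"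
    unfolding spec_def
  proof (intro conjI ballI)
    show "finite ?N" using fN L by auto
    show "(case z of (m, k) \<Rightarrow> p m k) > 0" if "z \<in> ?N" for z using that pos by auto
    show "orthon I ?N (\<lambda>(m, k). v m k)"
      unfolding orthon_def
    proof (intro ballI)
      fix z z' assume z: "z \<in> ?N" "z' \<in> ?N"
      show "ip I (case z of (m, k) \<Rightarrow> v m k) (case z' of (m, k) \<Rightarrow> v m k) = (if z = z' then 1 else 0)"
        using z vv orthonD[OF o] by (cases z, cases z', cases "fst z = fst z'") auto
    qed
    fix x y assume "x \<in> I" "y \<in> I"
    then show "(\<Sum>m\<in>L. gram (E m) (\<psi> m) x y) = (\<Sum>z\<in>?N. of_real (case z of (m, k) \<Rightarrow> p m k) * (case z of (m, k) \<Rightarrow> v m k) x * cnj ((case z of (m, k) \<Rightarrow> v m k) y))"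
      using fN L by (simp add: sum.Sigma case_prod_unfold eq)
  qed
  then have "ent I (\<lambda>i j. \<Sum>m\<in>L. gram (E m) (\<psi> m) i j) = (\<Sum>z\<in>?N. - ((case z of (m, k) \<Rightarrow> p m k) * ln (case z of (m, k) \<Rightarrow> p m k)))"
    by (rule ent_eq)
  then show ?thesis using fN L by (simp add: ent_eq[OF s] sum.Sigma case_prod_unfold)
qed

lemma ent_scale:
  assumes I: "finite I" and x: "x > 0" and tr: "(\<Sum>i\<in>I. gram E \<Psi> i i) = 1"
  shows "ent I (\<lambda>i j. of_real x * gram E \<Psi> i j) = x * ent I (gram E \<Psi>) - x * ln x"
proof -
  obtain N :: "nat set" and p v where s: "spec I (gram E \<Psi>) N p v"
    by (rule spec_gram_exists[OF I, of E \<Psi>]) blast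
  have pos: "\<And>k. k \<in> N \<Longrightarrow> p k > 0" using s unfolding spec_def by auto
  have "complex_of_real (\<Sum>k\<in>N. p k) = of_real 1" using spec_trace[OF s] tr by simp
  then have 1: "(\<Sum>k\<in>N. p k) = 1" using of_real_eq_iff by blast
  have "spec I (\<lambda>i j. of_real x * gram E \<Psi> i j) N (\<lambda>k. x * p k) v"
    using s x unfolding spec_def by (auto simp: sum_distrib_left mult_ac)
  then have "ent I (\<lambda>i j. of_real x * gram E \<Psi> i j) = (\<Sum>k\<in>N. - (x * p k * ln (x * p k)))" by (rule ent_eq)
  also have "\<dots> = (\<Sum>k\<in>N. x * - (p k * ln (p k)) - p k * (x * ln x))"
    using pos x by (intro sum.cong refl) (simp add: ln_mult algebra_simps)
  also have "\<dots> = x * (\<Sum>k\<in>N. - (p k * ln (p k))) - (\<Sum>k\<in>N. p k) * (x * ln x)"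
    unfolding sum_subtractf sum_distrib_left sum_distrib_right ..
  finally show ?thesis unfolding 1 ent_eq[OF s] by simp
qed

text \<open>An environment may be reindexed and enlarged by indices of zero amplitude. This
  identifies an environment containing duplicated labels with one containing each label
  once.\<close>

lemma gram_embed:
  assumes N: "finite N'" and h: "inj_on h N" "h ` N \<subseteq> N'"
    and 0: "\<And>i e. e \<in> N' \<Longrightarrow> e \<notin> h ` N \<Longrightarrow> \<Psi>' i e = 0" and eq: "\<And>i e. e \<in> N \<Longrightarrow> \<Psi>' i (h e) = \<Psi> i e"
  shows "gram N' \<Psi>' = gram N \<Psi>"
proof (intro ext)
  fix i j
  have "gram N' \<Psi>' i j = (\<Sum>e\<in>h ` N. \<Psi>' i e * cnj (\<Psi>' j e))"
    unfolding gram_def using N h(2) 0 by (intro sum.mono_neutral_right) auto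
  then show "gram N' \<Psi>' i j = gram N \<Psi> i j" unfolding gram_def sum.reindex[OF h(1)] using eq by simp
qed

text \<open>The label recorded in the system repeats \<open>lab e\<close> of the traced-out index,
  so entries between different labels vanish and the kernel is block diagonal, with one unnormalised
  state per label.\<close>

lemma ent_labelled:
  fixes X :: "'x set" and N :: "'e set" and L :: "'m set"
  assumes fin: "finite X" "finite N" "finite L"
  shows "ent (X \<times> L) (gram N (\<lambda>(x, m) e. if lab e = m then \<phi> x e else 0)) = (\<Sum>m\<in>L. ent X (gram {e \<in> N. lab e = m} \<phi>))"
proof -
  let ?N = "\<lambda>m. {e \<in> N. lab e = m}"
  define \<psi> where "\<psi> = (\<lambda>(m :: 'm) (x, m') e. if m' = m then \<phi> x e else 0)"
  have fX: "finite (X \<times> L)" using fin by simp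
  have "gram N (\<lambda>(x, m) e. if lab e = m then \<phi> x e else 0) x y = (\<Sum>m\<in>L. gram (?N m) (\<psi> m) x y)"
    if "x \<in> X \<times> L" "y \<in> X \<times> L" for x y
  proof -
    obtain a m b n where xy: "x = (a, m)" "y = (b, n)" by (cases x, cases y)
    have "(\<Sum>m'\<in>L. gram (?N m') (\<psi> m') x y) = (\<Sum>m'\<in>L. if m' = m then gram (?N m) (\<psi> m) x y else 0)"
      by (intro sum.cong refl) (auto simp: xy gram_def \<psi>_def)
    also have "\<dots> = gram (?N m) (\<psi> m) x y" using that fin xy by simp
    also have "\<dots> = gram N (\<lambda>(x, m) e. if lab e = m then \<phi> x e else 0) x y"
      unfolding gram_def xy \<psi>_def prod.case using fin by (intro sum.mono_neutral_cong_left) auto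
    finally show ?thesis ..
  qed
  then have "ent (X \<times> L) (gram N (\<lambda>(x, m) e. if lab e = m then \<phi> x e else 0)) = ent (X \<times> L) (\<lambda>x y. \<Sum>m\<in>L. gram (?N m) (\<psi> m) x y)"
    by (intro ent_cong)
  also have "\<dots> = (\<Sum>m\<in>L. ent (X \<times> L) (gram (?N m) (\<psi> m)))"
    by (rule ent_orthogonal_sum[OF fX fin(3)]) (auto simp: gram_def \<psi>_def intro!: sum.neutral)
  also have "\<dots> = (\<Sum>m\<in>L. ent X (gram (?N m) \<phi>))"
  proof (rule sum.cong[OF refl])
    fix m assume m: "m \<in> L"
    \<comment> \<open>The isometry is the embedding of \<open>X\<close> as the block with label
      \<open>m\<close>.\<close>
    have V: "(\<Sum>x\<in>X \<times> L. cnj (if x = (a, m) then 1 else 0) * (if x = (a', m) then 1 else 0)) = (if a = a' then 1 else 0 :: complex)"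
      if "a \<in> X" for a a'
    proof -
      have "(\<Sum>x\<in>X \<times> L. cnj (if x = (a, m) then 1 else 0) * (if x = (a', m) then 1 else 0))
        = (\<Sum>x\<in>X \<times> L. if x = (a, m) then (if a = a' then 1 else 0 :: complex) else 0)"
        by (intro sum.cong refl) auto
      then show ?thesis using that m fX by simp
    qed
    have "\<psi> m x e = (\<Sum>a\<in>X. (if x = (a, m) then 1 else 0) * \<phi> a e)" if "x \<in> X \<times> L" for x e
    proof -
      have "(\<Sum>a\<in>X. (if x = (a, m) then 1 else 0) * \<phi> a e) = (\<Sum>a\<in>X. if a = fst x then \<psi> m x e else 0)"
        unfolding \<psi>_def by (cases x, intro sum.cong refl) auto
      then show ?thesis using that fin by auto
    qed
    then have "ent (X \<times> L) (gram (?N m) (\<psi> m)) = ent (X \<times> L) (gram (?N m) (\<lambda>x e. \<Sum>a\<in>X. (if x = (a, m) then 1 else 0) * \<phi> a e))"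
      unfolding gram_def by (intro ent_cong) simp
    also have "\<dots> = ent X (gram (?N m) \<phi>)" using V fin by (intro ent_isometry) auto
    finally show "ent (X \<times> L) (gram (?N m) (\<psi> m)) = ent X (gram (?N m) \<phi>)" .
  qed
  finally show ?thesis .
qed

lemma ent_labelled3:
  assumes fin: "finite B" "finite Y" "finite N" "finite L"
  shows "ent (B \<times> Y \<times> L) (gram N (\<lambda>(b, y, m) e. if lab e = m then \<phi> (b, y) e else 0)) = (\<Sum>m\<in>L. ent (B \<times> Y) (gram {e \<in> N. lab e = m} \<phi>))"
proof -
  let ?\<Psi> = "\<lambda>(b, y, m) e. if lab e = m then \<phi> (b, y) e else 0"
  have "ent ((B \<times> Y) \<times> L) (\<lambda>a b. gram N ?\<Psi> ((\<lambda>((b, y), m). (b, y, m)) a) ((\<lambda>((b, y), m). (b, y, m)) b)) = ent (B \<times> Y \<times> L) (gram N ?\<Psi>)"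
    using fin by (intro ent_reindex) (force simp: bij_betw_def inj_on_def image_def)+
  moreover have "gram N ?\<Psi> ((\<lambda>((b, y), m). (b, y, m)) a) ((\<lambda>((b, y), m). (b, y, m)) b) = gram N (\<lambda>(x, m) e. if lab e = m then \<phi> x e else 0) a b" for a b
    unfolding gram_def by (auto split: prod.splits)
  ultimately show ?thesis using ent_labelled[of "B \<times> Y" N L lab \<phi>] fin by simp
qed

text \<open>The Holevo quantity of the ensemble of the unnormalised kernels \<open>gram ({m} \<times> Z) \<Psi>\<close>, up to the
  entropy of the distribution of the label \<open>m\<close>, which is the same for all the ensembles to be compared.\<close>
definition holevo :: "'m set \<Rightarrow> 'i set \<Rightarrow> 'z set \<Rightarrow> ('i \<Rightarrow> 'm \<times> 'z \<Rightarrow> complex) \<Rightarrow> real" where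
  "holevo L I Z \<Psi> = ent I (gram (L \<times> Z) \<Psi>) - (\<Sum>m\<in>L. ent I (gram ({m} \<times> Z) \<Psi>))"

lemma holevo_cong:
  assumes "\<And>L' i j. L' \<subseteq> L \<Longrightarrow> i \<in> I \<Longrightarrow> j \<in> I \<Longrightarrow> gram (L' \<times> Z) \<Psi> i j = gram (L' \<times> Z') \<Psi>' i j"
  shows "holevo L I Z \<Psi> = holevo L I Z' \<Psi>'"
  unfolding holevo_def using assms by (intro arg_cong2[where f = minus] sum.cong refl ent_cong) auto

section \<open>Entropy inequalities for ensembles\<close>

lemma ent_trivial: "R () () = 1 \<Longrightarrow> ent {()} R = 0"
  by (subst ent_eq[of _ _ "{0 :: nat}" "\<lambda>_. 1" "\<lambda>_ _. 1"]) (auto simp: spec_def orthon_def ip_def)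

text \<open>Strong subadditivity with a one-point middle system, whose entropy vanishes because the
  total trace is 1.\<close>

lemma subadditivity:
  assumes fin: "finite B" "finite Y" "finite E"
    and tr: "(\<Sum>y\<in>Y. gram (B \<times> E) (\<lambda>y (b, e). \<phi> b y e) y y) = 1"
  shows "ent (B \<times> Y) (gram E (\<lambda>(b, y) e. \<phi> b y e))
    \<le> ent B (gram (Y \<times> E) (\<lambda>b (y, e). \<phi> b y e)) + ent Y (gram (B \<times> E) (\<lambda>y (b, e). \<phi> b y e))"
proof -
  define \<Psi> where "\<Psi> = (\<lambda>b (u :: unit) y e. \<phi> b y e)"
  note ssa = strong_subadditivity[OF fin(1) finite.insertI[OF finite.emptyI] fin(2,3), of "()" \<Psi>]
  have "ent (B \<times> Y) (\<lambda>a b. gram E (\<lambda>(b, r, s) e. \<Psi> b r s e) ((\<lambda>(b, y). (b, (), y)) a) ((\<lambda>(b, y). (b, (), y)) b))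
      = ent (B \<times> {()} \<times> Y) (gram E (\<lambda>(b, r, s) e. \<Psi> b r s e))"
    using fin by (intro ent_reindex) (auto simp: bij_betw_def inj_on_def image_def)
  then have 1: "ent (B \<times> {()} \<times> Y) (gram E (\<lambda>(b, r, s) e. \<Psi> b r s e)) = ent (B \<times> Y) (gram E (\<lambda>(b, y) e. \<phi> b y e))"
    unfolding \<Psi>_def gram_def by (simp add: case_prod_unfold)
  have "ent Y (\<lambda>a b. gram (B \<times> E) (\<lambda>(r, s) (b, e). \<Psi> b r s e) (Pair () a) (Pair () b))
      = ent ({()} \<times> Y) (gram (B \<times> E) (\<lambda>(r, s) (b, e). \<Psi> b r s e))"
    using fin by (intro ent_reindex) (auto simp: bij_betw_def inj_on_def image_def)
  then have 2: "ent ({()} \<times> Y) (gram (B \<times> E) (\<lambda>(r, s) (b, e). \<Psi> b r s e)) = ent Y (gram (B \<times> E) (\<lambda>y (b, e). \<phi> b y e))"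
    unfolding \<Psi>_def gram_def by (simp add: case_prod_unfold)
  have "ent B (\<lambda>a b. gram (Y \<times> E) (\<lambda>(b, r) (s, e). \<Psi> b r s e) ((\<lambda>b. (b, ())) a) ((\<lambda>b. (b, ())) b))
      = ent (B \<times> {()}) (gram (Y \<times> E) (\<lambda>(b, r) (s, e). \<Psi> b r s e))"
    using fin by (intro ent_reindex) (auto simp: bij_betw_def inj_on_def image_def)
  then have 3: "ent (B \<times> {()}) (gram (Y \<times> E) (\<lambda>(b, r) (s, e). \<Psi> b r s e)) = ent B (gram (Y \<times> E) (\<lambda>b (y, e). \<phi> b y e))"
    unfolding \<Psi>_def gram_def by (simp add: case_prod_unfold)
  have 4: "ent {()} (gram (B \<times> Y \<times> E) (\<lambda>r (b, s, e). \<Psi> b r s e)) = 0"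
  proof (rule ent_trivial)
    have "gram (B \<times> Y \<times> E) (\<lambda>r (b, s, e). \<Psi> b r s e) () () = (\<Sum>b\<in>B. \<Sum>y\<in>Y. \<Sum>e\<in>E. \<phi> b y e * cnj (\<phi> b y e))"
      by (simp add: gram_def \<Psi>_def sum.cartesian_product')
    also have "\<dots> = (\<Sum>y\<in>Y. \<Sum>b\<in>B. \<Sum>e\<in>E. \<phi> b y e * cnj (\<phi> b y e))" by (rule sum.swap)
    finally show "gram (B \<times> Y \<times> E) (\<lambda>r (b, s, e). \<Psi> b r s e) () () = 1"
      using tr by (simp add: gram_def sum.cartesian_product')
  qed
  show ?thesis using ssa unfolding 1 2 3 4 by linarith
qed

text \<open>Strong subadditivity for \<open>F\<close>, \<open>Y\<close> and a copy of the label: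
  S(FYL) - S(YL) \<le> S(FY) - S(Y). The entropies containing the label split into sums over
  messages, and rearranging gives the two Holevo quantities.\<close>

lemma holevo_partial_trace:
  assumes fin: "finite F" "finite Y" "finite Z" "finite L"
  shows "holevo L Y (F \<times> Z) (\<lambda>y (m, f, z). \<psi> f y (m, z)) \<le> holevo L (F \<times> Y) Z (\<lambda>(f, y). \<psi> f y)"
proof -
  let ?N = "L \<times> Z"
  define \<Psi> where "\<Psi> = (\<lambda>f y m e. if fst e = m then \<psi> f y e else 0)"
  have fN: "finite ?N" "finite (F \<times> ?N)" using fin by auto
  note ssa = strong_subadditivity[OF fin(1,2,4) fN(1), of \<Psi>]
  have "ent (F \<times> Y \<times> L) (gram ?N (\<lambda>(b, r, s) e. \<Psi> b r s e)) = (\<Sum>m\<in>L. ent (F \<times> Y) (gram {e \<in> ?N. fst e = m} (\<lambda>(f, y). \<psi> f y)))"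
    using ent_labelled3[OF fin(1,2) fN(1) fin(4), of fst "\<lambda>(f, y). \<psi> f y"] unfolding \<Psi>_def prod.case .
  also have "\<dots> = (\<Sum>m\<in>L. ent (F \<times> Y) (gram ({m} \<times> Z) (\<lambda>(f, y). \<psi> f y)))"
    by (intro sum.cong refl arg_cong2[where f = ent] arg_cong2[where f = gram]) auto
  finally have 1: "ent (F \<times> Y \<times> L) (gram ?N (\<lambda>(b, r, s) e. \<Psi> b r s e)) = \<dots>" .
  have "ent (Y \<times> L) (gram (F \<times> ?N) (\<lambda>(r, s) (b, e). \<Psi> b r s e))
      = ent (Y \<times> L) (gram (F \<times> ?N) (\<lambda>(y, m) d. if fst (snd d) = m then (\<lambda>y (f, e). \<psi> f y e) y d else 0))"
    by (intro arg_cong2[where f = ent] arg_cong2[where f = gram] refl ext) (auto simp: \<Psi>_def)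
  also have "\<dots> = (\<Sum>m\<in>L. ent Y (gram {d \<in> F \<times> ?N. fst (snd d) = m} (\<lambda>y (f, e). \<psi> f y e)))"
    by (rule ent_labelled[OF fin(2) fN(2) fin(4)])
  also have "\<dots> = (\<Sum>m\<in>L. ent Y (gram ({m} \<times> F \<times> Z) (\<lambda>y (m, f, z). \<psi> f y (m, z))))"
    by (intro sum.cong refl arg_cong2[where f = ent] gram_embed[where h = "\<lambda>(m, f, z). (f, m, z)"])
      (use fN in \<open>auto simp: inj_on_def image_def\<close>)
  finally have 2: "ent (Y \<times> L) (gram (F \<times> ?N) (\<lambda>(r, s) (b, e). \<Psi> b r s e)) = \<dots>" .
  have 3: "gram (L \<times> ?N) (\<lambda>(b, r) (s, e). \<Psi> b r s e) = gram ?N (\<lambda>(f, y). \<psi> f y)"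
    by (rule gram_embed[where h = "\<lambda>e. (fst e, e)"]) (use fin in \<open>auto simp: inj_on_def image_def \<Psi>_def\<close>)
  have 4: "gram (F \<times> L \<times> ?N) (\<lambda>r (b, s, e). \<Psi> b r s e) = gram (L \<times> F \<times> Z) (\<lambda>y (m, f, z). \<psi> f y (m, z))"
    by (rule gram_embed[where h = "\<lambda>(m, f, z). (f, m, m, z)"]) (use fin in \<open>auto simp: inj_on_def image_def \<Psi>_def\<close>)
  show ?thesis using ssa unfolding 1 2 3 4 holevo_def by linarith
qed

text \<open>Strong subadditivity for \<open>B\<close>, \<open>(Y, m)\<close>, the labelled \<open>L \<times> Z\<close> and environment \<open>K\<close>; the entropies
  involving \<open>Z\<close> are turned into those of the complementary systems by duality.\<close>
lemma holevo_channel_bound: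
  fixes \<phi> :: "'b \<Rightarrow> 'k \<Rightarrow> 'y \<Rightarrow> 'm \<times> 'z \<Rightarrow> complex"
  assumes fin: "finite B" "finite K" "finite Y" "finite Z" "finite L"
    and tr: "(\<Sum>y\<in>Y. gram (L \<times> B \<times> K \<times> Z) (\<lambda>y (m, b, k, z). \<phi> b k y (m, z)) y y) = 1"
  shows "holevo L (B \<times> Y) (K \<times> Z) (\<lambda>(b, y) (m, k, z). \<phi> b k y (m, z))
    \<le> holevo L Y (B \<times> K \<times> Z) (\<lambda>y (m, b, k, z). \<phi> b k y (m, z))
      + ent (B \<times> K) (gram (Y \<times> L \<times> Z) (\<lambda>(b, k) (y, e). \<phi> b k y e))
      + ent B (gram (K \<times> Y \<times> L \<times> Z) (\<lambda>b (k, y, e). \<phi> b k y e))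
      - ent K (gram (B \<times> Y \<times> L \<times> Z) (\<lambda>k (b, y, e). \<phi> b k y e))"
proof -
  let ?N = "L \<times> Z"
  \<comment> \<open>The label next to \<open>y\<close> is a copy of the one already stored in
    \<open>e\<close>; keeping both is what allows the other copy to be traced out.\<close>
  define \<Psi> where "\<Psi> = (\<lambda>b (y, m) e k. if fst e = m then \<phi> b k y e else 0)"
  have fins: "finite (Y \<times> L)" "finite ?N" "finite (B \<times> (Y \<times> L) \<times> ?N)" "finite ((Y \<times> L) \<times> ?N)" "finite (B \<times> K)"
    "finite (?N \<times> K)" "finite (B \<times> ?N \<times> K)" "finite (L \<times> K \<times> Z)"
    using fin by auto
  note ssa = strong_subadditivity[OF fin(1) fins(1,2) fin(2), of \<Psi>]
  \<comment> \<open>The overall vector is pure, so the entropy of all systems but \<open>K\<close>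
    is that of \<open>K\<close>; in the same way \<open>T2\<close> yields the entropy of
    \<open>B\<close> with \<open>K\<close>.\<close>
  have T1: "ent (B \<times> (Y \<times> L) \<times> ?N) (gram K (\<lambda>(b, r, s) e. \<Psi> b r s e)) = ent K (gram (B \<times> Y \<times> ?N) (\<lambda>k (b, y, e). \<phi> b k y e))"
    unfolding ent_dual[OF fins(3) fin(2)]
    by (intro arg_cong2[where f = ent] refl gram_embed[where h = "\<lambda>(b, y, e). (b, (y, fst e), e)"])
      (use fins in \<open>auto simp: inj_on_def image_def \<Psi>_def\<close>)
  have T2: "ent ((Y \<times> L) \<times> ?N) (gram (B \<times> K) (\<lambda>(r, s) (b, e). \<Psi> b r s e)) = ent (B \<times> K) (gram (Y \<times> ?N) (\<lambda>(b, k) (y, e). \<phi> b k y e))"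
    unfolding ent_dual[OF fins(4,5)]
    by (intro arg_cong2[where f = ent] refl gram_embed[where h = "\<lambda>(y, e). ((y, fst e), e)"])
      (use fins in \<open>auto simp: inj_on_def image_def \<Psi>_def\<close>)
  have "ent (B \<times> Y \<times> L) (gram (?N \<times> K) (\<lambda>(b, r) (s, e). \<Psi> b r s e))
      = ent (B \<times> Y \<times> L) (gram (?N \<times> K) (\<lambda>(b, y, m) d. if fst (fst d) = m then (\<lambda>(b, y) (e, k). \<phi> b k y e) (b, y) d else 0))"
    by (intro arg_cong2[where f = ent] arg_cong2[where f = gram] refl ext) (auto simp: \<Psi>_def)
  also have "\<dots> = (\<Sum>m\<in>L. ent (B \<times> Y) (gram {d \<in> ?N \<times> K. fst (fst d) = m} (\<lambda>(b, y) (e, k). \<phi> b k y e)))"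
    by (rule ent_labelled3[OF fin(1,3) fins(6) fin(5)])
  also have "\<dots> = (\<Sum>m\<in>L. ent (B \<times> Y) (gram ({m} \<times> K \<times> Z) (\<lambda>(b, y) (m, k, z). \<phi> b k y (m, z))))"
    by (intro sum.cong refl arg_cong2[where f = ent] gram_embed[where h = "\<lambda>(m, k, z). ((m, z), k)"])
      (use fins in \<open>auto simp: inj_on_def image_def\<close>)
  finally have T3: "ent (B \<times> Y \<times> L) (gram (?N \<times> K) (\<lambda>(b, r) (s, e). \<Psi> b r s e)) = \<dots>" .
  have "ent (Y \<times> L) (gram (B \<times> ?N \<times> K) (\<lambda>r (b, s, e). \<Psi> b r s e))
      = ent (Y \<times> L) (gram (B \<times> ?N \<times> K) (\<lambda>(y, m) d. if fst (fst (snd d)) = m then (\<lambda>y (b, e, k). \<phi> b k y e) y d else 0))"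
    by (intro arg_cong2[where f = ent] arg_cong2[where f = gram] refl ext) (auto simp: \<Psi>_def)
  also have "\<dots> = (\<Sum>m\<in>L. ent Y (gram {d \<in> B \<times> ?N \<times> K. fst (fst (snd d)) = m} (\<lambda>y (b, e, k). \<phi> b k y e)))"
    by (rule ent_labelled[OF fin(3) fins(7) fin(5)])
  also have "\<dots> = (\<Sum>m\<in>L. ent Y (gram ({m} \<times> B \<times> K \<times> Z) (\<lambda>y (m, b, k, z). \<phi> b k y (m, z))))"
    by (intro sum.cong refl arg_cong2[where f = ent] gram_embed[where h = "\<lambda>(m, b, k, z). (b, (m, z), k)"])
      (use fins in \<open>auto simp: inj_on_def image_def\<close>)
  finally have T4: "ent (Y \<times> L) (gram (B \<times> ?N \<times> K) (\<lambda>r (b, s, e). \<Psi> b r s e)) = \<dots>" .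
  have S3: "gram (B \<times> L \<times> K \<times> Z) (\<lambda>y (b, m, k, z). \<phi> b k y (m, z)) = gram (L \<times> B \<times> K \<times> Z) (\<lambda>y (m, b, k, z). \<phi> b k y (m, z))"
    by (rule gram_embed[where h = "\<lambda>(m, b, k, z). (b, m, k, z)"]) (use fin in \<open>auto simp: inj_on_def image_def\<close>)
  have S2: "gram (Y \<times> L \<times> K \<times> Z) (\<lambda>b (y, m, k, z). \<phi> b k y (m, z)) = gram (K \<times> Y \<times> ?N) (\<lambda>b (k, y, e). \<phi> b k y e)"
    by (rule gram_embed[where h = "\<lambda>(k, y, m, z). (y, m, k, z)"]) (use fin in \<open>auto simp: inj_on_def image_def\<close>)
  \<comment> \<open>Strong subadditivity controls the entropies given the message. The entropy of
    the averaged state on \<open>B\<close> and \<open>Y\<close> is bounded by plain subadditivity,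
    which supplies the output entropy of the channel.\<close>
  have "ent (B \<times> Y) (gram (L \<times> K \<times> Z) (\<lambda>(b, y) (m, k, z). \<phi> b k y (m, z)))
    \<le> ent B (gram (Y \<times> L \<times> K \<times> Z) (\<lambda>b (y, m, k, z). \<phi> b k y (m, z))) + ent Y (gram (B \<times> L \<times> K \<times> Z) (\<lambda>y (b, m, k, z). \<phi> b k y (m, z)))"
    by (rule subadditivity[OF fin(1,3) fins(8)]) (use tr in \<open>simp only: S3\<close>)
  then show ?thesis using ssa unfolding T1 T2 T3 T4 S2 S3 holevo_def by linarith
qed

section \<open>Channels in kernel form and one round of communication\<close>

definition chan_out :: "'k set \<Rightarrow> 'a set \<Rightarrow> ('k \<Rightarrow> 'b \<Rightarrow> 'a \<Rightarrow> complex) \<Rightarrow> ('a \<Rightarrow> 'a \<Rightarrow> complex) \<Rightarrow> 'b \<Rightarrow> 'b \<Rightarrow> complex" where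
  "chan_out K A E \<rho> b b' = (\<Sum>k\<in>K. \<Sum>a\<in>A. \<Sum>a'\<in>A. E k b a * \<rho> a a' * cnj (E k b' a'))"

text \<open>Exchanging the roles of \<open>k\<close> and \<open>b\<close> in the Kraus operators gives the complementary channel.\<close>
definition chan_info :: "'a set \<Rightarrow> 'b set \<Rightarrow> 'k set \<Rightarrow> ('k \<Rightarrow> 'b \<Rightarrow> 'a \<Rightarrow> complex) \<Rightarrow> ('a \<Rightarrow> 'a \<Rightarrow> complex) \<Rightarrow> real" where
  "chan_info A B K E \<rho> = ent A \<rho> + ent B (chan_out K A E \<rho>) - ent K (chan_out B A (\<lambda>b k. E k b) \<rho>)"

text \<open>Stinespring dilation: the Kraus index joins the environment of the amplitudes.\<close>

lemma chan_out_gram: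
  "chan_out K A E (gram D \<chi>) = gram (K \<times> D) (\<lambda>b (k, d). \<Sum>a\<in>A. E k b a * \<chi> a d)"
proof (intro ext)
  fix b b'
  have "chan_out K A E (gram D \<chi>) b b' = (\<Sum>k\<in>K. \<Sum>a\<in>A. \<Sum>a'\<in>A. \<Sum>d\<in>D. E k b a * \<chi> a d * cnj (E k b' a' * \<chi> a' d))"
    unfolding chan_out_def gram_def sum_distrib_left sum_distrib_right by (simp add: mult_ac)
  also have "\<dots> = (\<Sum>k\<in>K. \<Sum>a\<in>A. \<Sum>d\<in>D. \<Sum>a'\<in>A. E k b a * \<chi> a d * cnj (E k b' a' * \<chi> a' d))"
    by (intro sum.cong refl sum.swap)
  also have "\<dots> = (\<Sum>k\<in>K. \<Sum>d\<in>D. \<Sum>a\<in>A. \<Sum>a'\<in>A. E k b a * \<chi> a d * cnj (E k b' a' * \<chi> a' d))"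
    by (intro sum.cong refl sum.swap)
  finally show "chan_out K A E (gram D \<chi>) b b' = gram (K \<times> D) (\<lambda>b (k, d). \<Sum>a\<in>A. E k b a * \<chi> a d) b b'"
    unfolding gram_def sum.cartesian_product' prod.case sum_product cnj_sum .
qed

lemma chan_out_cong:
  assumes "\<And>a a'. a \<in> A \<Longrightarrow> a' \<in> A \<Longrightarrow> \<rho> a a' = \<rho>' a a'"
  shows "chan_out K A E \<rho> = chan_out K A E \<rho>'"
  unfolding chan_out_def using assms by (intro ext sum.cong refl) auto

text \<open>One round: the channel is applied to \<open>A\<close>, then the receiver applies the isometry \<open>W\<close> to \<open>B \<otimes> Y\<close> and gives
  away the factor \<open>F\<close>.\<close>
lemma holevo_round:
  fixes \<psi> :: "'a \<Rightarrow> 'y \<Rightarrow> 'm \<times> 'z \<Rightarrow> complex"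
  assumes fin: "finite A" "finite B" "finite K" "finite Y" "finite Z" "finite F" "finite Y'" "finite L"
    and tr: "(\<Sum>y\<in>Y. gram (L \<times> A \<times> Z) (\<lambda>y (m, a, z). \<psi> a y (m, z)) y y) = 1"
    and E: "\<And>a a'. a \<in> A \<Longrightarrow> a' \<in> A \<Longrightarrow> (\<Sum>x\<in>B \<times> K. cnj (E (snd x) (fst x) a) * E (snd x) (fst x) a') = (if a = a' then 1 else 0)"
    and W: "\<And>x x'. x \<in> B \<times> Y \<Longrightarrow> x' \<in> B \<times> Y \<Longrightarrow> (\<Sum>g\<in>F \<times> Y'. cnj (W g x) * W g x') = (if x = x' then 1 else 0)"
    and \<chi>: "\<And>f y' k e. f \<in> F \<Longrightarrow> y' \<in> Y' \<Longrightarrow> k \<in> K \<Longrightarrow> e \<in> L \<times> Z \<Longrightarrow>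
      \<chi> f y' k e = (\<Sum>x\<in>B \<times> Y. W (f, y') x * (\<Sum>a\<in>A. E k (fst x) a * \<psi> a (snd x) e))"
  shows "holevo L Y' (F \<times> K \<times> Z) (\<lambda>y' (m, f, k, z). \<chi> f y' k (m, z))
    \<le> holevo L Y (A \<times> Z) (\<lambda>y (m, a, z). \<psi> a y (m, z)) + chan_info A B K E (gram (Y \<times> L \<times> Z) (\<lambda>a (y, e). \<psi> a y e))"
    and "(\<Sum>y'\<in>Y'. gram (L \<times> F \<times> K \<times> Z) (\<lambda>y' (m, f, k, z). \<chi> f y' k (m, z)) y' y') = 1"
proof -
  define \<phi> where "\<phi> = (\<lambda>b k y e. \<Sum>a\<in>A. E k b a * \<psi> a y e)"
  let ?\<phi> = "\<lambda>(b, y) (m, k, z). \<phi> b k y (m, z)" and ?\<chi> = "\<lambda>(f, y') (m, k, z). \<chi> f y' k (m, z)"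
  have fins: "finite (B \<times> K)" "finite (B \<times> Y)" "finite (F \<times> Y')" "finite (Y \<times> L \<times> Z)" "finite (L \<times> K \<times> Z)" using fin by auto
  \<comment> \<open>The channel, dilated to \<open>B\<close> and \<open>K\<close>, is an isometry on
    systems outside \<open>Y\<close>, so the old register of the receiver keeps its state, for every
    subset of messages.\<close>
  have Y\<phi>: "gram (L' \<times> B \<times> K \<times> Z) (\<lambda>y (m, b, k, z). \<phi> b k y (m, z)) y y' = gram (L' \<times> A \<times> Z) (\<lambda>y (m, a, z). \<psi> a y (m, z)) y y'" for L' y y'
  proof -
    have "(\<Sum>b\<in>B. \<Sum>k\<in>K. \<phi> b k y e * cnj (\<phi> b k y' e)) = (\<Sum>a\<in>A. \<psi> a y e * cnj (\<psi> a y' e))" for e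
      using isometry_inner[OF fin(1), where O' = "B \<times> K" and V = "\<lambda>x. E (snd x) (fst x)", OF E, of "\<lambda>a. \<psi> a y e" "\<lambda>a. \<psi> a y' e"]
      unfolding \<phi>_def sum.cartesian_product' by simp
    then have "(\<Sum>b\<in>B. \<Sum>k\<in>K. \<Sum>z\<in>Z. \<phi> b k y (m, z) * cnj (\<phi> b k y' (m, z))) = (\<Sum>a\<in>A. \<Sum>z\<in>Z. \<psi> a y (m, z) * cnj (\<psi> a y' (m, z)))" for m
      unfolding sum_swap3[of _ Z] by (simp add: sum.swap[of _ Z])
    then show ?thesis unfolding gram_def sum.cartesian_product' by simp
  qed
  have W\<phi>: "?\<chi> g d = (\<Sum>x\<in>B \<times> Y. W g x * ?\<phi> x d)" if "g \<in> F \<times> Y'" "d \<in> L \<times> K \<times> Z" for g d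
    using that \<chi> unfolding \<phi>_def by (auto simp: case_prod_unfold)
  have "(\<Sum>y'\<in>Y'. gram (L \<times> F \<times> K \<times> Z) (\<lambda>y' (m, f, k, z). \<chi> f y' k (m, z)) y' y') = (\<Sum>g\<in>F \<times> Y'. \<Sum>d\<in>L \<times> K \<times> Z. ?\<chi> g d * cnj (?\<chi> g d))"
    unfolding gram_def sum.cartesian_product' prod.case sum_swap3[of _ F] by (simp add: sum.swap[of _ F])
  also have "\<dots> = (\<Sum>d\<in>L \<times> K \<times> Z. \<Sum>g\<in>F \<times> Y'. (\<Sum>x\<in>B \<times> Y. W g x * ?\<phi> x d) * cnj (\<Sum>x\<in>B \<times> Y. W g x * ?\<phi> x d))"
    by (subst sum.swap) (intro sum.cong refl, simp only: W\<phi>)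
  also have "\<dots> = (\<Sum>d\<in>L \<times> K \<times> Z. \<Sum>x\<in>B \<times> Y. ?\<phi> x d * cnj (?\<phi> x d))"
    by (intro sum.cong refl isometry_inner[OF fins(2) W])
  also have "\<dots> = (\<Sum>y\<in>Y. gram (L \<times> B \<times> K \<times> Z) (\<lambda>y (m, b, k, z). \<phi> b k y (m, z)) y y)"
  proof -
    have "gram ((L \<times> K \<times> Z) \<times> (B \<times> Y)) (\<lambda>(_ :: unit) (d, x). ?\<phi> x d) = gram (Y \<times> L \<times> B \<times> K \<times> Z) (\<lambda>_ (y, m, b, k, z). \<phi> b k y (m, z))"
      by (rule gram_embed[where h = "\<lambda>(y, m, b, k, z). ((m, k, z), (b, y))"]) (use fin in \<open>auto simp: inj_on_def image_def\<close>)
    from fun_cong[OF fun_cong[OF this]] show ?thesis by (simp add: gram_def sum.cartesian_product')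
  qed
  also have "\<dots> = 1" unfolding Y\<phi> by (rule tr)
  finally show "(\<Sum>y'\<in>Y'. gram (L \<times> F \<times> K \<times> Z) (\<lambda>y' (m, f, k, z). \<chi> f y' k (m, z)) y' y') = 1" .
  have "holevo L Y' (F \<times> K \<times> Z) (\<lambda>y' (m, f, k, z). \<chi> f y' k (m, z)) \<le> holevo L (F \<times> Y') (K \<times> Z) ?\<chi>"
    using holevo_partial_trace[OF fin(6,7) finite_cartesian_product[OF fin(3,5)] fin(8), of "\<lambda>f y' (m, k, z). \<chi> f y' k (m, z)"]
    by (simp add: case_prod_unfold)
  also have "\<dots> = holevo L (B \<times> Y) (K \<times> Z) ?\<phi>"
  proof -
    have eqD: "ent (F \<times> Y') (gram D ?\<chi>) = ent (B \<times> Y) (gram D ?\<phi>)" if D: "D \<subseteq> L \<times> K \<times> Z" for D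
    proof -
      have "ent (F \<times> Y') (gram D ?\<chi>) = ent (F \<times> Y') (gram D (\<lambda>g d. \<Sum>x\<in>B \<times> Y. W g x * ?\<phi> x d))"
        unfolding gram_def using D by (intro ent_cong sum.cong refl) (simp only: W\<phi> subsetD[OF D])
      then show ?thesis using ent_isometry[OF fins(3,2) finite_subset[OF D fins(5)] W, of ?\<phi>] by simp
    qed
    show ?thesis unfolding holevo_def by (intro arg_cong2[where f = minus] sum.cong refl eqD) auto
  qed
  also have "\<dots> \<le> holevo L Y (B \<times> K \<times> Z) (\<lambda>y (m, b, k, z). \<phi> b k y (m, z))
      + ent (B \<times> K) (gram (Y \<times> L \<times> Z) (\<lambda>(b, k) (y, e). \<phi> b k y e))
      + ent B (gram (K \<times> Y \<times> L \<times> Z) (\<lambda>b (k, y, e). \<phi> b k y e)) - ent K (gram (B \<times> Y \<times> L \<times> Z) (\<lambda>k (b, y, e). \<phi> b k y e))"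
    by (rule holevo_channel_bound[OF fin(2-5,8)]) (unfold Y\<phi>, rule tr)
  also have "holevo L Y (B \<times> K \<times> Z) (\<lambda>y (m, b, k, z). \<phi> b k y (m, z)) = holevo L Y (A \<times> Z) (\<lambda>y (m, a, z). \<psi> a y (m, z))"
    by (rule holevo_cong) (rule Y\<phi>)
  \<comment> \<open>\<open>B\<close> and \<open>K\<close> together are the isometric image of the
    input \<open>A\<close>; this is the source of the input entropy in
    \<open>chan_info\<close>.\<close>
  also have "ent (B \<times> K) (gram (Y \<times> L \<times> Z) (\<lambda>(b, k) (y, e). \<phi> b k y e)) = ent A (gram (Y \<times> L \<times> Z) (\<lambda>a (y, e). \<psi> a y e))"
    using ent_isometry[OF fins(1) fin(1) fins(4) E, of "\<lambda>a (y, e). \<psi> a y e"] unfolding \<phi>_def by (simp add: case_prod_unfold)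
  finally show "holevo L Y' (F \<times> K \<times> Z) (\<lambda>y' (m, f, k, z). \<chi> f y' k (m, z))
    \<le> holevo L Y (A \<times> Z) (\<lambda>y (m, a, z). \<psi> a y (m, z)) + chan_info A B K E (gram (Y \<times> L \<times> Z) (\<lambda>a (y, e). \<psi> a y e))"
    unfolding chan_info_def chan_out_gram \<phi>_def by (simp add: case_prod_unfold)
qed

section \<open>Matrices and channels\<close>

lemma sum_lessThan_mult:
  fixes f :: "nat \<Rightarrow> 'a :: comm_monoid_add"
  shows "(\<Sum>i<a * b. f i) = (\<Sum>i<a. \<Sum>j<b. f (i * b + j))"
proof -
  have add: "(\<Sum>i<n + b. f i) = (\<Sum>i<n. f i) + (\<Sum>j<b. f (n + j))" for n
    by (induction b) (simp_all add: add.assoc)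
  show ?thesis by (induction a) (simp_all add: add add.commute[of b])
qed

lemma mult_add_less: "i < a \<Longrightarrow> j < b \<Longrightarrow> i * b + j < a * (b :: nat)"
proof -
  assume "i < a" "j < b"
  then have "Suc i * b \<le> a * b" by (intro mult_right_mono) auto
  then show ?thesis using \<open>j < b\<close> by simp
qed

lemma adj_carrier [simp]: "A \<in> carrier_mat r c \<Longrightarrow> adj A \<in> carrier_mat c r"
  unfolding adj_def by auto

lemma adj_entry: "A \<in> carrier_mat r c \<Longrightarrow> i < c \<Longrightarrow> j < r \<Longrightarrow> adj A $$ (i, j) = cnj (A $$ (j, i))"
  unfolding adj_def by auto

lemma kron_carrier: "A \<in> carrier_mat r c \<Longrightarrow> B \<in> carrier_mat r' c' \<Longrightarrow> kron A B \<in> carrier_mat (r * r') (c * c')"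
  unfolding kron_def by auto

lemma kron_entry:
  assumes "A \<in> carrier_mat r c" "B \<in> carrier_mat r' c'" "i < r" "j < c" "k < r'" "l < c'"
  shows "kron A B $$ (i * r' + k, j * c' + l) = A $$ (i, j) * B $$ (k, l)"
proof -
  have "i * r' + k < r * r'" "j * c' + l < c * c'" using assms by (auto intro: mult_add_less)
  moreover have "(i * r' + k) div r' = i" "(i * r' + k) mod r' = k" "(j * c' + l) div c' = j" "(j * c' + l) mod c' = l"
    using assms by auto
  ultimately show ?thesis using assms(1,2) unfolding kron_def by simp
qed

lemma msum_entry:
  assumes "\<And>A. A \<in> set As \<Longrightarrow> A \<in> carrier_mat r c"
  shows "msum r c As \<in> carrier_mat r c"
    and "i < r \<Longrightarrow> j < c \<Longrightarrow> msum r c As $$ (i, j) = (\<Sum>k<length As. (As ! k) $$ (i, j))"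
proof -
  have "msum r c As \<in> carrier_mat r c \<and> (i < r \<longrightarrow> j < c \<longrightarrow> msum r c As $$ (i, j) = (\<Sum>k<length As. (As ! k) $$ (i, j)))"
    using assms
  proof (induction As)
    case (Cons A As)
    have A: "A \<in> carrier_mat r c" and IH: "msum r c As \<in> carrier_mat r c"
      "i < r \<longrightarrow> j < c \<longrightarrow> msum r c As $$ (i, j) = (\<Sum>k<length As. (As ! k) $$ (i, j))" using Cons by auto
    have "msum r c (A # As) = A + msum r c As" unfolding msum_def by simp
    then show ?case using A IH by (auto simp: sum.lessThan_Suc_shift simp del: sum.lessThan_Suc)
  qed (simp add: msum_def)
  then show "msum r c As \<in> carrier_mat r c"
    "i < r \<Longrightarrow> j < c \<Longrightarrow> msum r c As $$ (i, j) = (\<Sum>k<length As. (As ! k) $$ (i, j))" by auto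
qed

text \<open>The matrix counterpart of \<open>chan_out_gram\<close>. The map \<open>T\<close> from
  Kraus operators to matrices is left open so that a channel, a channel tensored with the identity
  and a round of a code are all instances.\<close>

lemma kraus_sum_gram:
  assumes T: "\<And>E. E \<in> set Es \<Longrightarrow> T E \<in> carrier_mat D D0" and \<sigma>: "\<sigma> \<in> carrier_mat D0 D0"
    and g: "\<And>i j. i < D0 \<Longrightarrow> j < D0 \<Longrightarrow> \<sigma> $$ (i, j) = gram W \<chi> i j"
  shows "msum D D (map (\<lambda>E. T E * \<sigma> * adj (T E)) Es) \<in> carrier_mat D D"
    and "i < D \<Longrightarrow> j < D \<Longrightarrow> msum D D (map (\<lambda>E. T E * \<sigma> * adj (T E)) Es) $$ (i, j)
      = gram ({..<length Es} \<times> W) (\<lambda>i (k, w). \<Sum>l<D0. T (Es ! k) $$ (i, l) * \<chi> l w) i j"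
proof -
  have c: "A \<in> set (map (\<lambda>E. T E * \<sigma> * adj (T E)) Es) \<Longrightarrow> A \<in> carrier_mat D D" for A
    using mult_carrier_mat[OF mult_carrier_mat[OF T \<sigma>] adj_carrier[OF T]] by auto
  show "msum D D (map (\<lambda>E. T E * \<sigma> * adj (T E)) Es) \<in> carrier_mat D D" using c by (rule msum_entry)
  assume ij: "i < D" "j < D"
  have "(T (Es ! k) * \<sigma> * adj (T (Es ! k))) $$ (i, j)
      = (\<Sum>w\<in>W. (\<Sum>l<D0. T (Es ! k) $$ (i, l) * \<chi> l w) * cnj (\<Sum>l<D0. T (Es ! k) $$ (j, l) * \<chi> l w))" if "k < length Es" for k
  proof -
    have t: "T (Es ! k) \<in> carrier_mat D D0" using T that by simp
    let ?t = "\<lambda>i l. T (Es ! k) $$ (i, l)"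
    have "(T (Es ! k) * \<sigma> * adj (T (Es ! k))) $$ (i, j) = (\<Sum>l'<D0. (\<Sum>l<D0. ?t i l * \<sigma> $$ (l, l')) * cnj (?t j l'))"
      unfolding mult_mat_entry[OF mult_carrier_mat[OF t \<sigma>] adj_carrier[OF t] ij]
      using ij by (intro sum.cong refl) (simp add: mult_mat_entry[OF t \<sigma>] adj_entry[OF t])
    also have "\<dots> = (\<Sum>l'<D0. \<Sum>l<D0. \<Sum>w\<in>W. ?t i l * \<chi> l w * cnj (?t j l' * \<chi> l' w))"
      by (intro sum.cong refl) (simp add: g gram_def sum_distrib_left sum_distrib_right mult_ac)
    also have "\<dots> = (\<Sum>w\<in>W. \<Sum>l'<D0. \<Sum>l<D0. ?t i l * \<chi> l w * cnj (?t j l' * \<chi> l' w))"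
      by (rule sum_swap3)
    also have "\<dots> = (\<Sum>w\<in>W. \<Sum>l<D0. \<Sum>l'<D0. ?t i l * \<chi> l w * cnj (?t j l' * \<chi> l' w))"
      by (intro sum.cong refl sum.swap)
    finally show ?thesis unfolding cnj_sum sum_product .
  qed
  then show "msum D D (map (\<lambda>E. T E * \<sigma> * adj (T E)) Es) $$ (i, j)
      = gram ({..<length Es} \<times> W) (\<lambda>i (k, w). \<Sum>l<D0. T (Es ! k) $$ (i, l) * \<chi> l w) i j"
    unfolding gram_def sum.cartesian_product'
    by (subst msum_entry(2)[where As = "map (\<lambda>E. T E * \<sigma> * adj (T E)) Es", OF c ij]) (simp_all del: cnj_sum)
qed

section \<open>Channels, densities and purifications\<close>

definition kfun :: "complex mat list \<Rightarrow> nat \<Rightarrow> nat \<Rightarrow> nat \<Rightarrow> complex" where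
  "kfun Es k b a = (Es ! k) $$ (b, a)"

lemma is_channel_kfun:
  assumes ch: "is_channel dA dB Es" and a: "a < dA" "a' < dA"
  shows "(\<Sum>x\<in>{..<dB} \<times> {..<length Es}. cnj (kfun Es (snd x) (fst x) a) * kfun Es (snd x) (fst x) a') = (if a = a' then 1 else 0)"
proof -
  have c: "E \<in> carrier_mat dB dA" if "E \<in> set Es" for E using ch that unfolding is_channel_def by auto
  have c': "A \<in> set (map (\<lambda>E. adj E * E) Es) \<Longrightarrow> A \<in> carrier_mat dA dA" for A
    using mult_carrier_mat[OF adj_carrier[OF c] c] by auto
  have "(if a = a' then 1 else 0) = msum dA dA (map (\<lambda>E. adj E * E) Es) $$ (a, a')"
    using ch a unfolding is_channel_def by simp
  also have "\<dots> = (\<Sum>k<length Es. (adj (Es ! k) * (Es ! k)) $$ (a, a'))"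
    by (subst msum_entry(2)[where As = "map (\<lambda>E. adj E * E) Es", OF c' a]) simp_all
  also have "\<dots> = (\<Sum>k<length Es. \<Sum>b<dB. cnj (kfun Es k b a) * kfun Es k b a')"
  proof (intro sum.cong refl)
    fix k assume "k \<in> {..<length Es}"
    then have e: "Es ! k \<in> carrier_mat dB dA" using c by simp
    show "(adj (Es ! k) * (Es ! k)) $$ (a, a') = (\<Sum>b<dB. cnj (kfun Es k b a) * kfun Es k b a')"
      unfolding mult_mat_entry[OF adj_carrier[OF e] e a] using a
      by (intro sum.cong refl) (simp add: adj_entry[OF e] kfun_def)
  qed
  also have "\<dots> = (\<Sum>b<dB. \<Sum>k<length Es. cnj (kfun Es k b a) * kfun Es k b a')" by (rule sum.swap)
  finally show ?thesis by (simp add: sum.cartesian_product')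
qed

lemma gram_density:
  assumes g: "\<rho> = mat d d (\<lambda>(i, j). gram D \<chi> i j)" and tr: "(\<Sum>i<d. gram D \<chi> i i) = 1"
  shows "density d \<rho>"
  unfolding density_def
proof (intro conjI ballI)
  show c: "\<rho> \<in> carrier_mat d d" unfolding g by simp
  show "adj \<rho> = \<rho>"
  proof (rule eq_matI)
    fix i j assume "i < dim_row \<rho>" "j < dim_col \<rho>"
    then have "i < d" "j < d" using c by auto
    then show "adj \<rho> $$ (i, j) = \<rho> $$ (i, j)"
      unfolding adj_entry[OF c \<open>i < d\<close> \<open>j < d\<close>] unfolding g by (simp add: gram_herm[of D \<chi> i j])
  qed (use c in \<open>auto simp: adj_def\<close>)
  show "(\<Sum>i<d. \<rho> $$ (i, i)) = 1" using tr unfolding g by simp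
  have \<rho>: "\<rho> $$ (i, j) = gram D \<chi> i j" if "i < d" "j < d" for i j using that unfolding g by simp
  fix v :: "complex mat" assume v: "v \<in> carrier_mat d 1"
  have "(adj v * \<rho> * v) $$ (0, 0) = (\<Sum>j<d. (\<Sum>i<d. cnj (v $$ (i, 0)) * gram D \<chi> i j) * v $$ (j, 0))"
    unfolding mult_mat_entry[OF mult_carrier_mat[OF adj_carrier[OF v] c] v less_one[THEN iffD2, OF refl] less_one[THEN iffD2, OF refl]]
    by (intro sum.cong refl) (simp add: mult_mat_entry[OF adj_carrier[OF v] c] adj_entry[OF v] \<rho>)
  also have "\<dots> = (\<Sum>i<d. \<Sum>j<d. cnj (v $$ (i, 0)) * gram D \<chi> i j * v $$ (j, 0))"
    unfolding sum_distrib_right by (rule sum.swap)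
  also have "\<dots> = of_real (\<Sum>e\<in>D. (cmod (ip {..<d} (\<lambda>i. v $$ (i, 0)) (\<lambda>i. \<chi> i e)))\<^sup>2)"
    using gram_form[where I = "{..<d}" and x = "\<lambda>i. v $$ (i, 0)" and y = "\<lambda>i. v $$ (i, 0)" and E = D and \<Psi> = \<chi>]
    unfolding complex_mult_cnj_cmod2 by simp
  finally have 1: "(adj v * \<rho> * v) $$ (0, 0) = of_real (\<Sum>e\<in>D. (cmod (ip {..<d} (\<lambda>i. v $$ (i, 0)) (\<lambda>i. \<chi> i e)))\<^sup>2)" .
  show "Im ((adj v * \<rho> * v) $$ (0, 0)) = 0" "0 \<le> Re ((adj v * \<rho> * v) $$ (0, 0))"
    unfolding 1 Im_complex_of_real Re_complex_of_real by (auto intro: sum_nonneg)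
qed

text \<open>This justifies the \<open>SOME\<close> in \<open>mutual_info\<close>. The witness is the
  sum of \<open>sqrt (p k)\<close> times \<open>v k\<close> tensored with the \<open>k\<close>-th
  basis vector; the eigenvalue indices lie below \<open>d\<close>, so a reference system of
  dimension \<open>d\<close> is large enough.\<close>

lemma purification_exists:
  assumes g: "\<rho> = mat d d (\<lambda>(i, j). gram D \<chi> i j)" and tr: "(\<Sum>i<d. gram D \<chi> i i) = 1"
  shows "\<exists>\<phi>. is_purification d \<rho> \<phi>"
proof -
  obtain N p v where N: "N \<subseteq> {..<card {..<d}}" and s: "spec {..<d} (gram D \<chi>) N p v"
    by (rule spec_gram_exists[of "{..<d}" D \<chi>]) simp
  have eq: "\<And>i j. i < d \<Longrightarrow> j < d \<Longrightarrow> gram D \<chi> i j = (\<Sum>k\<in>N. of_real (p k) * v k i * cnj (v k j))" and pos: "\<And>k. k \<in> N \<Longrightarrow> p k > 0"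
    using s unfolding spec_def by auto
  define f where "f = (\<lambda>a k. if k \<in> N then of_real (sqrt (p k)) * v k a else 0)"
  define \<phi> where "\<phi> = mat (d * d) 1 (\<lambda>(i, _). f (i div d) (i mod d))"
  have \<phi>: "\<phi> \<in> carrier_mat (d * d) 1" unfolding \<phi>_def by simp
  have e: "\<phi> $$ (i * d + k, 0) = f i k" if "i < d" "k < d" for i k
  proof -
    have "(i * d + k) div d = i" "(i * d + k) mod d = k" using that by auto
    then show ?thesis unfolding \<phi>_def using mult_add_less[OF that] by simp
  qed
  have ff: "(\<Sum>k<d. f i k * cnj (f j k)) = gram D \<chi> i j" if "i < d" "j < d" for i j
  proof -
    have "(\<Sum>k<d. f i k * cnj (f j k)) = (\<Sum>k\<in>N. f i k * cnj (f j k))"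
      using N by (intro sum.mono_neutral_right) (auto simp: f_def)
    also have "\<dots> = (\<Sum>k\<in>N. of_real (p k) * v k i * cnj (v k j))"
    proof (intro sum.cong refl)
      fix k assume k: "k \<in> N"
      have "complex_of_real (sqrt (p k)) * of_real (sqrt (p k)) = of_real (p k)"
        unfolding of_real_mult[symmetric] using pos[OF k] by simp
      then have "complex_of_real (p k) * v k i * cnj (v k j) = complex_of_real (sqrt (p k)) * of_real (sqrt (p k)) * v k i * cnj (v k j)" by simp
      then show "f i k * cnj (f j k) = of_real (p k) * v k i * cnj (v k j)" using k unfolding f_def by (auto simp: mult_ac)
    qed
    finally show ?thesis using eq[OF that] by simp
  qed
  have "adj \<phi> * \<phi> = 1\<^sub>m 1"
  proof (rule eq_matI)
    fix i j assume "i < dim_row (1\<^sub>m 1 :: complex mat)" "j < dim_col (1\<^sub>m 1 :: complex mat)"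
    then have ij: "i = 0" "j = 0" by auto
    have "(adj \<phi> * \<phi>) $$ (0, 0) = (\<Sum>l<d * d. cnj (\<phi> $$ (l, 0)) * \<phi> $$ (l, 0))"
      unfolding mult_mat_entry[OF adj_carrier[OF \<phi>] \<phi> less_one[THEN iffD2, OF refl] less_one[THEN iffD2, OF refl]]
      by (intro sum.cong refl) (simp add: adj_entry[OF \<phi>])
    also have "\<dots> = (\<Sum>i<d. \<Sum>k<d. f i k * cnj (f i k))"
      unfolding sum_lessThan_mult by (intro sum.cong refl) (simp add: e mult.commute)
    also have "\<dots> = 1" using ff tr by simp
    finally show "(adj \<phi> * \<phi>) $$ (i, j) = 1\<^sub>m 1 $$ (i, j)" unfolding ij by simp
  qed (use \<phi> in \<open>auto simp: adj_def\<close>)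
  moreover have "ptrace2 d d (\<phi> * adj \<phi>) = \<rho>"
  proof (rule eq_matI)
    fix i j assume "i < dim_row \<rho>" "j < dim_col \<rho>"
    then have ij: "i < d" "j < d" unfolding g by auto
    have "(\<phi> * adj \<phi>) $$ (i * d + k, j * d + k) = f i k * cnj (f j k)" if "k < d" for k
      unfolding mult_mat_entry[OF \<phi> adj_carrier[OF \<phi>] mult_add_less[OF ij(1) that] mult_add_less[OF ij(2) that]]
      using mult_add_less[OF ij(2) that] ij that by (simp add: adj_entry[OF \<phi>] e)
    then show "ptrace2 d d (\<phi> * adj \<phi>) $$ (i, j) = \<rho> $$ (i, j)"
      using ij ff unfolding ptrace2_def g by simp
  qed (auto simp: ptrace2_def g)
  ultimately show ?thesis using \<phi> unfolding is_purification_def by blast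
qed

text \<open>The joint output of channel and reference is purified by the Kraus index, so its entropy
  is that of the complementary output, a function of the input state alone. In particular the chosen
  purification does not influence the value.\<close>

lemma mutual_info_chan_info:
  assumes ch: "is_channel dA dB Es" and g: "\<rho> = mat dA dA (\<lambda>(i, j). gram D \<chi> i j)"
    and D: "finite D" and tr: "(\<Sum>i<dA. gram D \<chi> i i) = 1"
  shows "mutual_info dA dB \<rho> Es = chan_info {..<dA} {..<dB} {..<length Es} (kfun Es) (gram D \<chi>) / ln 2"
proof -
  let ?K = "{..<length Es}"
  have c: "E \<in> carrier_mat dB dA" if "E \<in> set Es" for E using ch that unfolding is_channel_def by auto
  define \<phi> where "\<phi> = (SOME \<phi>. is_purification dA \<rho> \<phi>)"
  have "is_purification dA \<rho> \<phi>" unfolding \<phi>_def using someI_ex[OF purification_exists[OF g tr]] .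
  then have \<phi>: "\<phi> \<in> carrier_mat (dA * dA) 1" and pt: "ptrace2 dA dA (\<phi> * adj \<phi>) = \<rho>"
    unfolding is_purification_def by auto
  define f where "f = (\<lambda>a a'. \<phi> $$ (a * dA + a', 0))"
  have \<phi>\<phi>: "(\<phi> * adj \<phi>) $$ (i, j) = \<phi> $$ (i, 0) * cnj (\<phi> $$ (j, 0))" if "i < dA * dA" "j < dA * dA" for i j
    unfolding mult_mat_entry[OF \<phi> adj_carrier[OF \<phi>] that] using that by (simp add: adj_entry[OF \<phi>])
  have ff: "gram {..<dA} f i j = gram D \<chi> i j" if ij: "i < dA" "j < dA" for i j
  proof -
    have "gram D \<chi> i j = ptrace2 dA dA (\<phi> * adj \<phi>) $$ (i, j)" unfolding pt g using ij by simp
    also have "\<dots> = (\<Sum>k<dA. f i k * cnj (f j k))"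
      unfolding ptrace2_def using ij by (simp add: \<phi>\<phi> mult_add_less f_def)
    finally show ?thesis unfolding gram_def by simp
  qed
  have 1: "vN_entropy \<rho> = ent {..<dA} (gram D \<chi>) / ln 2"
    by (rule vN_entropy_gram) (auto simp: g)
  have 2: "vN_entropy (apply_ch dB Es \<rho>) = ent {..<dB} (chan_out ?K {..<dA} (kfun Es) (gram D \<chi>)) / ln 2"
  proof -
    have \<rho>: "\<rho> \<in> carrier_mat dA dA" "\<And>i j. i < dA \<Longrightarrow> j < dA \<Longrightarrow> \<rho> $$ (i, j) = gram D \<chi> i j" unfolding g by auto
    note k = kraus_sum_gram[where T = "\<lambda>E. E", OF c \<rho>]
    have "vN_entropy (apply_ch dB Es \<rho>) = ent {..<dB} (gram (?K \<times> D) (\<lambda>i (k, w). \<Sum>l<dA. Es ! k $$ (i, l) * \<chi> l w)) / ln 2"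
      unfolding apply_ch_def by (rule vN_entropy_gram[OF k])
    then show ?thesis unfolding chan_out_gram kfun_def .
  qed
  \<comment> \<open>Duality exchanges output and reference for the Kraus index, whose kernel is then
    the complementary channel applied to the marginal of the purification.\<close>
  have 3: "vN_entropy (apply_ch (dB * dA) (map (\<lambda>E. kron E (1\<^sub>m dA)) Es) (\<phi> * adj \<phi>))
     = ent ?K (chan_out {..<dB} {..<dA} (\<lambda>b k. kfun Es k b) (gram D \<chi>)) / ln 2"
  proof -
    define \<Psi> where "\<Psi> = (\<lambda>i k. \<Sum>l<dA * dA. kron (Es ! k) (1\<^sub>m dA) $$ (i, l) * \<phi> $$ (l, 0))"
    have \<sigma>: "\<phi> * adj \<phi> \<in> carrier_mat (dA * dA) (dA * dA)" by (rule mult_carrier_mat[OF \<phi> adj_carrier[OF \<phi>]])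
    have kc: "kron E (1\<^sub>m dA) \<in> carrier_mat (dB * dA) (dA * dA)" if "E \<in> set Es" for E
      using kron_carrier[OF c[OF that] one_carrier_mat[of dA]] .
    have gg: "(\<phi> * adj \<phi>) $$ (i, j) = gram {()} (\<lambda>i _. \<phi> $$ (i, 0)) i j" if "i < dA * dA" "j < dA * dA" for i j
      unfolding \<phi>\<phi>[OF that] gram_def by simp
    note k = kraus_sum_gram[where T = "\<lambda>E. kron E (1\<^sub>m dA)", OF kc \<sigma> gg]
    have k2: "gram (?K \<times> {()}) (\<lambda>i (k, w). \<Sum>l<dA * dA. kron (Es ! k) (1\<^sub>m dA) $$ (i, l) * \<phi> $$ (l, 0)) i j = gram ?K \<Psi> i j" for i j
      unfolding gram_def \<Psi>_def sum.cartesian_product' by simp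
    have "vN_entropy (apply_ch (dB * dA) (map (\<lambda>E. kron E (1\<^sub>m dA)) Es) (\<phi> * adj \<phi>)) = ent {..<dB * dA} (gram ?K \<Psi>) / ln 2"
      unfolding apply_ch_def map_map comp_def 
      by (rule vN_entropy_gram[OF k(1)], assumption+) (subst k2[symmetric], rule k(2))
    also have "ent {..<dB * dA} (gram ?K \<Psi>) = ent ?K (gram {..<dB * dA} (\<lambda>k i. \<Psi> i k))"
      by (rule ent_dual) auto
    also have "\<dots> = ent ?K (chan_out {..<dB} {..<dA} (\<lambda>b k. kfun Es k b) (gram D \<chi>))"
    proof (rule ent_cong)
      fix k k' assume kk: "k \<in> ?K" "k' \<in> ?K"
      have \<Psi>: "\<Psi> (b * dA + a') k = (\<Sum>a<dA. kfun Es k b a * f a a')" if "b < dB" "a' < dA" "k \<in> ?K" for b a' k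
      proof -
        have ck: "Es ! k \<in> carrier_mat dB dA" using c that by simp
        have "\<Psi> (b * dA + a') k = (\<Sum>a<dA. \<Sum>x<dA. if x = a' then kfun Es k b a * f a a' else 0)"
          unfolding \<Psi>_def sum_lessThan_mult
          by (intro sum.cong refl) (use that in \<open>auto simp: kron_entry[OF ck one_carrier_mat] kfun_def f_def\<close>)
        then show ?thesis using that by simp
      qed
      have "gram {..<dB * dA} (\<lambda>k i. \<Psi> i k) k k' = (\<Sum>b<dB. \<Sum>a'<dA. (\<Sum>a<dA. kfun Es k b a * f a a') * cnj (\<Sum>a<dA. kfun Es k' b a * f a a'))"
        unfolding gram_def sum_lessThan_mult using kk by (intro sum.cong refl) (auto simp: \<Psi>)
      also have "\<dots> = chan_out {..<dB} {..<dA} (\<lambda>b k. kfun Es k b) (gram {..<dA} f) k k'"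
        unfolding chan_out_gram gram_def sum.cartesian_product' prod.case ..
      \<comment> \<open>The purification enters only through its marginal, which equals the given
        state by \<open>ff\<close>.\<close>
      also have "chan_out {..<dB} {..<dA} (\<lambda>b k. kfun Es k b) (gram {..<dA} f) = chan_out {..<dB} {..<dA} (\<lambda>b k. kfun Es k b) (gram D \<chi>)"
        using ff by (intro chan_out_cong) auto
      finally show "gram {..<dB * dA} (\<lambda>k i. \<Psi> i k) k k' = chan_out {..<dB} {..<dA} (\<lambda>b k. kfun Es k b) (gram D \<chi>) k k'" .
    qed
    finally show ?thesis .
  qed
  show ?thesis unfolding mutual_info_def Let_def \<phi>_def[symmetric] 1 2 3 chan_info_def
    by (simp add: add_divide_distrib diff_divide_distrib)
qed

section \<open>Codes with feedback\<close>

text \<open>The environment after \<open>t\<close> rounds is indexed by words of Kraus indices, the latest first; \<open>path_amp\<close>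
  is the vector of amplitudes of which the global state is the Gram matrix.\<close>
fun words :: "complex mat list \<Rightarrow> fcode \<Rightarrow> nat \<Rightarrow> nat list set" where
  "words Es c 0 = {[]}"
| "words Es c (Suc t) = (\<lambda>(k, w). k # w) ` ({..<length (round_kraus Es c (Suc t))} \<times> words Es c t)"

fun path_amp :: "nat \<Rightarrow> complex mat list \<Rightarrow> fcode \<Rightarrow> nat \<Rightarrow> nat \<Rightarrow> nat \<Rightarrow> nat list \<Rightarrow> complex" where
  "path_amp dB Es c m 0 i w = phi0 c $$ (i, 0)"
| "path_amp dB Es c m (Suc t) i w = (\<Sum>l<xd c t * fd c t * yd c t.
     round_op dB c m (Suc t) (round_kraus Es c (Suc t) ! hd w) $$ (i, l) * path_amp dB Es c m t l (tl w))"

section \<open>Words of Kraus indices and the entries of a round\<close>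

lemma finite_words: "finite (words Es c t)"
  by (induction t) auto

lemma sum_words_Suc:
  "(\<Sum>w\<in>words Es c (Suc t). f w) = (\<Sum>k<length (round_kraus Es c (Suc t)). \<Sum>w\<in>words Es c t. f (k # w))"
  by (simp add: sum.reindex inj_on_def case_prod_unfold sum.cartesian_product')

lemma bit_kraus_carrier: "E \<in> set bit_kraus \<Longrightarrow> E \<in> carrier_mat 2 2"
  unfolding bit_kraus_def by auto

lemma swap_mat_mult_entry:
  assumes Q: "Q \<in> carrier_mat (d1 * d2) n" and "i < d1" "s < d2" "j < n"
  shows "(swap_mat d1 d2 * Q) $$ (s * d1 + i, j) = Q $$ (i * d2 + s, j)"
proof -
  have sw: "swap_mat d1 d2 \<in> carrier_mat (d1 * d2) (d1 * d2)" unfolding swap_mat_def by simp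
  have r: "s * d1 + i < d1 * d2" using mult_add_less[OF assms(3,2)] by (simp add: mult.commute)
  have "(swap_mat d1 d2 * Q) $$ (s * d1 + i, j) = (\<Sum>i'<d1. \<Sum>s'<d2. swap_mat d1 d2 $$ (s * d1 + i, i' * d2 + s') * Q $$ (i' * d2 + s', j))"
    unfolding mult_mat_entry[OF sw Q r assms(4)] sum_lessThan_mult ..
  also have "\<dots> = (\<Sum>i'<d1. \<Sum>s'<d2. if i' = i then if s' = s then Q $$ (i * d2 + s, j) else 0 else 0)"
  proof (intro sum.cong refl)
    fix i' s' assume *: "i' \<in> {..<d1}" "s' \<in> {..<d2}"
    then have lt: "i' * d2 + s' < d1 * d2" by (auto intro: mult_add_less)
    have dm: "(i' * d2 + s') div d2 = i'" "(i' * d2 + s') mod d2 = s'" using * by auto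
    have "s * d1 + i = s' * d1 + i' \<longleftrightarrow> s = s' \<and> i = i'"
    proof
      assume e: "s * d1 + i = s' * d1 + i'"
      have "(s * d1 + i) div d1 = s" "(s * d1 + i) mod d1 = i" "(s' * d1 + i') div d1 = s'" "(s' * d1 + i') mod d1 = i'"
        using assms(2) * by auto
      then show "s = s' \<and> i = i'" using e by metis
    qed simp
    then show "swap_mat d1 d2 $$ (s * d1 + i, i' * d2 + s') * Q $$ (i' * d2 + s', j) = (if i' = i then if s' = s then Q $$ (i * d2 + s, j) else 0 else 0)"
      unfolding swap_mat_def using r lt dm by auto
  qed
  also have "\<dots> = (\<Sum>i'<d1. if i' = i then \<Sum>s'<d2. if s' = s then Q $$ (i * d2 + s, j) else 0 else 0)"
    by (intro sum.cong refl) auto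
  also have "\<dots> = Q $$ (i * d2 + s, j)" using assms(2,3) by simp
  finally show ?thesis .
qed

locale feedback_code =
  fixes dA dB n b M :: nat and c :: fcode
  assumes ok: "code_ok dA dB n b M c"
begin

lemma U_iso: "m < M \<Longrightarrow> t < n + b \<Longrightarrow> isometry (xd c t * fd c t) (in_dim dA c (Suc t) * xd c (Suc t)) (Uop c m (Suc t))"
  using ok unfolding code_ok_def by (metis Suc_leI atLeastAtMost_iff diff_Suc_1 le_add1 plus_1_eq_Suc)

lemma W_iso: "t < n + b \<Longrightarrow> isometry (yd c t * out_dim dB c (Suc t)) (fd c (Suc t) * yd c (Suc t)) (Wop c (Suc t))"
  using ok unfolding code_ok_def by (metis Suc_leI atLeastAtMost_iff diff_Suc_1 le_add1 plus_1_eq_Suc)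

lemma round_kraus_carrier:
  assumes "\<And>E. E \<in> set Es \<Longrightarrow> E \<in> carrier_mat dB dA" "E \<in> set (round_kraus Es c t)"
  shows "E \<in> carrier_mat (out_dim dB c t) (in_dim dA c t)"
  using assms bit_kraus_carrier unfolding round_kraus_def out_dim_def in_dim_def by (auto split: if_splits)

context
  fixes m t :: nat and E :: "complex mat"
  assumes m: "m < M" and t: "t < n + b" and E: "E \<in> carrier_mat (out_dim dB c (Suc t)) (in_dim dA c (Suc t))"
begin

lemma round_op_carrier:
  "round_op dB c m (Suc t) E \<in> carrier_mat (xd c (Suc t) * fd c (Suc t) * yd c (Suc t)) (xd c t * fd c t * yd c t)"
proof -
  have U: "Uop c m (Suc t) \<in> carrier_mat (in_dim dA c (Suc t) * xd c (Suc t)) (xd c t * fd c t)"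
    and W: "Wop c (Suc t) \<in> carrier_mat (fd c (Suc t) * yd c (Suc t)) (yd c t * out_dim dB c (Suc t))"
    using U_iso[OF m t] W_iso[OF t] unfolding isometry_def by auto
  have "dim_row (round_op dB c m (Suc t) E) = xd c (Suc t) * fd c (Suc t) * yd c (Suc t)"
    using W unfolding round_op_def kron_def by simp
  moreover have "dim_col (round_op dB c m (Suc t) E) = xd c t * fd c t * yd c t"
    using U unfolding round_op_def kron_def by simp
  ultimately show ?thesis by auto
qed

text \<open>The intermediate identities are summed out: \<open>U\<close> and \<open>E\<close> leave
  Bob's register alone, \<open>E\<close> and \<open>W\<close> leave Alice's new register alone, and
  the swap only reorders the factors. Rows are split as X before (F, Y), columns as (X, F) before Y,
  matching the factors on which \<open>W\<close> and \<open>U\<close> act.\<close>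

lemma round_op_entry:
  assumes x: "x < xd c (Suc t)" and g: "g < fd c (Suc t) * yd c (Suc t)" and j: "j < xd c t * fd c t" and y: "y < yd c t"
  shows "round_op dB c m (Suc t) E $$ (x * (fd c (Suc t) * yd c (Suc t)) + g, j * yd c t + y)
    = (\<Sum>\<beta><out_dim dB c (Suc t). \<Sum>a<in_dim dA c (Suc t).
        Wop c (Suc t) $$ (g, y * out_dim dB c (Suc t) + \<beta>) * E $$ (\<beta>, a) * Uop c m (Suc t) $$ (a * xd c (Suc t) + x, j))"
proof -
  define dx where "dx = xd c (Suc t)"
  define dg where "dg = fd c (Suc t) * yd c (Suc t)"
  define dj where "dj = xd c t * fd c t"
  define dy where "dy = yd c t"
  define db where "db = out_dim dB c (Suc t)"
  define da where "da = in_dim dA c (Suc t)"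
  define U where "U = Uop c m (Suc t)"
  define W where "W = Wop c (Suc t)"
  note defs = dx_def dg_def dj_def dy_def db_def da_def U_def W_def
  have U: "U \<in> carrier_mat (da * dx) dj" and W: "W \<in> carrier_mat dg (dy * db)"
    using U_iso[OF m t] W_iso[OF t] unfolding isometry_def defs by auto
  have E': "E \<in> carrier_mat db da" using E unfolding defs .
  note lt = x[folded dx_def] g[folded dg_def] j[folded dj_def] y[folded dy_def]
  define P1 where "P1 = kron U (1\<^sub>m dy)"
  define P2 where "P2 = kron E (1\<^sub>m (dx * dy))"
  define S where "S = swap_mat db (dx * dy)"
  define P4 where "P4 = kron (1\<^sub>m dx) W"
  have P1: "P1 \<in> carrier_mat (da * (dx * dy)) (dj * dy)"
    using kron_carrier[OF U one_carrier_mat] unfolding P1_def by (simp add: mult.assoc)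
  have P2: "P2 \<in> carrier_mat (db * (dx * dy)) (da * (dx * dy))"
    using kron_carrier[OF E' one_carrier_mat] unfolding P2_def by simp
  have S: "S \<in> carrier_mat (db * (dx * dy)) (db * (dx * dy))" unfolding S_def swap_mat_def by simp
  have P4: "P4 \<in> carrier_mat (dx * dg) (db * (dx * dy))"
    using kron_carrier[OF one_carrier_mat W, of dx] unfolding P4_def by (simp add: mult_ac)
  have ro: "round_op dB c m (Suc t) E = P4 * (S * (P2 * P1))"
    unfolding round_op_def P1_def[symmetric, unfolded defs] P2_def[symmetric, unfolded defs] S_def[symmetric, unfolded defs] P4_def[symmetric, unfolded defs]
    using P1 P2 S P4 assoc_mult_mat[OF mult_carrier_mat[OF P4 S] P2 P1] assoc_mult_mat[OF P4 S mult_carrier_mat[OF P2 P1]]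
    unfolding P1_def P2_def S_def P4_def defs by simp
  have col: "j * dy + y < dj * dy" using lt by (intro mult_add_less)
  \<comment> \<open>The condition \<open>y1 = y\<close> expresses that Bob's register is idle before
    \<open>W\<close>; the index \<open>x\<close> passes unchanged through \<open>E\<close>.\<close>
  have Q: "(P2 * P1) $$ (\<beta> * (dx * dy) + (x * dy + y1), j * dy + y) = (if y1 = y then \<Sum>a<da. E $$ (\<beta>, a) * U $$ (a * dx + x, j) else 0)"
    if \<beta>: "\<beta> < db" and y1: "y1 < dy" for \<beta> y1
  proof -
    have xy: "x * dy + y1 < dx * dy" using lt y1 by (intro mult_add_less)
    have row: "\<beta> * (dx * dy) + (x * dy + y1) < db * (dx * dy)" by (rule mult_add_less[OF \<beta> xy])
    have "(P2 * P1) $$ (\<beta> * (dx * dy) + (x * dy + y1), j * dy + y)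
      = (\<Sum>a<da. \<Sum>s<dx * dy. P2 $$ (\<beta> * (dx * dy) + (x * dy + y1), a * (dx * dy) + s) * P1 $$ (a * (dx * dy) + s, j * dy + y))"
      unfolding mult_mat_entry[OF P2 P1 row col] sum_lessThan_mult[of _ da] ..
    also have "\<dots> = (\<Sum>a<da. \<Sum>s<dx * dy. if s = x * dy + y1 then E $$ (\<beta>, a) * P1 $$ (a * (dx * dy) + (x * dy + y1), j * dy + y) else 0)"
      using \<beta> xy by (intro sum.cong refl) (auto simp: P2_def kron_entry[OF E' one_carrier_mat])
    also have "\<dots> = (\<Sum>a<da. E $$ (\<beta>, a) * P1 $$ (a * (dx * dy) + (x * dy + y1), j * dy + y))"
      using xy by simp
    also have "\<dots> = (\<Sum>a<da. E $$ (\<beta>, a) * (if y1 = y then U $$ (a * dx + x, j) else 0))"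
    proof (intro sum.cong refl)
      fix a assume "a \<in> {..<da}"
      then have ax: "a * dx + x < da * dx" using lt by (intro mult_add_less) auto
      have eqi: "a * (dx * dy) + (x * dy + y1) = (a * dx + x) * dy + y1" by (simp add: algebra_simps)
      show "E $$ (\<beta>, a) * P1 $$ (a * (dx * dy) + (x * dy + y1), j * dy + y) = E $$ (\<beta>, a) * (if y1 = y then U $$ (a * dx + x, j) else 0)"
        unfolding eqi P1_def using kron_entry[OF U one_carrier_mat ax lt(3) y1 lt(4)] y1 lt(4) by simp
    qed
    finally show ?thesis by auto
  qed
  have row: "x * dg + g < dx * dg" using lt by (intro mult_add_less)
  have SQ: "S * (P2 * P1) \<in> carrier_mat (dx * (dy * db)) (dj * dy)"
    using mult_carrier_mat[OF S mult_carrier_mat[OF P2 P1]] by (simp add: mult_ac)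
  have P4': "P4 \<in> carrier_mat (dx * dg) (dx * (dy * db))" using P4 by (simp add: mult_ac)
  have "round_op dB c m (Suc t) E $$ (x * dg + g, j * dy + y)
     = (\<Sum>x'<dx. \<Sum>h<dy * db. P4 $$ (x * dg + g, x' * (dy * db) + h) * (S * (P2 * P1)) $$ (x' * (dy * db) + h, j * dy + y))"
    unfolding ro mult_mat_entry[OF P4' SQ row col] sum_lessThan_mult[of _ dx] ..
  also have "\<dots> = (\<Sum>x'<dx. if x' = x then \<Sum>h<dy * db. W $$ (g, h) * (S * (P2 * P1)) $$ (x * (dy * db) + h, j * dy + y) else 0)"
    using lt by (intro sum.cong refl) (auto simp: P4_def kron_entry[OF one_carrier_mat W] intro!: sum.cong)
  also have "\<dots> = (\<Sum>h<dy * db. W $$ (g, h) * (S * (P2 * P1)) $$ (x * (dy * db) + h, j * dy + y))"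
    using lt by simp
  also have "\<dots> = (\<Sum>y1<dy. \<Sum>\<beta><db. W $$ (g, y1 * db + \<beta>) * (S * (P2 * P1)) $$ (x * (dy * db) + (y1 * db + \<beta>), j * dy + y))"
    by (rule sum_lessThan_mult)
  also have "\<dots> = (\<Sum>y1<dy. \<Sum>\<beta><db. W $$ (g, y1 * db + \<beta>) * (if y1 = y then \<Sum>a<da. E $$ (\<beta>, a) * U $$ (a * dx + x, j) else 0))"
  proof (intro sum.cong refl)
    fix y1 \<beta> assume *: "y1 \<in> {..<dy}" "\<beta> \<in> {..<db}"
    then have xy: "x * dy + y1 < dx * dy" using lt by (intro mult_add_less) auto
    \<comment> \<open>Rebracketing of the three tensor factors, so that the swap sees X and Y as one
      factor.\<close>
    have eqi: "x * (dy * db) + (y1 * db + \<beta>) = (x * dy + y1) * db + \<beta>" by (simp add: algebra_simps)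
    have "(S * (P2 * P1)) $$ (x * (dy * db) + (y1 * db + \<beta>), j * dy + y) = (P2 * P1) $$ (\<beta> * (dx * dy) + (x * dy + y1), j * dy + y)"
      unfolding S_def eqi using swap_mat_mult_entry[OF mult_carrier_mat[OF P2 P1] _ xy col, of \<beta>] * by simp
    then show "W $$ (g, y1 * db + \<beta>) * (S * (P2 * P1)) $$ (x * (dy * db) + (y1 * db + \<beta>), j * dy + y)
      = W $$ (g, y1 * db + \<beta>) * (if y1 = y then \<Sum>a<da. E $$ (\<beta>, a) * U $$ (a * dx + x, j) else 0)"
      using Q * by simp
  qed
  also have "\<dots> = (\<Sum>y1<dy. if y1 = y then \<Sum>\<beta><db. W $$ (g, y * db + \<beta>) * (\<Sum>a<da. E $$ (\<beta>, a) * U $$ (a * dx + x, j)) else 0)"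
    by (intro sum.cong refl) auto
  also have "\<dots> = (\<Sum>\<beta><db. W $$ (g, y * db + \<beta>) * (\<Sum>a<da. E $$ (\<beta>, a) * U $$ (a * dx + x, j)))"
    using lt by simp
  also have "\<dots> = (\<Sum>\<beta><db. \<Sum>a<da. W $$ (g, y * db + \<beta>) * E $$ (\<beta>, a) * U $$ (a * dx + x, j))"
    unfolding sum_distrib_left by (simp add: mult.assoc)
  finally show ?thesis unfolding defs .
qed

end

section \<open>The receiver's state as a Gram kernel\<close>

definition bobk :: "complex mat list \<Rightarrow> nat \<Rightarrow> nat \<Rightarrow> nat \<Rightarrow> nat \<Rightarrow> complex" where
  "bobk Es t m = gram ({..<xd c t * fd c t} \<times> words Es c t) (\<lambda>y (j, w). path_amp dB Es c m t (j * yd c t + y) w)"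

definition benv :: "complex mat list \<Rightarrow> nat \<Rightarrow> (nat \<times> nat list) set" where
  "benv Es t = {..<xd c t * fd c t} \<times> words Es c t"

text \<open>Dividing by \<open>sqrt (real M)\<close> implements a uniformly random message. The
  message is part of the traced-out index, so summing over it averages Bob's states without
  interference.\<close>

definition bobv :: "complex mat list \<Rightarrow> nat \<Rightarrow> nat \<Rightarrow> nat \<times> nat \<times> nat list \<Rightarrow> complex" where
  "bobv Es t = (\<lambda>y (m, j, w). path_amp dB Es c m t (j * yd c t + y) w / of_real (sqrt (real M)))"

lemma gram_bobv: "gram ({m} \<times> benv Es t) (bobv Es t) i j = of_real (1 / real M) * bobk Es t m i j"
proof -
  have "complex_of_real (sqrt (real M)) * of_real (sqrt (real M)) = of_nat M"
    unfolding of_real_mult[symmetric] by simp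
  then show ?thesis unfolding gram_def bobk_def bobv_def benv_def sum.cartesian_product' by (simp add: sum_divide_distrib)
qed

context
  fixes Es :: "complex mat list"
  assumes Es: "\<And>E. E \<in> set Es \<Longrightarrow> E \<in> carrier_mat dB dA"
begin

lemma glob_state_gram:
  assumes m: "m < M"
  shows "t \<le> n + b \<Longrightarrow> glob_state dB Es c m t \<in> carrier_mat (xd c t * fd c t * yd c t) (xd c t * fd c t * yd c t) \<and>
    (\<forall>i < xd c t * fd c t * yd c t. \<forall>j < xd c t * fd c t * yd c t. glob_state dB Es c m t $$ (i, j) = gram (words Es c t) (path_amp dB Es c m t) i j)"
proof (induction t)
  case 0
  have \<phi>: "phi0 c \<in> carrier_mat (xd c 0 * fd c 0 * yd c 0) 1"
    using ok unfolding code_ok_def isometry_def by auto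
  have "(phi0 c * adj (phi0 c)) $$ (i, j) = gram (words Es c 0) (path_amp dB Es c m 0) i j"
    if "i < xd c 0 * fd c 0 * yd c 0" "j < xd c 0 * fd c 0 * yd c 0" for i j
    unfolding mult_mat_entry[OF \<phi> adj_carrier[OF \<phi>] that] using that by (simp add: gram_def adj_entry[OF \<phi>])
  then show ?case using mult_carrier_mat[OF \<phi> adj_carrier[OF \<phi>]] by (simp add: gram_def)
next
  case (Suc t)
  let ?D = "xd c t * fd c t * yd c t" and ?D' = "xd c (Suc t) * fd c (Suc t) * yd c (Suc t)"
  let ?T = "round_op dB c m (Suc t)" and ?K = "round_kraus Es c (Suc t)"
  have t: "t < n + b" using Suc.prems by simp
  have IH: "glob_state dB Es c m t \<in> carrier_mat ?D ?D"
    "\<And>i j. i < ?D \<Longrightarrow> j < ?D \<Longrightarrow> glob_state dB Es c m t $$ (i, j) = gram (words Es c t) (path_amp dB Es c m t) i j"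
    using Suc by auto
  have T: "?T E \<in> carrier_mat ?D' ?D" if "E \<in> set ?K" for E
    by (rule round_op_carrier[OF m t round_kraus_carrier[OF Es that]])
  have g: "glob_state dB Es c m (Suc t) = msum ?D' ?D' (map (\<lambda>E. ?T E * glob_state dB Es c m t * adj (?T E)) ?K)"
    by (simp add: Let_def)
  have "glob_state dB Es c m (Suc t) $$ (i, j) = gram (words Es c (Suc t)) (path_amp dB Es c m (Suc t)) i j" if "i < ?D'" "j < ?D'" for i j
  proof -
    have "glob_state dB Es c m (Suc t) $$ (i, j) = gram ({..<length ?K} \<times> words Es c t) (\<lambda>i (k, w). \<Sum>l<?D. ?T (?K ! k) $$ (i, l) * path_amp dB Es c m t l w) i j"
      unfolding g by (rule kraus_sum_gram(2)[OF T IH that])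
    also have "\<dots> = gram (words Es c (Suc t)) (path_amp dB Es c m (Suc t)) i j"
      unfolding gram_def sum_words_Suc sum.cartesian_product' by simp
    finally show ?thesis .
  qed
  moreover have "glob_state dB Es c m (Suc t) \<in> carrier_mat ?D' ?D'"
    unfolding g by (rule kraus_sum_gram(1)[OF T IH])
  ultimately show ?case by blast
qed

lemma bob_state_entry:
  assumes m: "m < M" and "t \<le> n + b" "i < yd c t" "j < yd c t"
  shows "bob_state dB Es c m t $$ (i, j) = bobk Es t m i j"
proof -
  have "k * yd c t + i' < xd c t * fd c t * yd c t" if "k < xd c t * fd c t" "i' < yd c t" for k i'
    using that by (rule mult_add_less)
  then have "bob_state dB Es c m t $$ (i, j) = (\<Sum>k<xd c t * fd c t. gram (words Es c t) (path_amp dB Es c m t) (k * yd c t + i) (k * yd c t + j))"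
    using assms glob_state_gram[OF m assms(2)] unfolding bob_state_def ptrace1_def by simp
  then show ?thesis unfolding bobk_def gram_def sum.cartesian_product' by simp
qed

text \<open>The amplitudes after a round in the shape demanded by \<open>holevo_round\<close>: Bob's
  isometry outermost, then the Kraus operator, then Alice's isometry.\<close>

lemma path_amp_Suc:
  assumes m: "m < M" and t: "t < n + b" and x: "x < xd c (Suc t)" and g: "g < fd c (Suc t) * yd c (Suc t)"
    and k: "k < length (round_kraus Es c (Suc t))"
  shows "path_amp dB Es c m (Suc t) (x * (fd c (Suc t) * yd c (Suc t)) + g) (k # w)
    = (\<Sum>z\<in>{..<out_dim dB c (Suc t)} \<times> {..<yd c t}. Wop c (Suc t) $$ (g, snd z * out_dim dB c (Suc t) + fst z) *
        (\<Sum>a<in_dim dA c (Suc t). kfun (round_kraus Es c (Suc t)) k (fst z) a *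
          (\<Sum>j<xd c t * fd c t. Uop c m (Suc t) $$ (a * xd c (Suc t) + x, j) * path_amp dB Es c m t (j * yd c t + snd z) w)))"
proof -
  let ?E = "round_kraus Es c (Suc t) ! k"
  let ?db = "out_dim dB c (Suc t)" and ?da = "in_dim dA c (Suc t)"
  have E: "?E \<in> carrier_mat ?db ?da" by (rule round_kraus_carrier[OF Es]) (use k in auto)
  define f where "f = (\<lambda>\<beta> a j y. Wop c (Suc t) $$ (g, y * ?db + \<beta>) * ?E $$ (\<beta>, a) * Uop c m (Suc t) $$ (a * xd c (Suc t) + x, j) * path_amp dB Es c m t (j * yd c t + y) w)"
  have "path_amp dB Es c m (Suc t) (x * (fd c (Suc t) * yd c (Suc t)) + g) (k # w)
     = (\<Sum>j<xd c t * fd c t. \<Sum>y<yd c t. round_op dB c m (Suc t) ?E $$ (x * (fd c (Suc t) * yd c (Suc t)) + g, j * yd c t + y) * path_amp dB Es c m t (j * yd c t + y) w)"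
    by (simp only: path_amp.simps list.sel sum_lessThan_mult)
  also have "\<dots> = (\<Sum>j<xd c t * fd c t. \<Sum>y<yd c t. \<Sum>\<beta><?db. \<Sum>a<?da. f \<beta> a j y)"
    unfolding f_def by (intro sum.cong refl) (simp add: round_op_entry[OF m t E x g] sum_distrib_right)
  also have "\<dots> = (\<Sum>y<yd c t. \<Sum>\<beta><?db. \<Sum>j<xd c t * fd c t. \<Sum>a<?da. f \<beta> a j y)" by (rule sum_swap3[symmetric])
  also have "\<dots> = (\<Sum>\<beta><?db. \<Sum>y<yd c t. \<Sum>a<?da. \<Sum>j<xd c t * fd c t. f \<beta> a j y)"
    by (rule trans[OF sum.swap]) (intro sum.cong refl sum.swap)
  finally show ?thesis unfolding f_def sum.cartesian_product' kfun_def by (simp add: sum_distrib_left mult.assoc)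
qed

end

end

text \<open>From \<open>ln x \<le> x - 1\<close> at \<open>x = 1 / p\<close> each summand is at most
  1. This crude constant suffices because it is used only for the bit rounds, whose number does not
  grow with the block length.\<close>

lemma gram_le_card:
  assumes "finite I"
  shows "ent I (gram E \<Psi>) \<le> real (card I)"
proof -
  obtain N :: "nat set" and p v where N: "N \<subseteq> {..<card I}" and s: "spec I (gram E \<Psi>) N p v"
    by (rule spec_gram_exists[OF assms, of E \<Psi>]) blast
  have "- (p k * ln (p k)) \<le> 1" if "k \<in> N" for k
  proof -
    have pos: "p k > 0" using s that unfolding spec_def by auto
    have "ln (1 / p k) \<le> 1 / p k - 1" using pos by (intro ln_le_minus_one) simp
    then have "p k * ln (1 / p k) \<le> p k * (1 / p k - 1)" using pos by (intro mult_left_mono) auto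
    then show ?thesis using pos by (simp add: ln_div algebra_simps)
  qed
  then have "ent I (gram E \<Psi>) \<le> (\<Sum>k\<in>N. 1)" unfolding ent_eq[OF s] by (intro sum_mono) auto
  also have "\<dots> \<le> real (card I)" using card_mono[OF _ N] by simp
  finally show ?thesis .
qed

lemma kfun_bit_kraus: "k < 2 \<Longrightarrow> \<beta> < 2 \<Longrightarrow> a < 2 \<Longrightarrow> kfun bit_kraus k \<beta> a = (if k = \<beta> \<and> \<beta> = a then 1 else 0)"
  unfolding kfun_def bit_kraus_def by (auto simp: less_2_cases_iff)

text \<open>The dephasing channel is its own complement, so the two output entropies cancel and only
  the input entropy on dimension 2 remains.\<close>

lemma chan_info_bit:
  "chan_info {..<2} {..<2} {..<length bit_kraus} (kfun bit_kraus) (gram D \<chi>) \<le> 2"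
proof -
  have l: "length bit_kraus = 2" by (simp add: bit_kraus_def)
  have "ent {..<2} (chan_out {..<2} {..<2} (kfun bit_kraus) (gram D \<chi>))
     = ent {..<2} (chan_out {..<2} {..<2} (\<lambda>b k. kfun bit_kraus k b) (gram D \<chi>))"
    by (intro ent_cong) (auto simp: chan_out_def kfun_bit_kraus intro!: sum.cong)
  then show ?thesis using gram_le_card[of "{..<2 :: nat}" D \<chi>] unfolding chan_info_def l by simp
qed

lemma isometry_entry_inner:
  assumes "isometry di do V" "a < di" "a' < di"
  shows "(\<Sum>x<do. cnj (V $$ (x, a)) * V $$ (x, a')) = (if a = a' then 1 else 0)"
proof -
  have V: "V \<in> carrier_mat do di" and 1: "adj V * V = 1\<^sub>m di" using assms unfolding isometry_def by auto
  have "(adj V * V) $$ (a, a') = (\<Sum>x<do. cnj (V $$ (x, a)) * V $$ (x, a'))"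
    unfolding mult_mat_entry[OF adj_carrier[OF V] V assms(2,3)] using assms
    by (intro sum.cong refl) (simp add: adj_entry[OF V])
  then show ?thesis unfolding 1 using assms by simp
qed

section \<open>One round of an actual code\<close>

context feedback_code
begin

lemma round_kraus_kfun:
  assumes ch: "is_channel dA dB Es" and a: "a < in_dim dA c t" "a' < in_dim dA c t"
  shows "(\<Sum>x\<in>{..<out_dim dB c t} \<times> {..<length (round_kraus Es c t)}.
     cnj (kfun (round_kraus Es c t) (snd x) (fst x) a) * kfun (round_kraus Es c t) (snd x) (fst x) a') = (if a = a' then 1 else 0)"
proof (cases "sched c t")
  case True
  then show ?thesis using is_channel_kfun[OF ch] a unfolding round_kraus_def in_dim_def out_dim_def by simp
next
  case False
  have l: "length bit_kraus = 2" by (simp add: bit_kraus_def)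
  have "(\<Sum>x\<in>{..<2} \<times> {..<2}. cnj (kfun bit_kraus (snd x) (fst x) a) * kfun bit_kraus (snd x) (fst x) a')
     = (\<Sum>\<beta><2. \<Sum>k<2. if k = \<beta> then if \<beta> = a then if a = a' then 1 else 0 else 0 else (0 :: complex))"
    using a False unfolding sum.cartesian_product' in_dim_def by (intro sum.cong refl) (auto simp: kfun_bit_kraus)
  also have "\<dots> = (\<Sum>\<beta><2. if \<beta> = a then if a = a' then 1 else 0 else (0 :: complex))"
    by (intro sum.cong refl) simp
  also have "\<dots> = (if a = a' then 1 else 0)" using a False unfolding in_dim_def by simp
  finally show ?thesis using False l unfolding round_kraus_def out_dim_def by simp
qed

text \<open>An instance of \<open>holevo_round\<close> in which Alice's retained register and the
  earlier Kraus word form the inert system \<open>Z\<close>. The averaged channel input is returned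
  as an anonymous Gram kernel of trace 1, which is all that is needed to compare it with a density
  matrix.\<close>

lemma holevo_code_round:
  assumes ch: "is_channel dA dB Es" and t: "t < n + b"
    and tr: "(\<Sum>y<yd c t. gram ({..<M} \<times> benv Es t) (bobv Es t) y y) = 1"
  shows "(\<Sum>y<yd c (Suc t). gram ({..<M} \<times> benv Es (Suc t)) (bobv Es (Suc t)) y y) = 1"
    and "\<exists>(D :: (nat \<times> nat \<times> nat \<times> nat list) set) \<chi>. finite D \<and> (\<Sum>a<in_dim dA c (Suc t). gram D \<chi> a a) = 1 \<and>
      holevo {..<M} {..<yd c (Suc t)} (benv Es (Suc t)) (bobv Es (Suc t)) \<le> holevo {..<M} {..<yd c t} (benv Es t) (bobv Es t)
        + chan_info {..<in_dim dA c (Suc t)} {..<out_dim dB c (Suc t)} {..<length (round_kraus Es c (Suc t))} (kfun (round_kraus Es c (Suc t))) (gram D \<chi>)"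
proof -
  have Es: "E \<in> carrier_mat dB dA" if "E \<in> set Es" for E using ch that unfolding is_channel_def by auto
  let ?A = "{..<in_dim dA c (Suc t)}" and ?B = "{..<out_dim dB c (Suc t)}" and ?K = "{..<length (round_kraus Es c (Suc t))}"
    and ?Y = "{..<yd c t}" and ?X = "{..<xd c (Suc t)}" and ?F = "{..<fd c (Suc t)}" and ?Y' = "{..<yd c (Suc t)}" and ?J = "{..<xd c t * fd c t}"
  let ?w = "words Es c t" and ?L = "{..<M}" and ?r = "complex_of_real (sqrt (real M))"
  let ?Z = "?X \<times> ?w"
  let ?E = "kfun (round_kraus Es c (Suc t))"
  define p where "p = (\<lambda>m j y w. path_amp dB Es c m t (j * yd c t + y) w / ?r)"
  define U where "U = (\<lambda>m \<alpha> j. Uop c m (Suc t) $$ (\<alpha>, j))"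
  \<comment> \<open>The amplitudes after Alice's isometry and before the channel: \<open>a\<close>
    is sent, \<open>x\<close> is retained.\<close>
  define \<psi> where "\<psi> = (\<lambda>a y (m, x, w). \<Sum>j\<in>?J. U m (a * xd c (Suc t) + x) j * p m j y w)"
  define W where "W = (\<lambda>(f, y') (\<beta>, y). Wop c (Suc t) $$ (f * yd c (Suc t) + y', y * out_dim dB c (Suc t) + \<beta>))"
  define q where "q = (\<lambda>m x f y k w. path_amp dB Es c m (Suc t) (x * (fd c (Suc t) * yd c (Suc t)) + (f * yd c (Suc t) + y)) (k # w) / ?r)"
  define \<chi> where "\<chi> = (\<lambda>f y' k (m, x, w). q m x f y' k w)"
  have fin: "finite ?A" "finite ?B" "finite ?K" "finite ?Y" "finite ?Z" "finite ?F" "finite ?Y'" "finite ?L"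
    using finite_words by auto
  \<comment> \<open>Alice's isometry may depend on \<open>m\<close>, but for each fixed
    \<open>m\<close> it acts within the part traced out for Bob, so his kernels are
    unchanged.\<close>
  have ker: "gram (L' \<times> ?A \<times> ?Z) (\<lambda>y (m, a, z). \<psi> a y (m, z)) y y' = gram (L' \<times> benv Es t) (bobv Es t) y y'" if L': "L' \<subseteq> ?L" for L' y y'
  proof -
    have per: "(\<Sum>a\<in>?A. \<Sum>x\<in>?X. \<Sum>w\<in>?w. (\<Sum>j\<in>?J. U m (a * xd c (Suc t) + x) j * p m j y w) * cnj (\<Sum>j\<in>?J. U m (a * xd c (Suc t) + x) j * p m j y' w))
      = (\<Sum>j\<in>?J. \<Sum>w\<in>?w. p m j y w * cnj (p m j y' w))" (is "?l = _") if m: "m < M" for m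
    proof -
      have iso: "(\<Sum>\<alpha><in_dim dA c (Suc t) * xd c (Suc t). cnj (U m \<alpha> j) * U m \<alpha> j') = (if j = j' then 1 else 0)" if "j \<in> ?J" "j' \<in> ?J" for j j'
        using isometry_entry_inner[OF U_iso[OF m t]] that unfolding U_def by simp
      have "?l = (\<Sum>\<alpha><in_dim dA c (Suc t) * xd c (Suc t). \<Sum>w\<in>?w. (\<Sum>j\<in>?J. U m \<alpha> j * p m j y w) * cnj (\<Sum>j\<in>?J. U m \<alpha> j * p m j y' w))"
        unfolding sum_lessThan_mult[of _ "in_dim dA c (Suc t)"] ..
      also have "\<dots> = (\<Sum>w\<in>?w. \<Sum>j\<in>?J. p m j y w * cnj (p m j y' w))"
        by (subst sum.swap) (intro sum.cong refl isometry_inner iso, auto)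
      also have "\<dots> = (\<Sum>j\<in>?J. \<Sum>w\<in>?w. p m j y w * cnj (p m j y' w))" by (rule sum.swap)
      finally show ?thesis .
    qed
    show ?thesis
      unfolding gram_def benv_def sum.cartesian_product' \<psi>_def bobv_def prod.case p_def
      by (rule sum.cong[OF refl], rule per[unfolded p_def]) (use L' in auto)
  qed
  \<comment> \<open>Only a reordering: the returned \<open>f\<close> joins Alice's \<open>x\<close>,
    and the Kraus index \<open>k\<close> is prepended to the word.\<close>
  have ker': "gram (L' \<times> ?F \<times> ?K \<times> ?Z) (\<lambda>y' (m, f, k, z). \<chi> f y' k (m, z)) y y' = gram (L' \<times> benv Es (Suc t)) (bobv Es (Suc t)) y y'" for L' y y'
  proof -
    have ix: "(x * fd c (Suc t) + f) * yd c (Suc t) + y = x * (fd c (Suc t) * yd c (Suc t)) + (f * yd c (Suc t) + y)" for x f y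
      by (simp add: algebra_simps)
    have "gram (L' \<times> ?F \<times> ?K \<times> ?Z) (\<lambda>y' (m, f, k, z). \<chi> f y' k (m, z)) y y'
        = (\<Sum>m\<in>L'. \<Sum>f\<in>?F. \<Sum>k\<in>?K. \<Sum>x\<in>?X. \<Sum>w\<in>?w. q m x f y k w * cnj (q m x f y' k w))"
      unfolding gram_def sum.cartesian_product' \<chi>_def prod.case ..
    also have "\<dots> = (\<Sum>m\<in>L'. \<Sum>x\<in>?X. \<Sum>f\<in>?F. \<Sum>k\<in>?K. \<Sum>w\<in>?w. q m x f y k w * cnj (q m x f y' k w))"
      by (rule sum.cong[OF refl sum_swap3])
    finally show ?thesis
      unfolding gram_def benv_def bobv_def sum.cartesian_product' prod.case sum_words_Suc sum_lessThan_mult[of _ "xd c (Suc t)"] ix q_def .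
  qed
  have W: "(\<Sum>g\<in>?F \<times> ?Y'. cnj (W g x) * W g x') = (if x = x' then 1 else 0)" if "x \<in> ?B \<times> ?Y" "x' \<in> ?B \<times> ?Y" for x x'
  proof -
    obtain \<beta> y \<beta>' y' where x: "x = (\<beta>, y)" "x' = (\<beta>', y')" by (cases x, cases x')
    let ?d = "out_dim dB c (Suc t)"
    have lt: "y * ?d + \<beta> < yd c t * ?d" "y' * ?d + \<beta>' < yd c t * ?d" using that unfolding x by (auto intro: mult_add_less)
    have "(y * ?d + \<beta>) div ?d = y" "(y * ?d + \<beta>) mod ?d = \<beta>" "(y' * ?d + \<beta>') div ?d = y'" "(y' * ?d + \<beta>') mod ?d = \<beta>'"
      using that unfolding x by auto
    then have "y * ?d + \<beta> = y' * ?d + \<beta>' \<longleftrightarrow> y = y' \<and> \<beta> = \<beta>'" by metis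
    then show ?thesis
      using isometry_entry_inner[OF W_iso[OF t] lt] unfolding x W_def sum.cartesian_product' prod.case sum_lessThan_mult[of _ "fd c (Suc t)"] by auto
  qed
  have \<chi>: "\<chi> f y' k e = (\<Sum>x\<in>?B \<times> ?Y. W (f, y') x * (\<Sum>a\<in>?A. ?E k (fst x) a * \<psi> a (snd x) e))"
    if "f \<in> ?F" "y' \<in> ?Y'" "k \<in> ?K" "e \<in> ?L \<times> ?Z" for f y' k e
  proof -
    obtain m x w where e: "e = (m, x, w)" "m < M" "x < xd c (Suc t)" using \<open>e \<in> ?L \<times> ?Z\<close> by auto
    have g: "f * yd c (Suc t) + y' < fd c (Suc t) * yd c (Suc t)" using that by (auto intro: mult_add_less)
    have k: "k < length (round_kraus Es c (Suc t))" using that by simp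
    show ?thesis
      unfolding e \<chi>_def q_def \<psi>_def prod.case W_def U_def p_def
      by (subst path_amp_Suc[OF Es e(2) t e(3) g k]) (auto simp: case_prod_unfold sum_divide_distrib[symmetric])
  qed
  have tr\<psi>: "(\<Sum>y\<in>?Y. gram (?L \<times> ?A \<times> ?Z) (\<lambda>y (m, a, z). \<psi> a y (m, z)) y y) = 1"
    using ker[OF order.refl] tr by simp
  note hr = holevo_round[OF fin tr\<psi> round_kraus_kfun[OF ch] W \<chi>]
  show "(\<Sum>y<yd c (Suc t). gram (?L \<times> benv Es (Suc t)) (bobv Es (Suc t)) y y) = 1"
    unfolding ker'[symmetric] by (rule hr(2)) auto
  let ?\<rho> = "gram (?Y \<times> ?L \<times> ?Z) (\<lambda>a (y, e). \<psi> a y e)"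
  have "(\<Sum>a\<in>?A. ?\<rho> a a) = 1"
  proof -
    have "gram (?A \<times> ?Y \<times> ?L \<times> ?Z) (\<lambda>(_ :: unit) (a, y, e). \<psi> a y e) = gram (?Y \<times> ?L \<times> ?A \<times> ?Z) (\<lambda>_ (y, m, a, z). \<psi> a y (m, z))"
      by (rule gram_embed[where h = "\<lambda>(y, m, a, z). (a, y, m, z)"]) (use fin in \<open>auto simp: inj_on_def image_def\<close>)
    from fun_cong[OF fun_cong[OF this]] show ?thesis using tr\<psi> by (simp add: gram_def sum.cartesian_product')
  qed
  moreover have "holevo ?L ?Y' (benv Es (Suc t)) (bobv Es (Suc t)) \<le> holevo ?L ?Y (benv Es t) (bobv Es t) + chan_info ?A ?B ?K ?E ?\<rho>"
  proof -
    have "holevo ?L ?Y (benv Es t) (bobv Es t) = holevo ?L ?Y (?A \<times> ?Z) (\<lambda>y (m, a, z). \<psi> a y (m, z))"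
      by (rule holevo_cong) (rule ker[symmetric])
    moreover have "holevo ?L ?Y' (benv Es (Suc t)) (bobv Es (Suc t)) = holevo ?L ?Y' (?F \<times> ?K \<times> ?Z) (\<lambda>y' (m, f, k, z). \<chi> f y' k (m, z))"
      by (rule holevo_cong) (rule ker'[symmetric])
    moreover have "holevo ?L ?Y' (?F \<times> ?K \<times> ?Z) (\<lambda>y' (m, f, k, z). \<chi> f y' k (m, z)) \<le> holevo ?L ?Y (?A \<times> ?Z) (\<lambda>y (m, a, z). \<psi> a y (m, z)) + chan_info ?A ?B ?K ?E ?\<rho>"
      by (rule hr(1)) auto
    ultimately show ?thesis by simp
  qed
  moreover have "finite (?Y \<times> ?L \<times> ?Z)" using fin by auto
  ultimately show "\<exists>(D :: (nat \<times> nat \<times> nat \<times> nat list) set) \<chi>. finite D \<and> (\<Sum>a\<in>?A. gram D \<chi> a a) = 1 \<and>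
      holevo ?L ?Y' (benv Es (Suc t)) (bobv Es (Suc t)) \<le> holevo ?L ?Y (benv Es t) (bobv Es t) + chan_info ?A ?B ?K ?E (gram D \<chi>)"
    by blast
qed

end

section \<open>The converse bound\<close>

context feedback_code
begin

section \<open>Growth of the Holevo quantity over all rounds\<close>

lemma gram_label_split: "gram ({..<M} \<times> Z) \<Psi> = (\<lambda>i j. \<Sum>m<M. gram ({m} \<times> Z) \<Psi> i j)"
  unfolding gram_def sum.cartesian_product' by simp

text \<open>Before any round Bob's state is the same for all messages. Each of the \<open>M\<close>
  parts carries weight \<open>1 / M\<close>, whose logarithm is the only contribution left; the true
  Holevo quantity 0 thus appears shifted by the entropy \<open>ln (real M)\<close> of the
  label.\<close>

lemma holevo_initial:
  assumes M: "M > 0"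
  shows "(\<Sum>y<yd c 0. gram ({..<M} \<times> benv Es 0) (bobv Es 0) y y) = 1"
    and "holevo {..<M} {..<yd c 0} (benv Es 0) (bobv Es 0) = - ln (real M)"
proof -
  have 0: "fd c 0 = 1" and iso: "isometry 1 (xd c 0 * yd c 0) (phi0 c)" using ok unfolding code_ok_def by auto
  have tr: "(\<Sum>y<yd c 0. bobk Es 0 0 y y) = 1"
  proof -
    have "(\<Sum>y<yd c 0. bobk Es 0 0 y y) = (\<Sum>y<yd c 0. \<Sum>j<xd c 0. cnj (phi0 c $$ (j * yd c 0 + y, 0)) * phi0 c $$ (j * yd c 0 + y, 0))"
      unfolding bobk_def gram_def sum.cartesian_product' by (simp add: 0 mult.commute)
    also have "\<dots> = (\<Sum>j<xd c 0. \<Sum>y<yd c 0. cnj (phi0 c $$ (j * yd c 0 + y, 0)) * phi0 c $$ (j * yd c 0 + y, 0))" by (rule sum.swap)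
    also have "\<dots> = 1" using isometry_entry_inner[OF iso, of 0 0] unfolding sum_lessThan_mult by simp
    finally show ?thesis .
  qed
  have "path_amp dB Es c m 0 = path_amp dB Es c 0 0" for m by (intro ext) simp
  then have const: "bobk Es 0 m = bobk Es 0 0" for m unfolding bobk_def by metis
  have g: "gram ({m} \<times> benv Es 0) (bobv Es 0) i j = of_real (1 / real M) * bobk Es 0 0 i j" for m i j
    unfolding gram_bobv by (subst const) (rule refl)
  have tot: "gram ({..<M} \<times> benv Es 0) (bobv Es 0) = bobk Es 0 0"
    unfolding gram_label_split g using M by simp
  show "(\<Sum>y<yd c 0. gram ({..<M} \<times> benv Es 0) (bobv Es 0) y y) = 1" unfolding tot by (rule tr)
  have part: "ent {..<yd c 0} (gram ({m} \<times> benv Es 0) (bobv Es 0)) = 1 / real M * ent {..<yd c 0} (bobk Es 0 0) - 1 / real M * ln (1 / real M)" for m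
    using ent_scale[OF finite_lessThan _ tr[unfolded bobk_def], of "1 / real M"] M unfolding g[abs_def] bobk_def by simp
  show "holevo {..<M} {..<yd c 0} (benv Es 0) (bobv Es 0) = - ln (real M)"
    unfolding holevo_def tot part using M by (simp add: ln_div field_simps)
qed

text \<open>The one-round estimates are accumulated. Mutual information is measured in bits and
  \<open>holevo\<close> in natural units, hence the factor \<open>ln 2\<close>; the 2 per bit round
  comes from \<open>chan_info_bit\<close>.\<close>

lemma holevo_code_bound:
  assumes ch: "is_channel dA dB Es" and M: "M > 0"
    and r: "\<And>\<rho>. density dA \<rho> \<Longrightarrow> mutual_info dA dB \<rho> Es \<le> r"
  shows "t \<le> n + b \<Longrightarrow> (\<Sum>y<yd c t. gram ({..<M} \<times> benv Es t) (bobv Es t) y y) = 1 \<and>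
    holevo {..<M} {..<yd c t} (benv Es t) (bobv Es t) \<le> (\<Sum>s\<in>{1..t}. if sched c s then r * ln 2 else 2) - ln (real M)"
proof (induction t)
  case 0
  then show ?case using holevo_initial[OF M] by simp
next
  case (Suc t)
  then have t: "t < n + b" and tr: "(\<Sum>y<yd c t. gram ({..<M} \<times> benv Es t) (bobv Es t) y y) = 1"
    and IH: "holevo {..<M} {..<yd c t} (benv Es t) (bobv Es t) \<le> (\<Sum>s\<in>{1..t}. if sched c s then r * ln 2 else 2) - ln (real M)" by auto
  note step = holevo_code_round[OF ch t tr]
  let ?I = "chan_info {..<in_dim dA c (Suc t)} {..<out_dim dB c (Suc t)} {..<length (round_kraus Es c (Suc t))} (kfun (round_kraus Es c (Suc t)))"
  obtain D :: "(nat \<times> nat \<times> nat \<times> nat list) set" and \<chi> where D: "finite D"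
    and trD: "(\<Sum>a<in_dim dA c (Suc t). gram D \<chi> a a) = 1"
    and le: "holevo {..<M} {..<yd c (Suc t)} (benv Es (Suc t)) (bobv Es (Suc t)) \<le> holevo {..<M} {..<yd c t} (benv Es t) (bobv Es t) + ?I (gram D \<chi>)"
    using step(2) by auto
  have "?I (gram D \<chi>) \<le> (if sched c (Suc t) then r * ln 2 else 2)"
  proof (cases "sched c (Suc t)")
    case True
    then have tr': "(\<Sum>a<dA. gram D \<chi> a a) = 1" using trD unfolding in_dim_def by simp
    have "chan_info {..<dA} {..<dB} {..<length Es} (kfun Es) (gram D \<chi>) / ln 2 \<le> r"
      using r[OF gram_density[OF refl tr']] unfolding mutual_info_chan_info[OF ch refl D tr'] .
    then show ?thesis using True unfolding in_dim_def out_dim_def round_kraus_def by (simp add: field_simps)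
  next
    case False
    then show ?thesis using chan_info_bit unfolding in_dim_def out_dim_def round_kraus_def by simp
  qed
  then show ?case using le IH step(1) by simp
qed

section \<open>Transferring zero error to a channel with smaller Choi-Kraus space\<close>

lemma round_op_linear:
  assumes m: "m < M" and t: "t < n + b"
    and E: "E \<in> carrier_mat (out_dim dB c (Suc t)) (in_dim dA c (Suc t))"
    and G: "\<And>q. q < N \<Longrightarrow> G q \<in> carrier_mat (out_dim dB c (Suc t)) (in_dim dA c (Suc t))"
    and lin: "\<And>\<beta> a. \<beta> < out_dim dB c (Suc t) \<Longrightarrow> a < in_dim dA c (Suc t) \<Longrightarrow> E $$ (\<beta>, a) = (\<Sum>q<N. d q * G q $$ (\<beta>, a))"
    and i: "i < xd c (Suc t) * fd c (Suc t) * yd c (Suc t)" and l: "l < xd c t * fd c t * yd c t"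
  shows "round_op dB c m (Suc t) E $$ (i, l) = (\<Sum>q<N. d q * round_op dB c m (Suc t) (G q) $$ (i, l))"
proof -
  let ?g = "fd c (Suc t) * yd c (Suc t)"
  have pos: "?g > 0" "yd c t > 0" using ok unfolding code_ok_def by auto
  define x where "x = i div ?g" define g where "g = i mod ?g" define j where "j = l div yd c t" define y where "y = l mod yd c t"
  have il: "i = x * ?g + g" "l = j * yd c t + y" unfolding x_def g_def j_def y_def by (simp_all only: div_mult_mod_eq)
  have b: "x < xd c (Suc t)" "g < ?g" "j < xd c t * fd c t" "y < yd c t"
    using i l pos unfolding x_def g_def j_def y_def by (auto simp: less_mult_imp_div_less mult.assoc)
  let ?f = "\<lambda>q \<beta> a. d q * (Wop c (Suc t) $$ (g, y * out_dim dB c (Suc t) + \<beta>) * G q $$ (\<beta>, a) * Uop c m (Suc t) $$ (a * xd c (Suc t) + x, j))"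
  have "round_op dB c m (Suc t) E $$ (i, l) = (\<Sum>\<beta><out_dim dB c (Suc t). \<Sum>a<in_dim dA c (Suc t). \<Sum>q<N. ?f q \<beta> a)"
    unfolding il round_op_entry[OF m t E b] by (intro sum.cong refl) (simp add: lin sum_distrib_left sum_distrib_right mult_ac)
  also have "\<dots> = (\<Sum>q<N. \<Sum>\<beta><out_dim dB c (Suc t). \<Sum>a<in_dim dA c (Suc t). ?f q \<beta> a)"
      by (rule sum_swap3)
  also have "\<dots> = (\<Sum>q<N. d q * round_op dB c m (Suc t) (G q) $$ (i, l))"
    unfolding il by (intro sum.cong refl) (simp add: round_op_entry[OF m t G b] sum_distrib_left)
  finally show ?thesis .
qed

text \<open>Rounds are linear in their Kraus operator, so coefficients multiply along a word. It is
  essential that \<open>\<gamma>\<close> does not depend on the register index \<open>i\<close>: the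
  relation then remains a linear combination of vectors on Bob's register.\<close>

lemma path_amp_span:
  assumes Es: "\<And>E. E \<in> set Es \<Longrightarrow> E \<in> carrier_mat dB dA" and Fs: "\<And>F. F \<in> set Fs \<Longrightarrow> F \<in> carrier_mat dB dA"
    and span: "\<And>F. F \<in> set Fs \<Longrightarrow> \<exists>d. \<forall>\<beta><dB. \<forall>a<dA. F $$ (\<beta>, a) = (\<Sum>q<length Es. d q * Es ! q $$ (\<beta>, a))"
  shows "t \<le> n + b \<Longrightarrow> u \<in> words Fs c t \<Longrightarrow> \<exists>\<gamma>. \<forall>m<M. \<forall>i < xd c t * fd c t * yd c t.
    path_amp dB Fs c m t i u = (\<Sum>v\<in>words Es c t. \<gamma> v * path_amp dB Es c m t i v)"
proof (induction t arbitrary: u)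
  case 0
  then show ?case by (intro exI[of _ "\<lambda>_. 1"]) simp
next
  case (Suc t)
  let ?F = "round_kraus Fs c (Suc t)" and ?E = "round_kraus Es c (Suc t)"
  let ?db = "out_dim dB c (Suc t)" and ?da = "in_dim dA c (Suc t)"
  from Suc.prems obtain k w where u: "u = k # w" and k: "k < length ?F" and w: "w \<in> words Fs c t" by auto
  have t: "t < n + b" using Suc.prems by simp
  obtain \<gamma> where \<gamma>: "\<And>m i. m < M \<Longrightarrow> i < xd c t * fd c t * yd c t \<Longrightarrow> path_amp dB Fs c m t i w = (\<Sum>v\<in>words Es c t. \<gamma> v * path_amp dB Es c m t i v)"
    using Suc.IH[OF _ w] t by auto
  have "\<exists>d. \<forall>\<beta><?db. \<forall>a<?da. (?F ! k) $$ (\<beta>, a) = (\<Sum>q<length ?E. d q * ?E ! q $$ (\<beta>, a))"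
  proof (cases "sched c (Suc t)")
    case True
    then show ?thesis using span[of "?F ! k"] k nth_mem[of k Fs] unfolding round_kraus_def out_dim_def in_dim_def by simp
  next
    \<comment> \<open>The bit channel has the same Kraus operators in both codes, so a Kronecker
      delta serves as coefficients.\<close>
    case False
    then have k': "k < length bit_kraus" using k unfolding round_kraus_def by simp
    have "bit_kraus ! k $$ (\<beta>, a) = (\<Sum>q<length bit_kraus. (if q = k then 1 else 0) * bit_kraus ! q $$ (\<beta>, a))" for \<beta> a
      using k' by (simp add: if_distrib[of "\<lambda>x. x * _"] cong: if_cong)
    then show ?thesis using False unfolding round_kraus_def by (intro exI[of _ "\<lambda>q. if q = k then 1 else 0"]) simp
  qed
  then obtain d where d: "\<And>\<beta> a. \<beta> < ?db \<Longrightarrow> a < ?da \<Longrightarrow> (?F ! k) $$ (\<beta>, a) = (\<Sum>q<length ?E. d q * ?E ! q $$ (\<beta>, a))" by blast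
  have Fk: "?F ! k \<in> carrier_mat ?db ?da" by (rule round_kraus_carrier[OF Fs]) (use k in auto)
  have Eq: "?E ! q \<in> carrier_mat ?db ?da" if "q < length ?E" for q by (rule round_kraus_carrier[OF Es]) (use that in auto)
  have "path_amp dB Fs c m (Suc t) i u = (\<Sum>v\<in>words Es c (Suc t). (d (hd v) * \<gamma> (tl v)) * path_amp dB Es c m (Suc t) i v)"
    if m: "m < M" and i: "i < xd c (Suc t) * fd c (Suc t) * yd c (Suc t)" for m i
  proof -
    let ?L = "{..<xd c t * fd c t * yd c t}"
    let ?f = "\<lambda>l q v. d q * \<gamma> v * (round_op dB c m (Suc t) (?E ! q) $$ (i, l) * path_amp dB Es c m t l v)"
    have "path_amp dB Fs c m (Suc t) i u = (\<Sum>l\<in>?L. (\<Sum>q<length ?E. d q * round_op dB c m (Suc t) (?E ! q) $$ (i, l)) * (\<Sum>v\<in>words Es c t. \<gamma> v * path_amp dB Es c m t l v))"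
      unfolding u path_amp.simps list.sel using m
      by (intro sum.cong refl arg_cong2[where f = "(*)"] round_op_linear[OF m t Fk Eq d i] \<gamma>) auto
    also have "\<dots> = (\<Sum>l\<in>?L. \<Sum>q<length ?E. \<Sum>v\<in>words Es c t. ?f l q v)"
      unfolding sum_product by (simp add: mult_ac)
    also have "\<dots> = (\<Sum>q<length ?E. \<Sum>v\<in>words Es c t. \<Sum>l\<in>?L. ?f l q v)"
      by (rule sum_swap3[symmetric])
    finally show ?thesis unfolding sum_words_Suc by (simp add: sum_distrib_left)
  qed
  then show ?case by (intro exI[of _ "\<lambda>v. d (hd v) * \<gamma> (tl v)"]) auto
qed

end

text \<open>The trace of the product of two Gram kernels is the sum of the squared overlaps of their
  columns. Its vanishing turns orthogonality of supports into orthogonality of the individual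
  amplitude vectors, which is stable under linear combinations.\<close>

lemma gram_product_zero:
  assumes fin: "finite I" "finite E" "finite E'"
    and z: "\<And>i. i \<in> I \<Longrightarrow> (\<Sum>l\<in>I. gram E \<Psi> i l * gram E' \<Phi> l i) = 0"
    and e: "e \<in> E" "e' \<in> E'"
  shows "ip I (\<lambda>i. \<Psi> i e) (\<lambda>i. \<Phi> i e') = 0"
proof -
  have "(\<Sum>i\<in>I. \<Sum>l\<in>I. gram E \<Psi> i l * gram E' \<Phi> l i) = (\<Sum>i\<in>I. \<Sum>l\<in>I. \<Sum>e'\<in>E'. cnj (\<Phi> i e') * gram E \<Psi> i l * \<Phi> l e')"
    unfolding gram_def[of E'] sum_distrib_left by (simp add: mult_ac)
  also have "\<dots> = (\<Sum>e'\<in>E'. \<Sum>i\<in>I. \<Sum>l\<in>I. cnj (\<Phi> i e') * gram E \<Psi> i l * \<Phi> l e')"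
      by (rule sum_swap3)
  also have "\<dots> = of_real (\<Sum>e'\<in>E'. \<Sum>e\<in>E. (cmod (ip I (\<lambda>i. \<Phi> i e') (\<lambda>i. \<Psi> i e)))\<^sup>2)"
    unfolding gram_form complex_mult_cnj_cmod2 by simp
  finally have "complex_of_real (\<Sum>e'\<in>E'. \<Sum>e\<in>E. (cmod (ip I (\<lambda>i. \<Phi> i e') (\<lambda>i. \<Psi> i e)))\<^sup>2) = 0" using z by simp
  then have "(\<Sum>e'\<in>E'. \<Sum>e\<in>E. (cmod (ip I (\<lambda>i. \<Phi> i e') (\<lambda>i. \<Psi> i e)))\<^sup>2) = 0" using of_real_eq_0_iff by blast
  then have "(\<Sum>e\<in>E. (cmod (ip I (\<lambda>i. \<Phi> i e') (\<lambda>i. \<Psi> i e)))\<^sup>2) = 0"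
    using fin e by (subst (asm) sum_nonneg_eq_0_iff) (auto intro: sum_nonneg)
  then have "(cmod (ip I (\<lambda>i. \<Phi> i e') (\<lambda>i. \<Psi> i e)))\<^sup>2 = 0" using fin e by (subst (asm) sum_nonneg_eq_0_iff) auto
  then show ?thesis using cmod_ip_commute[of I "\<lambda>i. \<Phi> i e'" "\<lambda>i. \<Psi> i e"] by simp
qed

lemma gram_product_zeroI:
  assumes "\<And>e e'. e \<in> E \<Longrightarrow> e' \<in> E' \<Longrightarrow> ip I (\<lambda>i. \<Psi> i e) (\<lambda>i. \<Phi> i e') = 0"
  shows "(\<Sum>l\<in>I. gram E \<Psi> i l * gram E' \<Phi> l j) = 0"
proof -
  have "(\<Sum>l\<in>I. gram E \<Psi> i l * gram E' \<Phi> l j) = (\<Sum>l\<in>I. \<Sum>e\<in>E. \<Sum>e'\<in>E'. \<Psi> i e * cnj (\<Phi> j e') * (cnj (\<Psi> l e) * \<Phi> l e'))"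
    unfolding gram_def sum_product by (simp add: mult_ac)
  also have "\<dots> = (\<Sum>e\<in>E. \<Sum>e'\<in>E'. \<Sum>l\<in>I. \<Psi> i e * cnj (\<Phi> j e') * (cnj (\<Psi> l e) * \<Phi> l e'))"
      by (rule sum_swap3[symmetric])
  also have "\<dots> = (\<Sum>e\<in>E. \<Sum>e'\<in>E'. \<Psi> i e * cnj (\<Phi> j e') * ip I (\<lambda>i. \<Psi> i e) (\<lambda>i. \<Phi> i e'))"
    unfolding ip_def sum_distrib_left ..
  finally show ?thesis using assms by simp
qed

text \<open>\<open>mspan\<close> allows a matrix to be listed repeatedly; here every multiple of
  \<open>E\<close> is credited to one chosen position of \<open>E\<close> in
  \<open>Es\<close>.\<close>

lemma mspan_coeffs:
  assumes F: "F \<in> mspan r c (set Es)" and Es: "\<And>E. E \<in> set Es \<Longrightarrow> E \<in> carrier_mat r c"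
  shows "\<exists>d. \<forall>\<beta><r. \<forall>a<c. F $$ (\<beta>, a) = (\<Sum>q<length Es. d q * Es ! q $$ (\<beta>, a))"
proof -
  obtain cs where cs: "set (map snd cs) \<subseteq> set Es" and Fe: "F = msum r c (map (\<lambda>(c, E). c \<cdot>\<^sub>m E) cs)"
    using F unfolding mspan_def by blast
  have "msum r c (map (\<lambda>(c, E). c \<cdot>\<^sub>m E) cs) \<in> carrier_mat r c \<and> (\<exists>d. \<forall>\<beta><r. \<forall>a<c. msum r c (map (\<lambda>(c, E). c \<cdot>\<^sub>m E) cs) $$ (\<beta>, a) = (\<Sum>q<length Es. d q * Es ! q $$ (\<beta>, a)))"
    using cs
  proof (induction cs)
    case Nil
    then show ?case by (auto simp: msum_def intro!: exI[of _ "\<lambda>_. 0"])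
  next
    case (Cons x cs)
    obtain e E where x: "x = (e, E)" by (cases x)
    let ?S = "msum r c (map (\<lambda>(c, E). c \<cdot>\<^sub>m E) cs)"
    obtain d where S: "?S \<in> carrier_mat r c" and d: "\<And>\<beta> a. \<beta> < r \<Longrightarrow> a < c \<Longrightarrow> ?S $$ (\<beta>, a) = (\<Sum>q<length Es. d q * Es ! q $$ (\<beta>, a))"
      using Cons by auto
    have "E \<in> set Es" using Cons.prems x by auto
    then obtain p where p: "p < length Es" "Es ! p = E" by (metis in_set_conv_nth)
    have E: "E \<in> carrier_mat r c" using Es \<open>E \<in> set Es\<close> .
    have eq: "msum r c (map (\<lambda>(c, E). c \<cdot>\<^sub>m E) (x # cs)) = e \<cdot>\<^sub>m E + ?S" unfolding msum_def x by simp
    have "(e \<cdot>\<^sub>m E + ?S) $$ (\<beta>, a) = (\<Sum>q<length Es. (d q + (if q = p then e else 0)) * Es ! q $$ (\<beta>, a))" if "\<beta> < r" "a < c" for \<beta> a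
    proof -
      have "(\<Sum>q<length Es. (d q + (if q = p then e else 0)) * Es ! q $$ (\<beta>, a))
         = (\<Sum>q<length Es. d q * Es ! q $$ (\<beta>, a)) + (\<Sum>q<length Es. if q = p then e * E $$ (\<beta>, a) else 0)"
        unfolding sum.distrib[symmetric] using p by (intro sum.cong refl) (auto simp: distrib_right)
      then show ?thesis using d[OF that] p E S that by simp
    qed
    then show ?case unfolding eq using E S by (intro conjI exI[of _ "\<lambda>q. d q + (if q = p then e else 0)"]) auto
  qed
  then show ?thesis unfolding Fe by blast
qed

lemma in_mspan: "F \<in> S \<Longrightarrow> F \<in> carrier_mat r c \<Longrightarrow> F \<in> mspan r c S"
  unfolding mspan_def msum_def by (auto intro!: exI[of _ "[(1, F)]"])

text \<open>The hypothesis on the code speaks about \<open>Es\<close> only, while the information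
  bound is wanted for \<open>Fs\<close>. Orthogonality is therefore brought to the level of
  amplitude vectors, extended to \<open>Fs\<close> by linearity, and returned to kernels.\<close>

lemma zero_error_message_bound:
  assumes ok: "code_ok dA dB n b M c" and M: "M > 0"
    and ze: "zero_error dA dB K n b M c" and E: "is_channel dA dB Es" "kraus_space dA dB Es = K"
    and F: "is_channel dA dB Fs" "kraus_space dA dB Fs \<subseteq> K"
    and r: "\<And>\<rho>. density dA \<rho> \<Longrightarrow> mutual_info dA dB \<rho> Fs \<le> r"
  shows "log 2 (real M) \<le> real n * r + 2 * real b / ln 2"
proof -
  interpret feedback_code dA dB n b M c by unfold_locales (rule ok)
  let ?T = "n + b"
  let ?Y = "{..<yd c ?T}"
  have Es: "\<And>X. X \<in> set Es \<Longrightarrow> X \<in> carrier_mat dB dA" and Fs: "\<And>X. X \<in> set Fs \<Longrightarrow> X \<in> carrier_mat dB dA"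
    using E F unfolding is_channel_def by auto
  have span: "\<exists>d. \<forall>\<beta><dB. \<forall>a<dA. X $$ (\<beta>, a) = (\<Sum>q<length Es. d q * Es ! q $$ (\<beta>, a))" if "X \<in> set Fs" for X
  proof (rule mspan_coeffs)
    have "X \<in> kraus_space dA dB Fs" unfolding kraus_space_def by (rule in_mspan) (use that Fs in auto)
    then show "X \<in> mspan dB dA (set Es)" using E F unfolding kraus_space_def by auto
  qed (rule Es)
  define P where "P = (\<lambda>Gs m y (j, w). path_amp dB Gs c m ?T (j * yd c ?T + y) w)"
  let ?J = "{..<xd c ?T * fd c ?T}"
  have bk: "bobk Gs ?T m = gram (?J \<times> words Gs c ?T) (P Gs m)" for Gs m unfolding bobk_def P_def ..
  have fin: "finite (?J \<times> words Gs c ?T)" for Gs using finite_words by auto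
  have orthE: "ip ?Y (\<lambda>y. P Es m y e) (\<lambda>y. P Es m' y e') = 0"
    if m: "m < M" "m' < M" "m \<noteq> m'" and e: "e \<in> ?J \<times> words Es c ?T" "e' \<in> ?J \<times> words Es c ?T" for m m' e e'
  proof (rule gram_product_zero[OF _ fin fin _ e])
    fix i assume "i \<in> ?Y"
    then have i: "i < yd c ?T" by simp
    let ?B = "\<lambda>m. bob_state dB Es c m ?T"
    have Bc: "?B m \<in> carrier_mat (yd c ?T) (yd c ?T)" for m unfolding bob_state_def ptrace1_def by simp
    \<comment> \<open>Testing orthogonality of supports on a basis vector on both sides gives one
      diagonal entry of the product of Bob's states; the diagonal is all that the trace argument
      uses.\<close>
    define u where "u = mat (yd c ?T) 1 (\<lambda>(k, _). if k = i then 1 else 0 :: complex)"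
    have u: "u \<in> carrier_mat (yd c ?T) 1" unfolding u_def by simp
    have Bu: "(?B m * u) $$ (l, 0) = bobk Es ?T m l i" if "l < yd c ?T" "m < M" for m l
    proof -
      have "(?B m * u) $$ (l, 0) = (\<Sum>k<yd c ?T. if k = i then ?B m $$ (l, i) else 0)"
        unfolding mult_mat_entry[OF Bc u that(1) less_one[THEN iffD2, OF refl]] by (intro sum.cong refl) (auto simp: u_def)
      also have "\<dots> = ?B m $$ (l, i)" using i by simp
      finally show ?thesis using bob_state_entry[OF Es that(2) order.refl that(1) i] by simp
    qed
    have "adj (?B m * u) * (?B m' * u) = 0\<^sub>m 1 1"
      using ze E m u unfolding zero_error_def orth_supp_def by blast
    then have "0 = (adj (?B m * u) * (?B m' * u)) $$ (0, 0)" by simp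
    also have "\<dots> = (\<Sum>l<yd c ?T. cnj (bobk Es ?T m l i) * bobk Es ?T m' l i)"
      unfolding mult_mat_entry[OF adj_carrier[OF mult_carrier_mat[OF Bc u]] mult_carrier_mat[OF Bc u] less_one[THEN iffD2, OF refl] less_one[THEN iffD2, OF refl]]
      by (intro sum.cong refl) (simp add: adj_entry[OF mult_carrier_mat[OF Bc u]] Bu m)
    also have "\<dots> = (\<Sum>l<yd c ?T. bobk Es ?T m i l * bobk Es ?T m' l i)"
      unfolding bobk_def gram_herm[symmetric] ..
    finally show "(\<Sum>l\<in>?Y. gram (?J \<times> words Es c ?T) (P Es m) i l * gram (?J \<times> words Es c ?T) (P Es m') l i) = 0"
      unfolding bk by simp
  qed simp
  have orthF: "ip ?Y (\<lambda>y. P Fs m y e) (\<lambda>y. P Fs m' y e') = 0"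
    if m: "m < M" "m' < M" "m \<noteq> m'" and e: "e \<in> ?J \<times> words Fs c ?T" "e' \<in> ?J \<times> words Fs c ?T" for m m' e e'
  proof -
    obtain j w j' w' where ee: "e = (j, w)" "e' = (j', w')" by (cases e, cases e')
    have jw: "j \<in> ?J" "w \<in> words Fs c ?T" "j' \<in> ?J" "w' \<in> words Fs c ?T" using e unfolding ee by auto
    have lt: "j * yd c ?T + y < xd c ?T * fd c ?T * yd c ?T" if "j \<in> ?J" "y \<in> ?Y" for j y using that by (auto intro: mult_add_less)
    obtain \<gamma> where \<gamma>: "\<And>m i. m < M \<Longrightarrow> i < xd c ?T * fd c ?T * yd c ?T \<Longrightarrow> path_amp dB Fs c m ?T i w = (\<Sum>v\<in>words Es c ?T. \<gamma> v * path_amp dB Es c m ?T i v)"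
      using path_amp_span[OF Es Fs span order.refl jw(2)] by blast
    obtain \<gamma>' where \<gamma>': "\<And>m i. m < M \<Longrightarrow> i < xd c ?T * fd c ?T * yd c ?T \<Longrightarrow> path_amp dB Fs c m ?T i w' = (\<Sum>v\<in>words Es c ?T. \<gamma>' v * path_amp dB Es c m ?T i v)"
      using path_amp_span[OF Es Fs span order.refl jw(4)] by blast
    have "ip ?Y (\<lambda>y. P Fs m y e) (\<lambda>y. P Fs m' y e')
      = ip ?Y (\<lambda>y. \<Sum>v\<in>words Es c ?T. \<gamma> v * P Es m y (j, v)) (\<lambda>y. \<Sum>v\<in>words Es c ?T. \<gamma>' v * P Es m' y (j', v))"
      unfolding ee P_def prod.case using \<gamma>[OF m(1) lt[OF jw(1)]] \<gamma>'[OF m(2) lt[OF jw(3)]] by (intro ip_cong) auto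
    also have "\<dots> = (\<Sum>v\<in>words Es c ?T. cnj (\<gamma> v) * (\<Sum>v'\<in>words Es c ?T. \<gamma>' v' * ip ?Y (\<lambda>y. P Es m y (j, v)) (\<lambda>y. P Es m' y (j', v'))))"
      unfolding ip_sum_left ip_sum_right ..
    also have "\<dots> = 0" using jw by (intro sum.neutral ballI mult_eq_0_iff[THEN iffD2] disjI2) (auto intro!: orthE[OF m])
    finally show ?thesis .
  qed
  let ?G = "\<lambda>m. gram ({m} \<times> benv Fs ?T) (bobv Fs ?T)"
  have "(\<Sum>l\<in>?Y. ?G m i l * ?G m' l j) = 0" if "m < M" "m' < M" "m \<noteq> m'" for m m' i j
  proof -
    have "(\<Sum>l\<in>?Y. ?G m i l * ?G m' l j) = of_real (1 / real M) * of_real (1 / real M) * (\<Sum>l\<in>?Y. bobk Fs ?T m i l * bobk Fs ?T m' l j)"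
      unfolding gram_bobv sum_distrib_left by (simp add: mult_ac)
    also have "(\<Sum>l\<in>?Y. bobk Fs ?T m i l * bobk Fs ?T m' l j) = 0"
      unfolding bk using orthF[OF that] by (rule gram_product_zeroI)
    finally show ?thesis by simp
  qed
  \<comment> \<open>For orthogonal signals the entropy of the mixture is the sum of the entropies of
    its unnormalised parts, so the final value of \<open>holevo\<close> is 0, against
    \<open>- ln (real M)\<close> at the start.\<close>
  then have "ent ?Y (\<lambda>i j. \<Sum>m<M. ?G m i j) = (\<Sum>m<M. ent ?Y (?G m))" by (intro ent_orthogonal_sum) auto
  then have "0 = holevo {..<M} ?Y (benv Fs ?T) (bobv Fs ?T)"
    unfolding holevo_def gram_label_split by simp
  also have "\<dots> \<le> (\<Sum>s\<in>{1..?T}. if sched c s then r * ln 2 else 2) - ln (real M)"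
    using holevo_code_bound[OF F(1) M r order.refl] by blast
  also have "(\<Sum>s\<in>{1..?T}. if sched c s then r * ln 2 else 2) = real n * (r * ln 2) + 2 * real b"
  proof -
    have n: "card {s \<in> {1..?T}. sched c s} = n" using ok unfolding code_ok_def by blast
    have "{1..?T} = {s \<in> {1..?T}. sched c s} \<union> {s \<in> {1..?T}. \<not> sched c s}" by auto
    moreover have "card ({s \<in> {1..?T}. sched c s} \<union> {s \<in> {1..?T}. \<not> sched c s}) = card {s \<in> {1..?T}. sched c s} + card {s \<in> {1..?T}. \<not> sched c s}"
      by (rule card_Un_disjoint) auto
    ultimately have "card {1..?T} = card {s \<in> {1..?T}. sched c s} + card {s \<in> {1..?T}. \<not> sched c s}" by metis
    then have b: "card {s \<in> {1..?T}. \<not> sched c s} = b" unfolding n by simp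
    have "(\<Sum>s\<in>{1..?T}. if sched c s then r * ln 2 else 2) = real (card {s \<in> {1..?T}. sched c s}) * (r * ln 2) + real (card {s \<in> {1..?T}. \<not> sched c s}) * 2"
      by (subst sum.If_cases) (auto simp: Int_def Collect_neg_eq[symmetric] conj_commute)
    then show ?thesis unfolding n b by simp
  qed
  \<comment> \<open>Conversion to bits divides by \<open>ln 2\<close>, which cancels in the channel
    term and remains in the bit term.\<close>
  finally have "ln (real M) \<le> real n * (r * ln 2) + 2 * real b" by simp
  then show ?thesis unfolding log_def by (simp add: field_simps)
qed

text \<open>The input \<open>|0\<rangle>\<close>; the bound is the single-message case of the Holevo estimate.\<close>
lemma chan_info_pure_nonneg:
  fixes E :: "'k \<Rightarrow> 'b \<Rightarrow> nat \<Rightarrow> complex"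
  assumes fin: "finite B" "finite K" and dA: "dA > 0"
    and E: "\<And>a a'. a < dA \<Longrightarrow> a' < dA \<Longrightarrow> (\<Sum>x\<in>B \<times> K. cnj (E (snd x) (fst x) a) * E (snd x) (fst x) a') = (if a = a' then 1 else 0)"
  shows "0 \<le> chan_info {..<dA} B K E (gram {()} (\<lambda>a _. if a = 0 then 1 else 0))"
proof -
  define \<psi> where "\<psi> = (\<lambda>(a :: nat) (y :: unit) (e :: unit \<times> unit). if a = 0 then 1 else 0 :: complex)"
  \<comment> \<open>The receiver only renames \<open>(b, ())\<close> to
    \<open>((), b)\<close>.\<close>
  define W where "W = (\<lambda>(g :: unit \<times> 'b) (x :: 'b \<times> unit). if snd g = fst x then 1 else 0 :: complex)"
  define \<chi> where "\<chi> = (\<lambda>f y' k e. \<Sum>x\<in>B \<times> {()}. W (f, y') x * (\<Sum>a<dA. E k (fst x) a * \<psi> a (snd x) e))"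
  \<comment> \<open>A single message carries no information, so both Holevo quantities in the round
    inequality vanish and only \<open>chan_info\<close> is left on the larger side.\<close>
  have h: "holevo {()} I Z Q = 0" for I :: "'i set" and Z :: "'z set" and Q unfolding holevo_def by simp
  have "holevo {()} B ({()} \<times> K \<times> {()}) (\<lambda>y' (m, f, k, z). \<chi> f y' k (m, z))
    \<le> holevo {()} {()} ({..<dA} \<times> {()}) (\<lambda>y (m, a, z). \<psi> a y (m, z))
      + chan_info {..<dA} B K E (gram ({()} \<times> {()} \<times> {()}) (\<lambda>a (y, e). \<psi> a y e))"
  proof (rule holevo_round(1)[where W = W])
    show "(\<Sum>y\<in>{()}. gram ({()} \<times> {..<dA} \<times> {()}) (\<lambda>y (m, a, z). \<psi> a y (m, z)) y y) = 1"
      using dA unfolding \<psi>_def gram_def by (simp add: sum.cartesian_product' if_distrib[of "\<lambda>x. x * _"] cong: if_cong)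
    show "(\<Sum>g\<in>{()} \<times> B. cnj (W g x) * W g x') = (if x = x' then 1 else 0)" if "x \<in> B \<times> {()}" for x x'
    proof -
      have "(\<Sum>g\<in>{()} \<times> B. cnj (W g x) * W g x') = (\<Sum>b\<in>B. if b = fst x then if x = x' then 1 else 0 else 0)"
        unfolding sum.cartesian_product' W_def by (auto simp: prod_eq_iff intro!: sum.cong)
      then show ?thesis using that fin by auto
    qed
    show "\<chi> f y' k e = (\<Sum>x\<in>B \<times> {()}. W (f, y') x * (\<Sum>a<dA. E k (fst x) a * \<psi> a (snd x) e))" for f y' k e
      unfolding \<chi>_def ..
  qed (use fin E in auto)
  moreover have "gram ({()} \<times> {()} \<times> {()}) (\<lambda>a (y, e). \<psi> a y e) = gram {()} (\<lambda>a _. if a = 0 then 1 else 0)"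
    by (intro ext) (simp add: gram_def \<psi>_def)
  ultimately show ?thesis unfolding h by simp
qed

text \<open>This rules out the value minus infinity for the supremum and makes the bounds on
  \<open>M_f\<close> non-negative, so that they also cover the degenerate numbers of messages.
  Positivity of \<open>dA\<close> provides an input state.\<close>

lemma C_E_nonneg:
  assumes ch: "is_channel dA dB Es" and dA: "dA > 0"
  shows "0 \<le> C_E dA dB Es"
proof -
  define \<rho> where "\<rho> = mat dA dA (\<lambda>(i, j). gram {()} (\<lambda>a _. if a = 0 then 1 else 0) i j)"
  have tr: "(\<Sum>i<dA. gram {()} (\<lambda>a _. if a = 0 then 1 else 0) i i) = 1"
    unfolding gram_def using dA by (simp add: if_distrib[of "\<lambda>x. x * _"] cong: if_cong)
  have "0 \<le> mutual_info dA dB \<rho> Es"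
    unfolding mutual_info_chan_info[OF ch \<rho>_def finite.insertI[OF finite.emptyI] tr]
    using chan_info_pure_nonneg[OF finite_lessThan finite_lessThan dA is_channel_kfun[OF ch]] by simp
  moreover have "ereal (mutual_info dA dB \<rho> Es) \<le> C_E dA dB Es"
    unfolding C_E_def by (intro Sup_upper) (use gram_density[OF \<rho>_def tr] in blast)
  ultimately show ?thesis by (metis ereal_less_eq(5) order_trans)
qed

text \<open>\<open>GREATEST\<close> of an empty or unbounded predicate is an unspecified constant, which does not
  depend on the predicate.\<close>
lemma Greatest_nat_cases:
  fixes P :: "nat \<Rightarrow> bool"
  shows "(P (Greatest P) \<and> (\<forall>y. P y \<longrightarrow> y \<le> Greatest P)) \<or> Greatest P = (THE x. False)"
proof (cases "\<exists>x. P x \<and> (\<forall>y. P y \<longrightarrow> y \<le> x)")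
  case True
  then obtain x where x: "P x" "\<And>y. P y \<Longrightarrow> y \<le> x" by blast
  then have "Greatest P = x" by (intro Greatest_equality)
  then show ?thesis using x by simp
next
  case False
  then have "(\<lambda>x. P x \<and> (\<forall>y. P y \<longrightarrow> y \<le> x)) = (\<lambda>x. False)" by (intro ext) metis
  then show ?thesis unfolding Greatest_def by simp
qed

text \<open>If no channel has Choi-Kraus space exactly \<open>K\<close>, the zero-error condition is vacuous and every number
  of messages is admissible as soon as one is.\<close>
lemma M_f_bound:
  assumes F: "is_channel dA dB Fs" "kraus_space dA dB Fs \<subseteq> K"
    and r: "\<And>\<rho>. density dA \<rho> \<Longrightarrow> mutual_info dA dB \<rho> Fs \<le> r" and r0: "r \<ge> 0"
  shows "log 2 (real (M_f dA dB K b n)) \<le> \<bar>log 2 (real (THE x. False))\<bar> + real n * r + 2 * real b / ln 2"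
proof -
  define P where "P = (\<lambda>M. \<exists>c. code_ok dA dB n b M c \<and> zero_error dA dB K n b M c)"
  define G where "G = M_f dA dB K b n"
  have G: "G = Greatest P" unfolding G_def M_f_def P_def ..
  have pos: "0 \<le> real n * r + 2 * real b / ln 2" using r0 by simp
  consider "G = (THE x. False)" | "P G" "\<And>y. P y \<Longrightarrow> y \<le> G" using Greatest_nat_cases[of P] unfolding G by blast
  then show ?thesis
  proof cases
    case 1
    then show ?thesis using pos unfolding G_def[symmetric] by simp
  next
    case 2
    then obtain c where c: "code_ok dA dB n b G c" "zero_error dA dB K n b G c" unfolding P_def by blast
    show ?thesis
    proof (cases "G = 0")
      case True
      \<comment> \<open>The logarithm of 0 takes the default value 0.\<close>
      then have "log 2 (real G) = 0" by (simp add: log_def)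
      then show ?thesis using pos unfolding G_def[symmetric] by linarith
    next
      case False
      have "\<exists>Es. is_channel dA dB Es \<and> kraus_space dA dB Es = K"
      proof (rule ccontr)
        assume no: "\<not> ?thesis"
        \<comment> \<open>A further message is added by letting all messages use the encoder of
          message 0, which consists of isometries because \<open>G\<close> is positive.\<close>
        have "code_ok dA dB n b (Suc G) (c\<lparr>Uop := \<lambda>m. Uop c 0\<rparr>)"
          using c(1) False unfolding code_ok_def in_dim_def out_dim_def by auto
        moreover have "zero_error dA dB K n b (Suc G) c'" for c' using no unfolding zero_error_def by blast
        ultimately have "P (Suc G)" unfolding P_def by blast
        then show False using 2(2) by fastforce
      qed
      then obtain Es where Es: "is_channel dA dB Es" "kraus_space dA dB Es = K" by blast
      have "log 2 (real G) \<le> real n * r + 2 * real b / ln 2"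
        using False by (intro zero_error_message_bound[OF c(1) _ c(2) Es F r]) auto
      then show ?thesis unfolding G_def[symmetric] by linarith
    qed
  qed
qed

theorem theorem10:
  fixes dA dB :: nat and K :: "complex mat set"
  assumes "ncbg dA dB K"
  shows "C0EF_act dA dB K \<le> C_minE dA dB K"
proof -
  have dA: "dA > 0" using assms unfolding ncbg_def by simp
  have "limsup (\<lambda>n. ereal (log 2 (real (M_f dA dB K b n)) / real n)) \<le> C_E dA dB Fs"
    if F: "is_channel dA dB Fs" "kraus_space dA dB Fs \<subseteq> K" for b Fs
  proof (cases "C_E dA dB Fs")
    case (real r)
    have r0: "r \<ge> 0" using C_E_nonneg[OF F(1) dA] unfolding real by simp
    have r: "mutual_info dA dB \<rho> Fs \<le> r" if "density dA \<rho>" for \<rho>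
    proof -
      have "ereal (mutual_info dA dB \<rho> Fs) \<le> C_E dA dB Fs" unfolding C_E_def by (intro Sup_upper) (use that in blast)
      then show ?thesis unfolding real by simp
    qed
    \<comment> \<open>Everything in the bound that does not grow with \<open>n\<close>: the value of
      an undefined maximum and the contribution of the \<open>b\<close> noiseless bits. Division by
      \<open>n\<close> removes it in the limit.\<close>
    define C where "C = \<bar>log 2 (real (THE x. False))\<bar> + 2 * real b / ln 2"
    have "(\<lambda>n. C / real n + r) \<longlonglongrightarrow> 0 + r"
      by (intro tendsto_add tendsto_const lim_const_over_n)
    then have "(\<lambda>n. ereal (C / real n + r)) \<longlonglongrightarrow> ereal r" by simp
    then have lim: "limsup (\<lambda>n. ereal (C / real n + r)) = ereal r" by (intro lim_imp_Limsup) auto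
    have "limsup (\<lambda>n. ereal (log 2 (real (M_f dA dB K b n)) / real n)) \<le> limsup (\<lambda>n. ereal (C / real n + r))"
    proof (rule Limsup_mono)
      show "\<forall>\<^sub>F n in sequentially. ereal (log 2 (real (M_f dA dB K b n)) / real n) \<le> ereal (C / real n + r)"
        using eventually_gt_at_top[of "0 :: nat"]
      proof eventually_elim
        case (elim n)
        have "log 2 (real (M_f dA dB K b n)) \<le> C + real n * r"
          using M_f_bound[OF F r r0] unfolding C_def by (simp add: algebra_simps)
        then show ?case using elim by (simp add: field_simps)
      qed
    qed
    then show ?thesis unfolding lim real .
  next
    case PInf
    then show ?thesis by simp
  next
    case MInf
    then show ?thesis using C_E_nonneg[OF F(1) dA] by simp
  qed
  then show ?thesis unfolding C0EF_act_def C_minE_def by (intro SUP_least Inf_greatest) blast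
qed

end
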